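(* Let $k$ be a local field, $d\ge2$, $V=k^d$, and $\mu$ a probability measure on $SL_d(k)$ with an exponential local moment such that $\Gamma_\mu$ is strongly irreducible. Let $S_n=X_n\cdots X_1$ with $(X_i)$ i.i.d. of law $\mu$. Then for every $\gamma>0$ there exist $\epsilon(\gamma)>0$ and $n(\gamma)\in\mathbb N^*$ such that for $0<\epsilon<\epsilon(\gamma)$ and $n>n(\gamma)$, $$\sup_{x\in V;\,\|x\|=1}\mathbb E\Big[\Big(\frac{\|S_n\|}{\|S_nx\|}\Big)^\epsilon\Big]\le(1+\epsilon\gamma)^n .$$ In particular, for every $\epsilon>0$, $$\limsup_{n\to\infty}\Big[\sup_{x\in V;\,\|x\|=1}\mathbb P\Big(\frac{\|S_n\|}{\|S_nx\|}\ge\exp(n\epsilon)\Big)\Big]^{1/n}<1 .$$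
   Context: A local field $k$ is $\mathbb R$, $\mathbb C$, a finite extension of some $\mathbb Q_p$, or a field of Laurent series over a finite field, with its usual absolute value. $\Gamma_\mu$ is the smallest closed semigroup containing the support of $\mu$. Exponential local moment: $\int\|g\|^\tau d\mu(g)<\infty$ for some $\tau>0$. Strongly irreducible: no finite union of proper non-zero subspaces of $V$ is preserved by $\Gamma_\mu$. $V$ carries the canonical norm (Euclidean/Hermitian if $k$ is archimedean, Max norm otherwise) and $\|g\|$ is the operator norm. *)

theory Defs
  imports "HOL-Probability.Probability" "HOL-Computational_Algebra.Formal_Laurent_Series"
begin

section \<open>Local fields\<close>

text \<open>
  A field with an absolute value \<open>absv\<close> and the metric it induces: the metric axioms make \<open>absv\<close>
  subadditive and definite. The topological, uniform and Borel structure of the field, and of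
  vectors and matrices over it, comes from this metric.
\<close>

class valued_field = field + metric_space +
  fixes absv :: "'a \<Rightarrow> real"
  assumes dist_absv: "dist x y = absv (x - y)"
    and absv_mult: "absv (x * y) = absv x * absv y"

instantiation real :: valued_field
begin
definition absv_real :: "real \<Rightarrow> real" where "absv_real x = \<bar>x\<bar>"
instance by standard (simp_all add: absv_real_def dist_real_def abs_mult)
end

instantiation complex :: valued_field
begin
definition absv_complex :: "complex \<Rightarrow> real" where "absv_complex z = cmod z"
instance by standard (simp_all add: absv_complex_def dist_norm norm_mult)
end

definition is_subfield :: "'k::field set \<Rightarrow> bool" where
  "is_subfield L \<longleftrightarrow> 1 \<in> L \<and> (\<forall>x\<in>L. \<forall>y\<in>L. x - y \<in> L \<and> x * y \<in> L \<and> inverse x \<in> L)"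

definition field_iso_betw :: "('a::field \<Rightarrow> 'b::field) \<Rightarrow> 'a set \<Rightarrow> 'b set \<Rightarrow> bool" where
  "field_iso_betw \<phi> A B \<longleftrightarrow> bij_betw \<phi> A B \<and>
     (\<forall>x\<in>A. \<forall>y\<in>A. \<phi> (x + y) = \<phi> x + \<phi> y \<and> \<phi> (x * y) = \<phi> x * \<phi> y)"

definition is_real_field :: "'k::valued_field itself \<Rightarrow> bool" where
  "is_real_field _ \<longleftrightarrow>
     (\<exists>\<phi> :: 'k \<Rightarrow> real. field_iso_betw \<phi> UNIV UNIV \<and> (\<forall>x. absv x = \<bar>\<phi> x\<bar>))"

definition is_complex_field :: "'k::valued_field itself \<Rightarrow> bool" where
  "is_complex_field _ \<longleftrightarrow>
     (\<exists>\<phi> :: 'k \<Rightarrow> complex. field_iso_betw \<phi> UNIV UNIV \<and> (\<forall>x. absv x = cmod (\<phi> x)))"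

definition padic_val :: "nat \<Rightarrow> rat \<Rightarrow> int" where
  "padic_val p x = (case quotient_of x of (a, b) \<Rightarrow>
     int (multiplicity (int p) a) - int (multiplicity (int p) b))"

definition padic_abs :: "nat \<Rightarrow> rat \<Rightarrow> real" where
  "padic_abs p x = (if x = 0 then 0 else real p powi (- padic_val p x))"

text \<open>
  The field of \<open>p\<close>-adic numbers is the completion of the rationals for the \<open>p\<close>-adic absolute value:
  a subfield \<open>L\<close> is a copy of it (as a valued field) iff \<open>L\<close> is complete and contains the rationals,
  with their \<open>p\<close>-adic absolute value, as a dense subfield.
\<close>

definition is_padic_subfield :: "nat \<Rightarrow> 'k::valued_field set \<Rightarrow> bool" where
  "is_padic_subfield p L \<longleftrightarrow> is_subfield L \<and> uniform_space_class.complete L \<and>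
     (\<exists>\<iota> :: rat \<Rightarrow> 'k. field_iso_betw \<iota> UNIV (range \<iota>) \<and>
        (\<forall>q. absv (\<iota> q) = padic_abs p q) \<and> range \<iota> \<subseteq> L \<and> L \<subseteq> closure (range \<iota>))"

definition finite_extension_of :: "'k::field set \<Rightarrow> bool" where
  "finite_extension_of L \<longleftrightarrow>
     (\<exists>B. finite B \<and> (\<forall>x. \<exists>c. (\<forall>b\<in>B. c b \<in> L) \<and> x = (\<Sum>b\<in>B. c b * b)))"

text \<open>
  The usual absolute value on a finite extension of the \<open>p\<close>-adic field is the unique absolute value
  extending the \<open>p\<close>-adic one (normalised by \<open>\<bar>p\<bar> = 1/p\<close>); \<open>absv\<close> is one by \<open>is_padic_subfield\<close>.
\<close>

definition is_padic_extension_field :: "'k::valued_field itself \<Rightarrow> bool" where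
  "is_padic_extension_field _ \<longleftrightarrow>
     (\<exists>p. prime p \<and> (\<exists>L :: 'k set. is_padic_subfield p L \<and> finite_extension_of L))"

text \<open>
  Fields of Laurent series over a finite field. A field isomorphic to \<open>F((t))\<close> contains a copy of
  \<open>F\<close>, so the coefficient field may be taken to be a finite subfield of the field itself, and
  \<open>F((t))\<close> to be the set of Laurent series all of whose coefficients lie in \<open>F\<close>.
\<close>

definition is_laurent_field :: "'k::valued_field itself \<Rightarrow> bool" where
  "is_laurent_field _ \<longleftrightarrow>
     (\<exists>(F :: 'k set) (\<psi> :: 'k fls \<Rightarrow> 'k). is_subfield F \<and> finite F \<and>
        field_iso_betw \<psi> {f. \<forall>n. fls_nth f n \<in> F} UNIV \<and>
        (\<forall>f. (\<forall>n. fls_nth f n \<in> F) \<longrightarrow>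
           absv (\<psi> f) = (if f = 0 then 0 else real (card F) powi (- fls_subdegree f))))"

definition local_field :: "'k::valued_field itself \<Rightarrow> bool" where
  "local_field k \<longleftrightarrow> is_real_field k \<or> is_complex_field k \<or>
     is_padic_extension_field k \<or> is_laurent_field k"

lemma local_field_real: "local_field TYPE(real)"
  unfolding local_field_def is_real_field_def field_iso_betw_def
  by (intro disjI1 exI[of _ id]) (auto simp: absv_real_def)

lemma local_field_complex: "local_field TYPE(complex)"
  unfolding local_field_def is_complex_field_def field_iso_betw_def
  by (intro disjI2 disjI1 exI[of _ id]) (auto simp: absv_complex_def)

definition archimedean :: "'k::valued_field itself \<Rightarrow> bool" where
  "archimedean _ \<longleftrightarrow> \<not> (\<forall>x y :: 'k. absv (x + y) \<le> max (absv x) (absv y))"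

section \<open>Canonical norm, operator norm\<close>

text \<open>
  The library norm on \<open>'k ^ 'd\<close> is always the Euclidean one and is only available over real normed
  spaces, hence a separate definition.
\<close>

definition vnorm :: "'k::valued_field ^ 'd \<Rightarrow> real" where
  "vnorm x = (if archimedean TYPE('k) then L2_set (\<lambda>i. absv (x $ i)) UNIV
              else Max (range (\<lambda>i. absv (x $ i))))"

definition opnorm :: "'k::valued_field ^ 'd ^ 'd \<Rightarrow> real" where
  "opnorm g = (SUP x. vnorm (g *v x) / vnorm x)"

section \<open>Probability measures on the special linear group\<close>

definition SL :: "('k::valued_field ^ 'd ^ 'd) set" where
  "SL = {g. det g = 1}"

definition prob_measure_on_SL :: "('k::valued_field ^ 'd ^ 'd) measure \<Rightarrow> bool" where
  "prob_measure_on_SL \<mu> \<longleftrightarrow> prob_space \<mu> \<and> sets \<mu> = sets (restrict_space borel SL)"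

definition msupport :: "'a::topological_space measure \<Rightarrow> 'a set" where
  "msupport \<mu> = {g \<in> space \<mu>. \<forall>U. open U \<and> g \<in> U \<longrightarrow> emeasure \<mu> (U \<inter> space \<mu>) > 0}"

definition closed_semigroup :: "('k::valued_field ^ 'd ^ 'd) set \<Rightarrow> bool" where
  "closed_semigroup T \<longleftrightarrow>
     closedin (top_of_set SL) T \<and> (\<forall>g\<in>T. \<forall>h\<in>T. g ** h \<in> T)"

definition \<Gamma> :: "('k::valued_field ^ 'd ^ 'd) measure \<Rightarrow> ('k ^ 'd ^ 'd) set" where
  "\<Gamma> \<mu> = \<Inter> {T. closed_semigroup T \<and> msupport \<mu> \<subseteq> T}"

definition exp_local_moment :: "('k::valued_field ^ 'd ^ 'd) measure \<Rightarrow> bool" where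
  "exp_local_moment \<mu> \<longleftrightarrow> (\<exists>\<tau>>0. (\<integral>\<^sup>+ g. ennreal (opnorm g powr \<tau>) \<partial>\<mu>) < \<infinity>)"

definition strongly_irreducible :: "('k::valued_field ^ 'd ^ 'd) set \<Rightarrow> bool" where
  "strongly_irreducible G \<longleftrightarrow>
     \<not> (\<exists>\<W> :: ('k ^ 'd) set set. finite \<W> \<and> \<W> \<noteq> {} \<and>
          (\<forall>W\<in>\<W>. vec.subspace W \<and> W \<noteq> {0} \<and> W \<noteq> UNIV) \<and>
          (\<forall>g\<in>G. (\<lambda>v. g *v v) ` (\<Union>\<W>) \<subseteq> \<Union>\<W>))"

text \<open>The left product \<open>A n ** \<dots> ** A 1\<close>; the value \<open>A 0\<close> is not used.\<close>

primrec left_prod :: "(nat \<Rightarrow> 'k::semiring_1 ^ 'd ^ 'd) \<Rightarrow> nat \<Rightarrow> 'k ^ 'd ^ 'd" where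
  "left_prod A 0 = mat 1"
| "left_prod A (Suc n) = A (Suc n) ** left_prod A n"

definition iid_sequence :: "'w measure \<Rightarrow> 'a measure \<Rightarrow> (nat \<Rightarrow> 'w \<Rightarrow> 'a) \<Rightarrow> bool" where
  "iid_sequence P \<mu> X \<longleftrightarrow> prob_space P \<and>
     prob_space.indep_vars P (\<lambda>_. \<mu>) X {1..} \<and> (\<forall>i\<ge>1. distr P \<mu> (X i) = \<mu>)"

end

theory Submission
  imports Defs "HOL-Number_Theory.Cong"
begin

text \<open>
  Write \<open>M\<^sub>n(\<epsilon>)\<close> for the supremum over \<open>x\<close> of the \<open>\<epsilon>\<close>-moment of \<open>\<parallel>S\<^sub>n\<parallel> / \<parallel>S\<^sub>n x\<parallel>\<close> (\<open>\<parallel>x\<parallel> = 1\<close>). It is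
  submultiplicative in \<open>n\<close>, and \<open>M\<^sub>m(\<epsilon>) \<le> 1 + \<epsilon> E + O(\<epsilon>\<^sup>2)\<close> with \<open>E\<close> the supremum of the mean of
  \<open>ln (\<parallel>S\<^sub>m\<parallel> / \<parallel>S\<^sub>m x\<parallel>)\<close>, so it suffices to find one \<open>m\<close> with \<open>E \<le> m \<gamma> / 4\<close>. Let \<open>\<beta>\<close> be the exponent of
  \<open>\<parallel>S\<^sub>n x\<parallel>\<close> from the worst starting point. Lower deviations from \<open>m \<beta>\<close> are negligible uniformly in \<open>x\<close>.
  Along the trajectory of a nearly worst point, \<open>ln (\<parallel>g y\<parallel> / \<parallel>y\<parallel>)\<close>, with \<open>g\<close> an independent copy of \<open>S\<^sub>m\<close>,
  has mean at most \<open>m \<beta> + 1\<close>, hence negligible upper deviations too. By strong irreducibility and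
  compactness this trajectory visits, with a frequency bounded below uniformly in \<open>g\<close>, points \<open>y\<close>
  with \<open>\<parallel>g y\<parallel> \<ge> const \<parallel>g\<parallel> \<parallel>y\<parallel>\<close>. Therefore \<open>ln \<parallel>S\<^sub>m\<parallel>\<close> has mean at most \<open>m \<beta> + o(m)\<close>, which bounds \<open>E\<close>.
\<close>

unbundle no fps_syntax

section \<open>Valued fields\<close>

text \<open>What makes the argument close is the order of choices. Strong irreducibility gives
  \<open>\<eta>\<close>, \<open>D\<close> and \<open>\<kappa>\<close> without reference to a block
  length: over any \<open>D\<close> consecutive times the probabilities of a good position add up to
  at least \<open>\<eta>\<close>. Then the slope \<open>\<delta>\<close> of the deviation error is
  taken small against D / \<eta>, then \<open>m\<close> large enough to absorb every additive
  constant, and \<open>\<epsilon>\<close> last.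

  The supremum over starting points has to be controlled at finite times. The average along a finite
  trajectory leaves boundary terms, which a long trajectory absorbs.

  The field enters through compactness of its closed balls. This gives compactness of the pairs of a
  line and a linear form, and it makes the space of matrices separable, which is used for
  measurability of the product. Determinant one enters through Cramer's rule: it bounds the
  contraction of vectors by a power of \<open>opnorm g\<close>, so one exponential moment controls
  the cocycle from both sides.\<close>

lemma absv_dist0: "absv (x::'k::valued_field) = dist x 0"
  by (simp add: dist_absv)

lemma absv_nonneg [simp]: "0 \<le> absv (x::'k::valued_field)"
  by (simp add: absv_dist0)

lemma absv_eq_0 [simp]: "absv (x::'k::valued_field) = 0 \<longleftrightarrow> x = 0"
  by (simp add: absv_dist0)

lemma absv_zero [simp]: "absv (0::'k::valued_field) = 0"
  by simp

lemma absv_pos [simp]: "0 < absv (x::'k::valued_field) \<longleftrightarrow> x \<noteq> 0"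
  by (simp add: absv_dist0)

lemma absv_one [simp]: "absv (1::'k::valued_field) = 1"
  using absv_mult[of "1::'k" 1] by simp

lemma absv_minus_commute: "absv (x - y) = absv (y - (x::'k::valued_field))"
  by (metis dist_absv dist_commute)

lemma absv_minus [simp]: "absv (- x) = absv (x::'k::valued_field)"
  using absv_minus_commute[of 0 x] by simp

lemma absv_add_le: "absv (x + y) \<le> absv x + absv (y::'k::valued_field)"
  using dist_triangle[of x "-y" 0] by (simp add: dist_absv)

lemma absv_diff_le: "absv (x - y) \<le> absv x + absv (y::'k::valued_field)"
  using absv_add_le[of x "-y"] by simp

lemma absv_power: "absv (x ^ n) = absv (x::'k::valued_field) ^ n"
  by (induction n) (simp_all add: absv_mult)

lemma absv_inverse: "absv (inverse x) = inverse (absv (x::'k::valued_field))"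
proof (cases "x = 0")
  case False
  then have "absv x * absv (inverse x) = 1"
    using absv_mult[of x "inverse x"] by simp
  then show ?thesis
    by (metis inverse_unique)
qed simp

lemma absv_divide: "absv (x / y) = absv x / absv (y::'k::valued_field)"
  by (simp add: divide_inverse absv_mult absv_inverse)

lemma absv_sum_le: "absv (sum f A) \<le> (\<Sum>i\<in>A. absv (f i :: 'k::valued_field))"
  by (induction A rule: infinite_finite_induct)
    (auto intro: order_trans[OF absv_add_le])

lemma absv_prod: "absv (prod f A) = (\<Prod>i\<in>A. absv (f i :: 'k::valued_field))"
  by (induction A rule: infinite_finite_induct) (auto simp: absv_mult)

lemma absv_sign: "absv (of_int (sign p) :: 'k::valued_field) = 1"
  by (simp add: sign_def)

text \<open>Membership in this class and in the multiplicative ones below makes the continuity rules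
  for sums and products available, and with them continuity of matrix products, matrix-vector
  products and \<open>dotp\<close>.\<close>

instance valued_field \<subseteq> topological_group_add
proof
  fix a b :: 'a
  show "((\<lambda>x. fst x + snd x) \<longlongrightarrow> a + b) (nhds a \<times>\<^sub>F nhds b)"
  proof (rule metric_tendsto_imp_tendsto)
    have "((\<lambda>x. dist (fst x) a + dist (snd x) b) \<longlongrightarrow> dist a a + dist b b) (nhds a \<times>\<^sub>F nhds b)"
      by (intro tendsto_add tendsto_dist tendsto_const filterlim_fst filterlim_snd)
    then show "((\<lambda>x. dist (fst x) a + dist (snd x) b) \<longlongrightarrow> 0) (nhds a \<times>\<^sub>F nhds b)"
      by simp
    show "\<forall>\<^sub>F x in nhds a \<times>\<^sub>F nhds b.
        dist (fst x + snd x) (a + b) \<le> dist (dist (fst x) a + dist (snd x) b) 0"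
    proof (rule always_eventually, rule allI)
      fix x :: "'a \<times> 'a"
      have "fst x + snd x - (a + b) = (fst x - a) + (snd x - b)"
        by (simp add: algebra_simps)
      then have "dist (fst x + snd x) (a + b) = absv ((fst x - a) + (snd x - b))"
        by (simp only: dist_absv)
      then show "dist (fst x + snd x) (a + b) \<le> dist (dist (fst x) a + dist (snd x) b) 0"
        using absv_add_le[of "fst x - a" "snd x - b"] by (simp add: dist_absv absv_real_def)
    qed
  qed
  show "(uminus \<longlongrightarrow> - a) (nhds a)"
  proof (rule metric_tendsto_imp_tendsto)
    show "((\<lambda>x. x) \<longlongrightarrow> a) (nhds a)" by (rule filterlim_ident)
    show "\<forall>\<^sub>F x in nhds a. dist (- x) (- a) \<le> dist x a"
      by (simp add: dist_absv absv_minus_commute[of a])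
  qed
qed

instance valued_field \<subseteq> topological_comm_monoid_add ..

instance valued_field \<subseteq> topological_semigroup_mult
proof
  fix a b :: 'a
  show "((\<lambda>x. fst x * snd x) \<longlongrightarrow> a * b) (nhds a \<times>\<^sub>F nhds b)"
  proof (rule metric_tendsto_imp_tendsto)
    let ?e = "\<lambda>x. dist (fst x) a * dist (snd x) 0 + dist a 0 * dist (snd x) b"
    have "(?e \<longlongrightarrow> dist a a * dist b 0 + dist a 0 * dist b b) (nhds a \<times>\<^sub>F nhds b)"
      by (intro tendsto_add tendsto_mult tendsto_dist tendsto_const filterlim_fst filterlim_snd)
    then show "(?e \<longlongrightarrow> 0) (nhds a \<times>\<^sub>F nhds b)"
      by simp
    show "\<forall>\<^sub>F x in nhds a \<times>\<^sub>F nhds b. dist (fst x * snd x) (a * b) \<le> dist (?e x) 0"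
    proof (rule always_eventually, rule allI)
      fix x :: "'a \<times> 'a"
      have "fst x * snd x - a * b = (fst x - a) * snd x + a * (snd x - b)"
        by (simp add: algebra_simps)
      then show "dist (fst x * snd x) (a * b) \<le> dist (?e x) 0"
        using absv_add_le[of "(fst x - a) * snd x" "a * (snd x - b)"]
        by (simp add: dist_absv absv_mult absv_real_def)
    qed
  qed
qed

instance valued_field \<subseteq> topological_monoid_mult ..

lemma continuous_on_absv [continuous_intros]:
  fixes f :: "'a::topological_space \<Rightarrow> 'k::valued_field"
  shows "continuous_on S f \<Longrightarrow> continuous_on S (\<lambda>x. absv (f x))"
  unfolding absv_dist0 by (intro continuous_intros)

lemma continuous_on_matrix_mult [continuous_intros]:
  fixes f g :: "'a::topological_space \<Rightarrow> 'k::valued_field ^ 'd ^ 'd"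
  shows "continuous_on S f \<Longrightarrow> continuous_on S g \<Longrightarrow> continuous_on S (\<lambda>x. f x ** g x)"
  unfolding matrix_matrix_mult_def by (intro continuous_intros)

lemma continuous_on_matrix_vector_mult [continuous_intros]:
  fixes f :: "'a::topological_space \<Rightarrow> 'k::valued_field ^ 'd ^ 'd"
  shows "continuous_on S f \<Longrightarrow> continuous_on S g \<Longrightarrow> continuous_on S (\<lambda>x. f x *v g x)"
  unfolding matrix_vector_mult_def by (intro continuous_intros)

section \<open>Local compactness of local fields\<close>

text \<open>Relative to a subset \<open>V\<close>, because in the p-adic case it is first proved for
  a subfield and then carried through finite-dimensional subspaces up to
  \<open>UNIV\<close>.\<close>

definition compact_balls :: "'k::valued_field set \<Rightarrow> bool" where
  "compact_balls V \<longleftrightarrow> (\<forall>r. compact {x \<in> V. absv x \<le> r})"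

lemma closed_absv_le: "closed {x :: 'k::valued_field. absv x \<le> r}"
  by (intro closed_Collect_le continuous_intros)

section \<open>Archimedean fields\<close>

lemma compact_balls_iso:
  fixes \<phi> :: "'k::valued_field \<Rightarrow> 'n::{real_normed_field, heine_borel}"
  assumes "field_iso_betw \<phi> UNIV UNIV" and abs: "\<And>x. absv x = norm (\<phi> x)"
  shows "compact_balls (UNIV :: 'k set)"
  unfolding compact_balls_def
proof
  fix r
  have bij: "bij \<phi>" and add: "\<And>x y. \<phi> (x + y) = \<phi> x + \<phi> y"
    using assms(1) by (auto simp: field_iso_betw_def)
  have diff: "\<phi> (x - y) = \<phi> x - \<phi> y" for x y
    using add[of "x - y" y] by (simp add: algebra_simps)
  \<comment> \<open>The inverse of \<open>\<phi>\<close> is an isometry, so balls of the field are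
    continuous images of compact balls of the model.\<close>
  have "dist (inv \<phi> a) (inv \<phi> b) = dist a b" for a b
    using bij by (simp add: dist_absv[of "inv \<phi> a"] abs diff dist_norm bij_is_surj surj_f_inv_f)
  then have "continuous_on UNIV (inv \<phi>)"
    unfolding continuous_on_iff by auto
  then have "compact (inv \<phi> ` cball 0 r)"
    by (rule compact_continuous_image[OF continuous_on_subset]) auto
  also have "inv \<phi> ` cball 0 r = {x \<in> UNIV. absv x \<le> r}"
  proof (intro set_eqI iffI)
    fix x :: 'k assume "x \<in> {x \<in> UNIV. absv x \<le> r}"
    then have "\<phi> x \<in> cball 0 r" "x = inv \<phi> (\<phi> x)"
      using bij by (simp_all add: abs bij_is_inj inv_f_f)
    then show "x \<in> inv \<phi> ` cball 0 r" by blast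
  qed (use bij in \<open>auto simp: abs bij_is_surj surj_f_inv_f\<close>)
  finally show "compact {x \<in> UNIV :: 'k set. absv x \<le> r}" .
qed

section \<open>Subfields, scaling and finite extensions\<close>

lemma subfield_power: "is_subfield L \<Longrightarrow> a \<in> L \<Longrightarrow> a ^ n \<in> L"
  by (induction n) (auto simp: is_subfield_def)

lemma subfield_zero: "is_subfield L \<Longrightarrow> 0 \<in> L"
  unfolding is_subfield_def by (metis diff_self)

text \<open>Multiplication by a ^ n is continuous, and the image of the unit ball of
  \<open>L\<close> contains the ball of radius \<open>r\<close> once absv a ^ n > r. Intersecting
  this compact image with a closed set gives the ball.\<close>

lemma compact_balls_subfield:
  fixes L :: "'k::valued_field set"
  assumes L: "is_subfield L" and a: "a \<in> L" "absv a > 1"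
    and unit: "compact {x \<in> L. absv x \<le> 1}"
  shows "compact_balls L"
  unfolding compact_balls_def
proof
  fix r
  obtain n where n: "r < absv a ^ n" using real_arch_pow[OF a(2)] by blast
  have an: "a ^ n \<in> L" "a ^ n \<noteq> 0" using subfield_power[OF L a(1)] a(2) by auto
  have "compact ((\<lambda>x. a ^ n * x) ` {x \<in> L. absv x \<le> 1})"
    by (intro compact_continuous_image unit continuous_intros)
  then have "compact ((\<lambda>x. a ^ n * x) ` {x \<in> L. absv x \<le> 1} \<inter> {x. absv x \<le> r})"
    by (intro compact_Int_closed closed_absv_le)
  also have "(\<lambda>x. a ^ n * x) ` {x \<in> L. absv x \<le> 1} \<inter> {x. absv x \<le> r} = {x \<in> L. absv x \<le> r}"
  proof (intro set_eqI iffI)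
    fix x assume x: "x \<in> {x \<in> L. absv x \<le> r}"
    have "inverse (a ^ n) * x \<in> L" using L an(1) x unfolding is_subfield_def by auto
    moreover have "absv (inverse (a ^ n) * x) \<le> 1"
    proof -
      have "absv (inverse (a ^ n) * x) * absv (a ^ n) = absv x"
        using an(2) by (simp add: absv_mult[symmetric] divide_simps)
      then have "absv (inverse (a ^ n) * x) * absv a ^ n = absv x"
        by (simp only: absv_power)
      moreover have "0 < absv a ^ n" using a(2) by (intro zero_less_power) linarith
      ultimately show ?thesis
        using x n mult_le_cancel_right_pos[of "absv a ^ n" "absv (inverse (a ^ n) * x)" 1] by simp
    qed
    moreover have "x = a ^ n * (inverse (a ^ n) * x)" using an(2) by simp
    ultimately show "x \<in> (\<lambda>x. a ^ n * x) ` {x \<in> L. absv x \<le> 1} \<inter> {x. absv x \<le> r}"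
      using x by blast
  qed (use L an(1) in \<open>auto simp: is_subfield_def\<close>)
  finally show "compact {x \<in> L. absv x \<le> r}" .
qed

definition lspace :: "'k::field set \<Rightarrow> 'k set \<Rightarrow> bool" where
  "lspace L V \<longleftrightarrow> 0 \<in> V \<and> (\<forall>x\<in>V. \<forall>y\<in>V. x + y \<in> V) \<and> (\<forall>c\<in>L. \<forall>x\<in>V. c * x \<in> V)"

text \<open>
  If \<open>b \<notin> V\<close> then \<open>b\<close> has positive distance \<open>\<delta>\<close> from \<open>V\<close> by compactness of balls in \<open>V\<close>, hence
  \<open>\<bar>w + c b\<bar> \<ge> \<delta> \<bar>c\<bar>\<close>, and the coordinates of a bounded set are bounded.
\<close>

lemma compact_balls_adjoin:
  fixes L V :: "'k::valued_field set" and b :: 'k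
  assumes L: "is_subfield L" "compact_balls L" and V: "lspace L V" "compact_balls V"
  defines "V' \<equiv> {w + c * b |w c. w \<in> V \<and> c \<in> L}"
  shows "lspace L V'" "compact_balls V'"
proof -
  have Lneg: "- c \<in> L" if "c \<in> L" for c
    using L(1) that subfield_zero[OF L(1)] unfolding is_subfield_def by (metis diff_0)
  have Ladd: "c + d \<in> L" if "c \<in> L" "d \<in> L" for c d
  proof -
    have "c - (- d) \<in> L" using L(1) that Lneg unfolding is_subfield_def by blast
    then show ?thesis by simp
  qed
  have Lmul: "c * d \<in> L" and Linv: "inverse c \<in> L" if "c \<in> L" "d \<in> L" for c d
    using L(1) that unfolding is_subfield_def by auto
  have V0: "0 \<in> V" and Vadd: "\<And>x y. x \<in> V \<Longrightarrow> y \<in> V \<Longrightarrow> x + y \<in> V"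
    and Vmul: "\<And>c x. c \<in> L \<Longrightarrow> x \<in> V \<Longrightarrow> c * x \<in> V"
    using V(1) by (auto simp: lspace_def)
  show "lspace L V'"
    unfolding lspace_def
  proof (intro conjI ballI)
    show "0 \<in> V'" unfolding V'_def using V0 subfield_zero[OF L(1)] by force
  next
    fix x y assume "x \<in> V'" "y \<in> V'"
    then obtain w c w' c' where "x = w + c * b" "y = w' + c' * b" "w \<in> V" "c \<in> L" "w' \<in> V" "c' \<in> L"
      by (auto simp: V'_def)
    moreover have "w + c * b + (w' + c' * b) = (w + w') + (c + c') * b" by (simp add: algebra_simps)
    ultimately show "x + y \<in> V'" unfolding V'_def using Vadd Ladd by blast
  next
    fix d x assume d: "d \<in> L" and "x \<in> V'"
    then obtain w c where "x = w + c * b" "w \<in> V" "c \<in> L" by (auto simp: V'_def)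
    moreover have "d * (w + c * b) = d * w + (d * c) * b" by (simp add: algebra_simps)
    ultimately show "d * x \<in> V'" unfolding V'_def using Vmul[OF d] Lmul[OF d] by blast
  qed
  show "compact_balls V'"
  proof (cases "b \<in> V")
    case True
    have "V' = V"
    proof (intro set_eqI iffI)
      fix x assume "x \<in> V"
      moreover have "x = x + 0 * b" by simp
      ultimately show "x \<in> V'" unfolding V'_def using subfield_zero[OF L(1)] by blast
    qed (use True Vadd Vmul in \<open>auto simp: V'_def\<close>)
    then show ?thesis using V(2) by simp
  next
    case False
    have "compact {w \<in> V. absv w \<le> absv b + 1}" using V(2) by (simp add: compact_balls_def)
    then have "open (- {w \<in> V. absv w \<le> absv b + 1})"
      using compact_imp_closed by blast
    then obtain e where e: "e > 0" "ball b e \<subseteq> - {w \<in> V. absv w \<le> absv b + 1}"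
      using False open_contains_ball by blast
    \<comment> \<open>The cap at 1 ensures that if absv (b + w) < \<delta>, then - w lies in the
      compact ball of radius absv b + 1 from which \<open>b\<close> has been separated.\<close>
    define \<delta> where "\<delta> = min e 1"
    have \<delta>: "\<delta> > 0" using e(1) by (simp add: \<delta>_def)
    have far: "\<delta> \<le> absv (b + w)" if "w \<in> V" for w
    proof (rule ccontr)
      assume *: "\<not> \<delta> \<le> absv (b + w)"
      have "- 1 \<in> L" using L(1) Lneg unfolding is_subfield_def by blast
      from Vmul[OF this that] have mw: "- w \<in> V" by simp
      have "absv (- w) = absv (b - (b + w))" by simp
      also have "\<dots> \<le> absv b + absv (b + w)" by (rule absv_diff_le)
      finally have "absv (- w) \<le> absv b + 1" using * by (simp add: \<delta>_def)
      with mw have "- w \<notin> ball b e" using e(2) by blast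
      then show False using * by (simp add: dist_absv \<delta>_def)
    qed
    show ?thesis
      unfolding compact_balls_def
    proof
      fix r :: real
      let ?R = "max 0 r"
      let ?C = "{c \<in> L. absv c \<le> ?R / \<delta>}" and ?W = "{w \<in> V. absv w \<le> ?R + ?R / \<delta> * absv b}"
      have "compact ((\<lambda>(w, c). w + c * b) ` (?W \<times> ?C))"
        using L(2) V(2) unfolding case_prod_unfold
        by (intro compact_continuous_image compact_Times continuous_intros) (auto simp: compact_balls_def)
      then have "compact ((\<lambda>(w, c). w + c * b) ` (?W \<times> ?C) \<inter> {x. absv x \<le> r})"
        by (intro compact_Int_closed closed_absv_le)
      also have "(\<lambda>(w, c). w + c * b) ` (?W \<times> ?C) \<inter> {x. absv x \<le> r} = {x \<in> V'. absv x \<le> r}"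
      proof (intro set_eqI iffI)
        fix x assume x: "x \<in> {x \<in> V'. absv x \<le> r}"
        then obtain w c where wc: "x = w + c * b" "w \<in> V" "c \<in> L" by (auto simp: V'_def)
        have r: "absv (w + c * b) \<le> ?R" using x wc(1) by (simp add: le_max_iff_disj)
        have c: "absv c \<le> ?R / \<delta>"
        proof (cases "c = 0")
          case False
          have "inverse c * w \<in> V" using Vmul Linv wc by blast
          then have "\<delta> * absv c \<le> absv (b + inverse c * w) * absv c"
            using far by (intro mult_right_mono) auto
          also have "\<dots> = absv ((b + inverse c * w) * c)" by (simp only: absv_mult)
          also have "(b + inverse c * w) * c = w + c * b"
            using False by (simp add: field_simps)
          finally show ?thesis using r \<delta> by (simp add: pos_le_divide_eq mult.commute)
        qed (use \<delta> in simp)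
        have "absv w = absv ((w + c * b) - c * b)" by simp
        also have "\<dots> \<le> absv (w + c * b) + absv c * absv b" by (metis absv_diff_le absv_mult)
        also have "\<dots> \<le> ?R + ?R / \<delta> * absv b" using r c by (intro add_mono mult_right_mono) auto
        finally have "w \<in> ?W" using wc by simp
        with c wc x show "x \<in> (\<lambda>(w, c). w + c * b) ` (?W \<times> ?C) \<inter> {x. absv x \<le> r}"
          by (auto intro!: image_eqI[of _ _ "(w, c)"])
      qed (auto simp: V'_def)
      finally show "compact {x \<in> V'. absv x \<le> r}" .
    qed
  qed
qed

text \<open>Adjoins the elements of a finite spanning set one at a time. Linear dependence does no
  harm, as \<open>compact_balls_adjoin\<close> treats separately the case that the new element
  already lies in the space.\<close>

lemma compact_balls_finite_extension:
  fixes L :: "'k::valued_field set"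
  assumes L: "is_subfield L" "compact_balls L" and fin: "finite_extension_of L"
  shows "compact_balls (UNIV :: 'k set)"
proof -
  obtain B where B: "finite B" "\<And>x. \<exists>c. (\<forall>b\<in>B. c b \<in> L) \<and> x = (\<Sum>b\<in>B. c b * b)"
    using fin unfolding finite_extension_of_def by blast
  have "\<exists>V. lspace L V \<and> compact_balls V \<and> (\<forall>c. (\<forall>b\<in>B. c b \<in> L) \<longrightarrow> (\<Sum>b\<in>B. c b * b) \<in> V)"
    using B(1)
  proof (induction B rule: finite_induct)
    case empty
    have "compact {x \<in> {0 :: 'k}. absv x \<le> r}" for r
      by (intro finite_imp_compact) simp
    then have "lspace L {0}" "compact_balls {0 :: 'k}"
      by (auto simp: lspace_def compact_balls_def)
    then show ?case by (intro exI[of _ "{0}"]) auto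
  next
    case (insert b B)
    then obtain V where V: "lspace L V" "compact_balls V"
      "\<And>c. (\<forall>b\<in>B. c b \<in> L) \<Longrightarrow> (\<Sum>b\<in>B. c b * b) \<in> V" by blast
    have "(\<Sum>b'\<in>insert b B. c b' * b') \<in> {w + c * b |w c. w \<in> V \<and> c \<in> L}"
      if "\<forall>b'\<in>insert b B. c b' \<in> L" for c
    proof -
      have "(\<Sum>b'\<in>insert b B. c b' * b') = (\<Sum>b'\<in>B. c b' * b') + c b * b"
        using insert by (simp add: add.commute)
      then show ?thesis using V(3)[of c] that by blast
    qed
    then show ?case
      using compact_balls_adjoin[OF L V(1,2), of b] by blast
  qed
  then obtain V where "compact_balls V" "\<And>c. (\<forall>b\<in>B. c b \<in> L) \<Longrightarrow> (\<Sum>b\<in>B. c b * b) \<in> V" by blast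
  moreover from this have "V = UNIV" using B(2) by (metis UNIV_eq_I)
  ultimately show ?thesis by simp
qed

section \<open>p-adic fields\<close>

lemma padic_val_divide:
  fixes s v :: int
  assumes p: "prime p" and s: "s \<noteq> 0" and v: "v \<noteq> 0"
  shows "padic_val p (of_int s / of_int v) = int (multiplicity (int p) s) - int (multiplicity (int p) v)"
proof -
  obtain a b where ab: "quotient_of (of_int s / of_int v) = (a, b)" by force
  have b: "b > 0" using quotient_of_denom_pos[OF ab] .
  have "(of_int s :: rat) / of_int v = of_int a / of_int b" by (rule quotient_of_div[OF ab])
  then have "(of_int (s * b) :: rat) = of_int (a * v)"
    using v b by (simp add: field_simps)
  \<comment> \<open>\<open>padic_val\<close> reads off the reduced fraction a / b; comparing
    multiplicities in this equation transfers it to the given representation.\<close>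
  then have eq: "s * b = a * v" by (simp only: of_int_eq_iff)
  have a: "a \<noteq> 0" using eq s b by auto
  have pe: "prime_elem (int p)" using p by simp
  have "multiplicity (int p) s + multiplicity (int p) b = multiplicity (int p) a + multiplicity (int p) v"
    using arg_cong[OF eq, of "multiplicity (int p)"] prime_elem_multiplicity_mult_distrib[OF pe] s v a b
    by simp
  then show ?thesis by (simp add: padic_val_def ab)
qed

lemma padic_abs_le_iff:
  assumes p: "prime p" and x: "x \<noteq> 0"
  shows "padic_abs p x \<le> real p powi (- m) \<longleftrightarrow> m \<le> padic_val p x"
proof -
  have p1: "real p > 1" using prime_gt_1_nat[OF p] by simp
  show ?thesis
  proof
    assume "padic_abs p x \<le> real p powi (- m)"
    then have "\<not> - m < - padic_val p x"
      using power_int_strict_increasing[OF _ p1, of "- m" "- padic_val p x"] x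
      by (auto simp: padic_abs_def)
    then show "m \<le> padic_val p x" by simp
  next
    assume "m \<le> padic_val p x"
    then show "padic_abs p x \<le> real p powi (- m)"
      using p1 x by (simp add: padic_abs_def power_int_increasing)
  qed
qed

text \<open>Write q = u / v with \<open>v\<close> prime to \<open>p\<close>, and let
  \<open>w\<close> invert \<open>v\<close> modulo p ^ n. The remainder \<open>a\<close> of u w works
  since p ^ n divides u - a v. The numbers below p ^ n thus form a finite net of the p-adic
  integers.\<close>

lemma padic_integer_approx:
  assumes p: "prime p" and q: "padic_abs p q \<le> 1"
  obtains a :: nat where "a < p ^ n" "padic_abs p (q - of_nat a) \<le> real p powi (- int n)"
proof -
  obtain u v where uv: "quotient_of q = (u, v)" by force
  have v: "v > 0" using quotient_of_denom_pos[OF uv] .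
  have q_eq: "q = of_int u / of_int v" by (rule quotient_of_div[OF uv])
  have cop: "coprime u v" by (rule quotient_of_coprime[OF uv])
  \<comment> \<open>Otherwise \<open>p\<close> does not divide \<open>u\<close> and \<open>q\<close>
    has negative valuation, against the bound on its absolute value.\<close>
  have pv: "\<not> int p dvd v"
  proof
    assume dv: "int p dvd v"
    have nu: "\<not> is_unit (int p)"
      using prime_gt_1_nat[OF p] by simp
    then have "multiplicity (int p) v \<noteq> 0"
      using dv v by (simp add: multiplicity_eq_zero_iff)
    moreover have "\<not> int p dvd u" using dv cop nu coprime_common_divisor by blast
    then have "multiplicity (int p) u = 0" by (simp add: not_dvd_imp_multiplicity_0)
    moreover have "u \<noteq> 0" using \<open>\<not> int p dvd u\<close> by auto
    then have "q \<noteq> 0" using q_eq v by simp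
    ultimately show False
      using q padic_abs_le_iff[OF p \<open>q \<noteq> 0\<close>, of 0] uv by (simp add: padic_val_def)
  qed
  then have "coprime v (int p ^ n)"
    using p by (metis coprime_commute coprime_power_right_iff prime_imp_coprime prime_nat_int_transfer)
  then obtain w where w: "[v * w = 1] (mod (int p ^ n))"
    using cong_solve_coprime_int by blast
  define a where "a = nat ((u * w) mod (int p ^ n))"
  have pn: "int p ^ n > 0" using prime_gt_0_nat[OF p] by simp
  have a: "int a = (u * w) mod (int p ^ n)" using pn by (simp add: a_def)
  have "int a < int (p ^ n)" using pn by (simp add: a)
  then have a_less: "a < p ^ n" by (simp only: of_nat_less_iff)
  have "[int a * v = (u * w) * v] (mod (int p ^ n))"
    by (intro cong_mult cong_refl) (simp add: a cong_def)
  also have "(u * w) * v = u * (v * w)" by simp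
  also have "[u * (v * w) = u * 1] (mod (int p ^ n))" by (intro cong_mult cong_refl w)
  finally have dvd: "int p ^ n dvd u - int a * v"
    by (metis cong_iff_dvd_diff cong_sym mult_1_right)
  have diff: "q - of_nat a = of_int (u - int a * v) / of_int v"
    using v by (simp add: q_eq field_simps)
  have "padic_abs p (q - of_nat a) \<le> real p powi (- int n)"
  proof (cases "u - int a * v = 0")
    case True
    then show ?thesis by (simp add: diff padic_abs_def)
  next
    case False
    then have ne: "q - of_nat a \<noteq> 0"
      unfolding diff using v by (simp del: of_int_diff of_int_mult)
    have "\<not> is_unit (int p)"
      using prime_gt_1_nat[OF p] by simp
    then have "n \<le> multiplicity (int p) (u - int a * v)"
      using False dvd by (intro multiplicity_geI) auto
    moreover have "multiplicity (int p) v = 0" using pv by (simp add: not_dvd_imp_multiplicity_0)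
    ultimately have "int n \<le> padic_val p (q - of_nat a)"
      using False v unfolding diff by (subst padic_val_divide[OF p]) auto
    then show ?thesis by (simp add: padic_abs_le_iff[OF p ne])
  qed
  with a_less show ?thesis by (rule that)
qed

lemma compact_balls_padic:
  fixes L :: "'k::valued_field set"
  assumes p: "prime p" and L: "is_padic_subfield p L"
  shows "compact_balls L"
proof -
  from L obtain \<iota> :: "rat \<Rightarrow> 'k" where sub: "is_subfield L" and compl: "uniform_space_class.complete L"
    and iso: "field_iso_betw \<iota> UNIV (range \<iota>)" and abs: "\<And>q. absv (\<iota> q) = padic_abs p q"
    and range: "range \<iota> \<subseteq> L" and dense: "L \<subseteq> closure (range \<iota>)"
    unfolding is_padic_subfield_def by blast
  have add: "\<iota> (x + y) = \<iota> x + \<iota> y" for x y using iso by (auto simp: field_iso_betw_def)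
  have diff: "\<iota> (x - y) = \<iota> x - \<iota> y" for x y
    using add[of "x - y" y] by (simp add: algebra_simps)
  have p1: "real p > 1" using prime_gt_1_nat[OF p] by simp
  show ?thesis
  proof (rule compact_balls_subfield[OF sub])
    show "\<iota> (1 / of_nat p) \<in> L" using range by blast
    have "padic_val p (of_int 1 / of_int (int p)) = - 1"
      using p by (subst padic_val_divide[OF p]) (auto simp: multiplicity_self prime_gt_0_nat)
    then show "absv (\<iota> (1 / of_nat p)) > 1"
      using p1 by (simp add: abs padic_abs_def)
    show "compact {x \<in> L. absv x \<le> 1}"
      unfolding compact_eq_totally_bounded
    proof (intro conjI allI impI)
      have "closed {x \<in> L. absv x \<le> 1}"
        using closed_Int[OF complete_imp_closed[OF compl] closed_absv_le[of 1]] by (simp add: Int_def)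
      then show "uniform_space_class.complete {x \<in> L. absv x \<le> 1}"
        by (rule complete_closed_subset[OF _ _ compl]) auto
      fix e :: real assume e: "0 < e"
      obtain n where n: "(1 / real p) ^ n < e / 2"
        using real_arch_pow_inv[of "e / 2" "1 / real p"] e p1 by auto
      then have n: "real p powi (- int n) < e / 2"
        by (simp add: power_int_minus power_one_over inverse_eq_divide)
      let ?k = "(\<lambda>a :: nat. \<iota> (of_nat a)) ` {..<p ^ n}"
      have "{x \<in> L. absv x \<le> 1} \<subseteq> (\<Union>x\<in>?k. ball x e)"
      proof
        fix x assume x: "x \<in> {x \<in> L. absv x \<le> 1}"
        \<comment> \<open>The cutoff 1 gives \<open>padic_abs p q\<close> < 2 \<le> p. As its
          non-zero values are integral powers of \<open>p\<close>, it is at most 1 and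
          \<open>padic_integer_approx\<close> applies.\<close>
        then obtain q where q: "dist (\<iota> q) x < min 1 (e / 2)"
        proof -
          have "x \<in> closure (range \<iota>)" "0 < min 1 (e / 2)" using x dense e by auto
          then obtain y where "y \<in> range \<iota>" "dist y x < min 1 (e / 2)"
            unfolding closure_approachable by blast
          then show ?thesis using that by blast
        qed
        have "absv (\<iota> q) = absv (x + (\<iota> q - x))" by simp
        also have "\<dots> \<le> absv x + absv (\<iota> q - x)" by (rule absv_add_le)
        finally have "padic_abs p q < 2" using q x by (simp add: abs dist_absv)
        then have lt: "padic_abs p q < real p" using p1 prime_ge_2_nat[OF p] by linarith
        have "padic_abs p q \<le> 1"
        proof (cases "q = 0")
          case False
          have "real p powi (- padic_val p q) < real p powi 1"
            using lt False by (simp add: padic_abs_def)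
          then have "- padic_val p q < 1"
            by (rule power_int_le_imp_less_exp[OF p1]) simp
          then show ?thesis using padic_abs_le_iff[OF p False, of 0] by simp
        qed (simp add: padic_abs_def)
        then obtain a where a: "a < p ^ n" "padic_abs p (q - of_nat a) \<le> real p powi (- int n)"
          using padic_integer_approx[OF p] by blast
        have "dist (\<iota> (of_nat a)) x \<le> dist (\<iota> (of_nat a)) (\<iota> q) + dist (\<iota> q) x" by (rule dist_triangle)
        also have "dist (\<iota> (of_nat a)) (\<iota> q) < e / 2"
        proof -
          have "dist (\<iota> q) (\<iota> (of_nat a)) \<le> real p powi (- int n)"
            using a(2) by (simp add: dist_absv diff[symmetric] abs)
          then show ?thesis using n by (simp add: dist_commute)
        qed
        finally have "dist (\<iota> (of_nat a)) x < e" using q by simp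
        then show "x \<in> (\<Union>x\<in>?k. ball x e)" using a(1) by auto
      qed
      then show "\<exists>k. finite k \<and> {x \<in> L. absv x \<le> 1} \<subseteq> (\<Union>x\<in>k. ball x e)"
        by (intro exI[of _ ?k]) auto
    qed
  qed
qed

section \<open>Laurent series over a finite field\<close>

lemma compact_balls_laurent:
  assumes "is_laurent_field TYPE('k::valued_field)"
  shows "compact_balls (UNIV :: 'k set)"
proof -
  from assms obtain F :: "'k set" and \<psi> :: "'k fls \<Rightarrow> 'k" where F: "is_subfield F" "finite F"
    and iso: "field_iso_betw \<psi> {f. \<forall>n. fls_nth f n \<in> F} UNIV"
    and abs: "\<And>f. (\<forall>n. fls_nth f n \<in> F) \<Longrightarrow>
      absv (\<psi> f) = (if f = 0 then 0 else real (card F) powi (- fls_subdegree f))"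
    unfolding is_laurent_field_def by blast
  define A where "A = {f. \<forall>n. fls_nth f n \<in> F}"
  define q where "q = real (card F)"
  have Fdiff: "x - y \<in> F" if "x \<in> F" "y \<in> F" for x y
    using F(1) that by (auto simp: is_subfield_def)
  have F01: "0 \<in> F" "1 \<in> F"
    using F(1) subfield_zero[OF F(1)] by (auto simp: is_subfield_def)
  have "card {0, 1 :: 'k} \<le> card F" using F(2) F01 by (intro card_mono) auto
  then have q1: "q > 1" by (simp add: q_def)
  have add: "\<psi> (f + g) = \<psi> f + \<psi> g" if "f \<in> A" "g \<in> A" for f g
    using iso that unfolding field_iso_betw_def A_def by blast
  have A_diff: "f - g \<in> A" if "f \<in> A" "g \<in> A" for f g
    using that Fdiff by (auto simp: A_def)
  have diff: "\<psi> (f - g) = \<psi> f - \<psi> g" if "f \<in> A" "g \<in> A" for f g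
    using add[OF A_diff[OF that] that(2)] by (simp add: algebra_simps)
  have surj: "\<exists>f\<in>A. \<psi> f = x" for x
    using iso unfolding field_iso_betw_def bij_betw_def A_def by (metis (no_types, lifting) UNIV_I imageE)
  have abs_le: "absv (\<psi> f) \<le> q powi (- n) \<longleftrightarrow> (\<forall>i<n. fls_nth f i = 0)" if f: "f \<in> A" for f n
  proof (cases "f = 0")
    case True
    then show ?thesis using abs[of f] f q1 by (simp add: A_def zero_le_power_int)
  next
    case False
    have eq: "absv (\<psi> f) = q powi (- fls_subdegree f)" using abs[of f] f False by (simp add: A_def q_def)
    show ?thesis
    proof
      assume "absv (\<psi> f) \<le> q powi (- n)"
      then have "\<not> - n < - fls_subdegree f"
        using power_int_strict_increasing[OF _ q1, of "- n" "- fls_subdegree f"] by (auto simp: eq)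
      then show "\<forall>i<n. fls_nth f i = 0" by (auto intro: fls_eq0_below_subdegree)
    next
      assume *: "\<forall>i<n. fls_nth f i = 0"
      then have "n \<le> fls_subdegree f"
        using nth_fls_subdegree_nonzero[OF False] by (meson not_le)
      then show "absv (\<psi> f) \<le> q powi (- n)"
        using q1 by (simp add: eq power_int_increasing)
    qed
  qed
  have abs_le_1: "absv (\<psi> f) \<le> 1 \<longleftrightarrow> (\<forall>i<0. fls_nth f i = 0)" if "f \<in> A" for f
    using abs_le[OF that, of 0] by simp
  \<comment> \<open>Distance measures how far the coefficients agree: Cauchy sequences stabilise
    coefficient by coefficient, and truncation is approximation.\<close>
  have dist_le: "dist (\<psi> f) (\<psi> g) \<le> q powi (- n) \<longleftrightarrow> (\<forall>i<n. fls_nth f i = fls_nth g i)"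
    if "f \<in> A" "g \<in> A" for f g n
    using abs_le[OF A_diff[OF that], of n] diff[OF that] by (simp add: dist_absv)
  define S where "S c = fps_to_fls (Abs_fps c)" for c :: "nat \<Rightarrow> 'k"
  have S_nth: "fls_nth (S c) i = (if i < 0 then 0 else c (nat i))" for c i
    by (simp add: S_def)
  have S_A: "S c \<in> A" if "\<And>i. c i \<in> F" for c
    using that F01 by (simp add: A_def S_nth)
  have small: "\<exists>n::nat. q powi (- int n) < e" if e: "e > 0" for e
  proof -
    obtain n where "(1 / q) ^ n < e" using real_arch_pow_inv[of e "1 / q"] e q1 by auto
    then have "q powi (- int n) < e" by (simp add: power_int_minus power_one_over inverse_eq_divide)
    then show ?thesis ..
  qed
  have "compact {x :: 'k. absv x \<le> 1}"
    unfolding compact_eq_totally_bounded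
  proof (intro conjI allI impI)
    show "uniform_space_class.complete {x :: 'k. absv x \<le> 1}"
      unfolding complete_def
    proof (intro allI impI)
      fix x :: "nat \<Rightarrow> 'k" assume "(\<forall>n. x n \<in> {x. absv x \<le> 1}) \<and> Cauchy x"
      then have unit: "\<And>n. absv (x n) \<le> 1" and C: "Cauchy x" by auto
      have "\<forall>n. \<exists>f. f \<in> A \<and> \<psi> f = x n" using surj by blast
      then obtain f where f: "\<And>n. f n \<in> A" "\<And>n. \<psi> (f n) = x n"
        unfolding choice_iff by blast
      have "\<exists>N. \<forall>m\<ge>N. \<forall>k\<ge>N. \<forall>i<int n. fls_nth (f m) i = fls_nth (f k) i" for n
      proof -
        have "q powi (- int n) > 0" using q1 by (intro zero_less_power_int) simp
        then obtain N where "\<And>m k. m \<ge> N \<Longrightarrow> k \<ge> N \<Longrightarrow> dist (x m) (x k) < q powi (- int n)"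
          using C unfolding Cauchy_def by blast
        then have "\<forall>m\<ge>N. \<forall>k\<ge>N. dist (\<psi> (f m)) (\<psi> (f k)) \<le> q powi (- int n)"
          unfolding f(2) by (meson less_imp_le)
        then show ?thesis using dist_le[OF f(1) f(1)] by metis
      qed
      then obtain N where N: "\<And>n m k i. m \<ge> N n \<Longrightarrow> k \<ge> N n \<Longrightarrow> i < int n \<Longrightarrow> fls_nth (f m) i = fls_nth (f k) i"
        by metis
      \<comment> \<open>Coefficient \<open>i\<close> is read off at the index N (Suc i), from which
        on the coefficients below i + 1 no longer change.\<close>
      define g where "g = S (\<lambda>i. fls_nth (f (N (Suc i))) (int i))"
      have gA: "g \<in> A" unfolding g_def using f(1) by (intro S_A) (simp add: A_def)
      have agree: "fls_nth (f m) i = fls_nth g i" if m: "m \<ge> N n" and i: "i < int n" for m n i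
      proof (cases "i < 0")
        case True
        then show ?thesis using abs_le_1[OF f(1), of m] unit[of m] f(2)[of m] by (simp add: g_def S_nth)
      next
        case False
        let ?M = "max m (N (Suc (nat i)))"
        have "fls_nth (f m) i = fls_nth (f ?M) i" using m i by (intro N[of n]) auto
        also have "\<dots> = fls_nth (f (N (Suc (nat i)))) i" using False by (intro N[of "Suc (nat i)"]) auto
        finally show ?thesis using False by (simp add: g_def S_nth)
      qed
      have "absv (\<psi> g) \<le> 1" unfolding abs_le_1[OF gA] by (simp add: g_def S_nth)
      moreover have "x \<longlonglongrightarrow> \<psi> g"
      proof (rule metric_LIMSEQ_I)
        fix e :: real assume "0 < e"
        then obtain n :: nat where n: "q powi (- int n) < e" using small by blast
        have "dist (x m) (\<psi> g) < e" if "m \<ge> N n" for m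
        proof -
          have "dist (\<psi> (f m)) (\<psi> g) \<le> q powi (- int n)"
            unfolding dist_le[OF f(1) gA] using agree[OF that] by blast
          then show ?thesis using n f(2) by simp
        qed
        then show "\<exists>no. \<forall>m\<ge>no. dist (x m) (\<psi> g) < e" by blast
      qed
      ultimately show "\<exists>l\<in>{x. absv x \<le> 1}. x \<longlonglongrightarrow> l" by blast
    qed
    fix e :: real assume "0 < e"
    then obtain n :: nat where n: "q powi (- int n) < e" using small by blast
    \<comment> \<open>Polynomials of degree below \<open>n\<close> with coefficients in the finite
      set \<open>F\<close>: a finite net of the unit ball.\<close>
    let ?T = "\<lambda>c. S (\<lambda>i. if i < n then c i else 0)"
    let ?k = "(\<lambda>c. \<psi> (?T c)) ` PiE {..<n} (\<lambda>_. F)"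
    have "{x. absv x \<le> 1} \<subseteq> (\<Union>y\<in>?k. ball y e)"
    proof
      fix x :: 'k assume x: "x \<in> {x. absv x \<le> 1}"
      obtain f where f: "f \<in> A" "\<psi> f = x" using surj by blast
      let ?c = "restrict (\<lambda>i. fls_nth f (int i)) {..<n}"
      have c: "?c \<in> PiE {..<n} (\<lambda>_. F)" using f(1) by (auto simp: A_def)
      have TA: "?T ?c \<in> A" using f(1) F01 by (intro S_A) (auto simp: A_def)
      have "dist (\<psi> (?T ?c)) (\<psi> f) \<le> q powi (- int n)"
        unfolding dist_le[OF TA f(1)]
        using abs_le_1[OF f(1)] f(2) x by (auto simp: S_nth)
      then have "x \<in> ball (\<psi> (?T ?c)) e" using n f(2) by simp
      with c show "x \<in> (\<Union>y\<in>?k. ball y e)" by blast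
    qed
    moreover have "finite ?k" using F(2) by (intro finite_imageI finite_PiE) auto
    ultimately show "\<exists>k. finite k \<and> {x :: 'k. absv x \<le> 1} \<subseteq> (\<Union>y\<in>k. ball y e)" by blast
  qed
  moreover have "\<exists>a :: 'k. absv a > 1"
  proof -
    have XA: "fls_X_inv \<in> A" using F01 by (simp add: A_def fls_X_inv_nth)
    have "absv (\<psi> fls_X_inv) > 1"
      using abs[of fls_X_inv] XA q1 by (simp add: A_def q_def fls_X_inv_subdegree)
    then show ?thesis ..
  qed
  ultimately show ?thesis
    using compact_balls_subfield[of "UNIV :: 'k set"] by (auto simp: is_subfield_def)
qed

section \<open>Local compactness in all four cases\<close>

theorem compact_balls_local_field:
  assumes "local_field TYPE('k::valued_field)"
  shows "compact_balls (UNIV :: 'k set)"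
  using assms unfolding local_field_def
proof (elim disjE)
  assume "is_real_field TYPE('k)"
  then obtain \<phi> :: "'k \<Rightarrow> real" where "field_iso_betw \<phi> UNIV UNIV" "\<forall>x. absv x = \<bar>\<phi> x\<bar>"
    unfolding is_real_field_def by blast
  then show ?thesis by (intro compact_balls_iso[of \<phi>]) auto
next
  assume "is_complex_field TYPE('k)"
  then obtain \<phi> :: "'k \<Rightarrow> complex" where "field_iso_betw \<phi> UNIV UNIV" "\<forall>x. absv x = cmod (\<phi> x)"
    unfolding is_complex_field_def by blast
  then show ?thesis by (intro compact_balls_iso[of \<phi>]) auto
next
  assume "is_padic_extension_field TYPE('k)"
  then obtain p and L :: "'k set" where "prime p" "is_padic_subfield p L" "finite_extension_of L"
    unfolding is_padic_extension_field_def by blast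
  then show ?thesis
    by (intro compact_balls_finite_extension[of L] compact_balls_padic[of p])
      (auto simp: is_padic_subfield_def)
qed (rule compact_balls_laurent)

section \<open>Random walks and cocycles\<close>

text \<open>\<open>\<mu>\<close> is both the law of a step and the measurable space in which the
  products live, so no separate measurable structure is fixed.\<close>

locale random_walk =
  fixes \<mu> :: "'g measure" and mult :: "'g \<Rightarrow> 'g \<Rightarrow> 'g" (infixl "\<odot>" 70) and one :: 'g
  assumes prob_space_step: "prob_space \<mu>"
    and measurable_mult: "(\<lambda>(g, h). g \<odot> h) \<in> measurable (\<mu> \<Otimes>\<^sub>M \<mu>) \<mu>"
    and one_in_space: "one \<in> space \<mu>"
    and mult_assoc: "(g \<odot> h) \<odot> k = g \<odot> (h \<odot> k)"
    and one_mult: "one \<odot> g = g"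
begin

text \<open>The law of S_n, with the newest step on the left. Working with laws keeps the argument
  free of the underlying probability space, which returns in \<open>law_left_prod\<close>.\<close>

primrec walk :: "nat \<Rightarrow> 'g measure" where
  "walk 0 = return \<mu> one"
| "walk (Suc n) = distr (\<mu> \<Otimes>\<^sub>M walk n) \<mu> (\<lambda>(g, h). g \<odot> h)"

lemma sets_walk [simp, measurable_cong]: "sets (walk n) = sets \<mu>"
  by (induction n) auto

lemma space_walk [simp]: "space (walk n) = space \<mu>"
  by (rule sets_eq_imp_space_eq[OF sets_walk])

lemma measurable_mult_walk: "(\<lambda>(g, h). g \<odot> h) \<in> measurable (walk n \<Otimes>\<^sub>M walk m) \<mu>"
  using measurable_mult by (simp cong: measurable_cong_sets sets_pair_measure_cong)

lemma measurable_mult_step: "(\<lambda>(g, h). g \<odot> h) \<in> measurable (\<mu> \<Otimes>\<^sub>M walk m) \<mu>"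
  using measurable_mult by (simp cong: measurable_cong_sets sets_pair_measure_cong)

lemma prob_space_walk: "prob_space (walk n)"
proof (induction n)
  case 0
  then show ?case by (simp add: prob_space_return one_in_space)
next
  case (Suc n)
  interpret A: prob_space \<mu> by (rule prob_space_step)
  interpret B: prob_space "walk n" by (rule Suc)
  interpret pair_prob_space \<mu> "walk n" ..
  show ?case
    using measurable_mult_step by (simp add: prob_space_distr)
qed

lemma measure_walk_space [simp]: "measure (walk n) (space \<mu>) = 1"
  using prob_space.prob_space[OF prob_space_walk[of n]] by simp

lemma measurable_mult_left:
  assumes "h \<in> space \<mu>" shows "(\<lambda>g. g \<odot> h) \<in> measurable \<mu> \<mu>"
  using measurable_compose[OF measurable_Pair2'[OF assms] measurable_mult] by simp

lemma measurable_mult_compose: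
  "f \<in> borel_measurable \<mu> \<Longrightarrow> (\<lambda>(g, h). f (g \<odot> h)) \<in> borel_measurable (\<mu> \<Otimes>\<^sub>M \<mu>)"
  using measurable_compose[OF measurable_mult, of f borel] by (simp add: case_prod_unfold)

lemma nn_integral_walk_Suc:
  assumes f [measurable]: "f \<in> borel_measurable \<mu>"
  shows "(\<integral>\<^sup>+g. f g \<partial>walk (Suc n)) = (\<integral>\<^sup>+h. \<integral>\<^sup>+g. f (g \<odot> h) \<partial>\<mu> \<partial>walk n)"
proof -
  interpret A: prob_space \<mu> by (rule prob_space_step)
  interpret B: prob_space "walk n" by (rule prob_space_walk)
  interpret pair_prob_space \<mu> "walk n" ..
  have m: "(\<lambda>p. f (fst p \<odot> snd p)) \<in> borel_measurable (\<mu> \<Otimes>\<^sub>M walk n)"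
    using measurable_mult_compose[OF f]
    by (simp add: case_prod_unfold cong: measurable_cong_sets sets_pair_measure_cong)
  have "(\<integral>\<^sup>+g. f g \<partial>walk (Suc n)) = (\<integral>\<^sup>+p. f (fst p \<odot> snd p) \<partial>(\<mu> \<Otimes>\<^sub>M walk n))"
    using measurable_mult_step[of n] by (simp add: nn_integral_distr case_prod_unfold)
  also have "\<dots> = (\<integral>\<^sup>+h. \<integral>\<^sup>+g. f (g \<odot> h) \<partial>\<mu> \<partial>walk n)"
    using nn_integral_snd[of "\<lambda>p. f (fst p \<odot> snd p)"] m by simp
  finally show ?thesis .
qed

text \<open>Markov property: \<open>h\<close> collects the first \<open>m\<close> steps and
  \<open>g\<close> the \<open>n\<close> later ones. Associativity lets the induction peel off the
  newest step.\<close>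

lemma nn_integral_walk_add:
  assumes f [measurable]: "f \<in> borel_measurable \<mu>"
  shows "(\<integral>\<^sup>+g. f g \<partial>walk (n + m)) = (\<integral>\<^sup>+h. \<integral>\<^sup>+g. f (g \<odot> h) \<partial>walk n \<partial>walk m)"
  using f
proof (induction n arbitrary: f)
  case 0
  have "(\<integral>\<^sup>+g. f (g \<odot> h) \<partial>walk 0) = f h" if "h \<in> space \<mu>" for h
    using measurable_compose[OF measurable_mult_left[OF that] 0]
    by (simp add: nn_integral_return one_in_space one_mult)
  then show ?case
    unfolding add_0 by (intro nn_integral_cong) (simp del: walk.simps)
next
  case (Suc n)
  interpret A: prob_space \<mu> by (rule prob_space_step)
  define F where "F h = (\<integral>\<^sup>+g. f (g \<odot> h) \<partial>\<mu>)" for h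
  have sw: "(\<lambda>(h, g). f (g \<odot> h)) \<in> borel_measurable (\<mu> \<Otimes>\<^sub>M \<mu>)"
    using measurable_compose[OF measurable_pair_swap' measurable_mult_compose[OF Suc.prems]]
    by (simp add: case_prod_unfold)
  have F: "F \<in> borel_measurable \<mu>"
    unfolding F_def using A.borel_measurable_nn_integral[OF sw] by simp
  have "(\<integral>\<^sup>+g. f g \<partial>walk (Suc n + m)) = (\<integral>\<^sup>+h. F h \<partial>walk (n + m))"
    using nn_integral_walk_Suc[OF Suc.prems, of "n + m"] by (simp add: F_def del: walk.simps)
  also have "\<dots> = (\<integral>\<^sup>+h. \<integral>\<^sup>+k. F (k \<odot> h) \<partial>walk n \<partial>walk m)"
    by (rule Suc.IH[OF F])
  also have "\<dots> = (\<integral>\<^sup>+h. \<integral>\<^sup>+g. f (g \<odot> h) \<partial>walk (Suc n) \<partial>walk m)"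
  proof (rule nn_integral_cong)
    fix h assume "h \<in> space (walk m)"
    then have "(\<lambda>g. f (g \<odot> h)) \<in> borel_measurable \<mu>"
      using measurable_compose[OF measurable_mult_left Suc.prems] by simp
    then show "(\<integral>\<^sup>+k. F (k \<odot> h) \<partial>walk n) = (\<integral>\<^sup>+g. f (g \<odot> h) \<partial>walk (Suc n))"
      using nn_integral_walk_Suc[of "\<lambda>g. f (g \<odot> h)" n] by (simp add: F_def mult_assoc del: walk.simps)
  qed
  finally show ?case .
qed

text \<open>The previous lemma applied to indicators. As an identity of measures it also transfers
  integrability and Bochner integrals, as \<open>\<phi>_add\<close> requires.\<close>

lemma walk_add: "walk (n + m) = distr (walk n \<Otimes>\<^sub>M walk m) \<mu> (\<lambda>(g, h). g \<odot> h)"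
proof (rule measure_eqI)
  interpret A: prob_space "walk n" by (rule prob_space_walk)
  interpret B: prob_space "walk m" by (rule prob_space_walk)
  interpret pair_prob_space "walk n" "walk m" ..
  fix E assume "E \<in> sets (walk (n + m))"
  then have E [measurable]: "E \<in> sets \<mu>" by simp
  have f: "(indicator E :: 'g \<Rightarrow> ennreal) \<in> borel_measurable \<mu>" by simp
  have m: "(\<lambda>p. indicator E (fst p \<odot> snd p) :: ennreal) \<in> borel_measurable (walk n \<Otimes>\<^sub>M walk m)"
    using measurable_mult_compose[OF f]
    by (simp add: case_prod_unfold cong: measurable_cong_sets sets_pair_measure_cong)
  have "emeasure (walk (n + m)) E = (\<integral>\<^sup>+g. indicator E g \<partial>walk (n + m))"
    by simp
  also have "\<dots> = (\<integral>\<^sup>+h. \<integral>\<^sup>+g. indicator E (g \<odot> h) \<partial>walk n \<partial>walk m)"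
    by (rule nn_integral_walk_add[OF f])
  also have "\<dots> = (\<integral>\<^sup>+p. indicator E (fst p \<odot> snd p) \<partial>(walk n \<Otimes>\<^sub>M walk m))"
    using nn_integral_snd[OF m] by simp
  also have "\<dots> = (\<integral>\<^sup>+g. indicator E g \<partial>distr (walk n \<Otimes>\<^sub>M walk m) \<mu> (\<lambda>(g, h). g \<odot> h))"
    using measurable_mult_walk[of n m]
    by (simp add: nn_integral_distr case_prod_unfold del: nn_integral_indicator)
  finally show "emeasure (walk (n + m)) E =
      emeasure (distr (walk n \<Otimes>\<^sub>M walk m) \<mu> (\<lambda>(g, h). g \<odot> h)) E"
    by simp
qed simp

end

section \<open>Exponential moments of cocycles\<close>

lemma exp_le_quadratic: "exp y \<le> 1 + y + y\<^sup>2 * exp \<bar>y\<bar>" for y :: real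
proof -
  obtain s where s: "\<bar>s\<bar> \<le> \<bar>y\<bar>" "exp y = (\<Sum>m<2. y ^ m / fact m) + exp s / fact 2 * y ^ 2"
    using Maclaurin_exp_le[of y 2] by blast
  have "exp s / fact 2 \<le> exp \<bar>y\<bar>"
  proof -
    have "exp s \<le> exp \<bar>y\<bar>" using s(1) by simp
    moreover have "exp s \<ge> 0" by simp
    ultimately show ?thesis unfolding fact_2 by linarith
  qed
  then have "exp s / fact 2 * y ^ 2 \<le> exp \<bar>y\<bar> * y ^ 2"
    by (rule mult_right_mono) simp
  then show ?thesis using s(2) by (simp add: numeral_2_eq_2 mult.commute)
qed

text \<open>
  In the application \<open>X\<close> is the set of non-zero vectors, \<open>c g x = ln (\<parallel>g x\<parallel> / \<parallel>x\<parallel>)\<close>, \<open>t g = ln \<parallel>g\<parallel>\<close>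
  and \<open>l\<close> is a length function dominating both.
\<close>

locale cocycle_walk = random_walk +
  fixes act :: "'a \<Rightarrow> 'x \<Rightarrow> 'x" and X :: "'x set" and c :: "'a \<Rightarrow> 'x \<Rightarrow> real"
    and t l :: "'a \<Rightarrow> real" and \<tau> :: real
  assumes X_nonempty: "X \<noteq> {}"
    and act_in: "g \<in> space \<mu> \<Longrightarrow> x \<in> X \<Longrightarrow> act g x \<in> X"
    and act_one: "x \<in> X \<Longrightarrow> act one x = x"
    and act_mult: "g \<in> space \<mu> \<Longrightarrow> h \<in> space \<mu> \<Longrightarrow> x \<in> X \<Longrightarrow> act (g \<odot> h) x = act g (act h x)"
    and c_mult: "g \<in> space \<mu> \<Longrightarrow> h \<in> space \<mu> \<Longrightarrow> x \<in> X \<Longrightarrow> c (g \<odot> h) x = c g (act h x) + c h x"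
    and c_measurable: "x \<in> X \<Longrightarrow> (\<lambda>g. c g x) \<in> borel_measurable \<mu>"
    and t_measurable [measurable]: "t \<in> borel_measurable \<mu>"
    and l_measurable [measurable]: "l \<in> borel_measurable \<mu>"
    and t_mult: "g \<in> space \<mu> \<Longrightarrow> h \<in> space \<mu> \<Longrightarrow> t (g \<odot> h) \<le> t g + t h"
    and l_mult: "g \<in> space \<mu> \<Longrightarrow> h \<in> space \<mu> \<Longrightarrow> l (g \<odot> h) \<le> l g + l h"
    and t_one: "t one \<le> 0"
    and c_le_t: "g \<in> space \<mu> \<Longrightarrow> x \<in> X \<Longrightarrow> c g x \<le> t g"
    and abs_c_le: "g \<in> space \<mu> \<Longrightarrow> x \<in> X \<Longrightarrow> \<bar>c g x\<bar> \<le> l g"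
    and abs_t_le: "g \<in> space \<mu> \<Longrightarrow> \<bar>t g\<bar> \<le> l g"
    and \<tau>_pos: "\<tau> > 0"
    and exp_moment: "(\<integral>\<^sup>+g. ennreal (exp (\<tau> * l g)) \<partial>\<mu>) < \<infinity>"
begin

lemma c_one: "x \<in> X \<Longrightarrow> c one x = 0"
  using c_mult[OF one_in_space one_in_space, of x] one_mult[of one] by (simp add: act_one)

lemma l_nonneg: "g \<in> space \<mu> \<Longrightarrow> 0 \<le> l g"
  using abs_t_le[of g] by simp

text \<open>
  The subcocycle inequality for \<open>u\<close> makes the suprema over \<open>x\<close> of exponential moments submultiplicative
  in the time.
\<close>

lemma exp_moment_add:
  assumes u: "\<And>x. x \<in> X \<Longrightarrow> (\<lambda>g. u g x) \<in> borel_measurable \<mu>"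
    and sub: "\<And>g h x. g \<in> space \<mu> \<Longrightarrow> h \<in> space \<mu> \<Longrightarrow> x \<in> X \<Longrightarrow> u (g \<odot> h) x \<le> u g (act h x) + u h x"
    and A: "\<And>x. x \<in> X \<Longrightarrow> (\<integral>\<^sup>+g. ennreal (exp (u g x)) \<partial>walk n) \<le> A"
    and B: "\<And>x. x \<in> X \<Longrightarrow> (\<integral>\<^sup>+g. ennreal (exp (u g x)) \<partial>walk m) \<le> B"
    and x: "x \<in> X"
  shows "(\<integral>\<^sup>+g. ennreal (exp (u g x)) \<partial>walk (n + m)) \<le> A * B"
proof -
  have [measurable]: "(\<lambda>g. u g x) \<in> borel_measurable \<mu>" by (rule u[OF x])
  have "(\<integral>\<^sup>+g. ennreal (exp (u g x)) \<partial>walk (n + m)) =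
      (\<integral>\<^sup>+h. \<integral>\<^sup>+g. ennreal (exp (u (g \<odot> h) x)) \<partial>walk n \<partial>walk m)"
    by (rule nn_integral_walk_add) measurable
  also have "\<dots> \<le> (\<integral>\<^sup>+h. A * ennreal (exp (u h x)) \<partial>walk m)"
  proof (rule nn_integral_mono)
    fix h assume "h \<in> space (walk m)"
    then have h: "h \<in> space \<mu>" by simp
    have hx: "act h x \<in> X" using act_in[OF h x] .
    have "(\<integral>\<^sup>+g. ennreal (exp (u (g \<odot> h) x)) \<partial>walk n) \<le>
        (\<integral>\<^sup>+g. ennreal (exp (u g (act h x))) * ennreal (exp (u h x)) \<partial>walk n)"
      using sub[OF _ h x]
      by (intro nn_integral_mono) (simp add: ennreal_mult[symmetric] exp_add[symmetric] ennreal_leI)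
    also have "\<dots> = (\<integral>\<^sup>+g. ennreal (exp (u g (act h x))) \<partial>walk n) * ennreal (exp (u h x))"
      using u[OF hx] by (intro nn_integral_multc) measurable
    also have "\<dots> \<le> A * ennreal (exp (u h x))"
      by (intro mult_right_mono A hx) simp
    finally show "(\<integral>\<^sup>+g. ennreal (exp (u (g \<odot> h) x)) \<partial>walk n) \<le> A * ennreal (exp (u h x))" .
  qed
  also have "\<dots> = A * (\<integral>\<^sup>+h. ennreal (exp (u h x)) \<partial>walk m)"
    by (intro nn_integral_cmult) measurable
  also have "\<dots> \<le> A * B"
    by (intro mult_left_mono B x) simp
  finally show ?thesis .
qed

text \<open>Iterates \<open>exp_moment_add\<close> over equal blocks; the assumption
  \<open>one\<close> settles the case of zero blocks, where the walk is a point mass.\<close>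

lemma exp_moment_mult:
  assumes u: "\<And>x. x \<in> X \<Longrightarrow> (\<lambda>g. u g x) \<in> borel_measurable \<mu>"
    and sub: "\<And>g h x. g \<in> space \<mu> \<Longrightarrow> h \<in> space \<mu> \<Longrightarrow> x \<in> X \<Longrightarrow> u (g \<odot> h) x \<le> u g (act h x) + u h x"
    and one: "\<And>x. x \<in> X \<Longrightarrow> u one x \<le> 0"
    and A: "\<And>x. x \<in> X \<Longrightarrow> (\<integral>\<^sup>+g. ennreal (exp (u g x)) \<partial>walk n) \<le> A"
    and x: "x \<in> X"
  shows "(\<integral>\<^sup>+g. ennreal (exp (u g x)) \<partial>walk (k * n)) \<le> A ^ k"
  using x
proof (induction k arbitrary: x)
  case 0
  have "(\<integral>\<^sup>+g. ennreal (exp (u g x)) \<partial>walk 0) = ennreal (exp (u one x))"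
    using u[OF 0] by (simp add: nn_integral_return one_in_space)
  then show ?case using one[OF 0] by (simp del: walk.simps)
next
  case (Suc k)
  show ?case
    using exp_moment_add[OF u sub A Suc.IH Suc.prems] by simp
qed

lemma exp_moment_walk: "(\<integral>\<^sup>+g. ennreal (exp (\<tau> * l g)) \<partial>walk n) < \<infinity>"
proof (induction n)
  case 0
  have "(\<integral>\<^sup>+g. ennreal (exp (\<tau> * l g)) \<partial>walk 0) = ennreal (exp (\<tau> * l one))"
    by (simp add: nn_integral_return one_in_space)
  then show ?case by simp
next
  case (Suc n)
  have "(\<integral>\<^sup>+g. ennreal (exp (\<tau> * l g)) \<partial>walk (Suc n)) =
      (\<integral>\<^sup>+h. \<integral>\<^sup>+g. ennreal (exp (\<tau> * l (g \<odot> h))) \<partial>\<mu> \<partial>walk n)"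
    by (rule nn_integral_walk_Suc) measurable
  also have "\<dots> \<le> (\<integral>\<^sup>+h. \<integral>\<^sup>+g. ennreal (exp (\<tau> * l g)) * ennreal (exp (\<tau> * l h)) \<partial>\<mu> \<partial>walk n)"
    using l_mult \<tau>_pos
    by (intro nn_integral_mono)
      (simp add: ennreal_mult[symmetric] exp_add[symmetric] ennreal_leI distrib_left[symmetric])
  also have "\<dots> = (\<integral>\<^sup>+g. ennreal (exp (\<tau> * l g)) \<partial>\<mu>) * (\<integral>\<^sup>+h. ennreal (exp (\<tau> * l h)) \<partial>walk n)"
    by (simp add: nn_integral_multc nn_integral_cmult)
  also have "\<dots> < \<infinity>"
    using exp_moment Suc by (simp add: ennreal_mult_less_top)
  finally show ?case .
qed

lemma integrable_exp_l: "integrable (walk n) (\<lambda>g. exp (\<tau> * l g))"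
  using exp_moment_walk[of n] by (intro integrableI_nonneg) auto

lemma integrable_l: "integrable (walk n) l"
proof (rule Bochner_Integration.integrable_bound[OF integrable_mult_right[where c = "1 / \<tau>", OF integrable_exp_l]])
  show "AE g in walk n. norm (l g) \<le> norm (1 / \<tau> * exp (\<tau> * l g))"
  proof (rule AE_I2)
    fix g assume "g \<in> space (walk n)"
    then have "0 \<le> l g" by (simp add: l_nonneg)
    moreover have "\<tau> * l g \<le> exp (\<tau> * l g)"
      using exp_ge_add_one_self[of "\<tau> * l g"] by linarith
    ultimately show "norm (l g) \<le> norm (1 / \<tau> * exp (\<tau> * l g))"
      using \<tau>_pos by (simp add: field_simps)
  qed
qed simp

lemma integrable_le_l:
  assumes "u \<in> borel_measurable \<mu>" "\<And>g. g \<in> space \<mu> \<Longrightarrow> \<bar>u g\<bar> \<le> K * l g"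
  shows "integrable (walk n) u"
  by (rule Bochner_Integration.integrable_bound[OF integrable_mult_right[where c = K, OF integrable_l]])
    (use assms in \<open>auto intro!: AE_I2 intro: order_trans[OF _ abs_ge_self]\<close>)

lemma integrable_c: "x \<in> X \<Longrightarrow> integrable (walk n) (\<lambda>g. c g x)"
  using integrable_le_l[of "\<lambda>g. c g x" 1] abs_c_le c_measurable by simp

lemma integrable_t: "integrable (walk n) t"
  using integrable_le_l[of t 1] abs_t_le by simp

text \<open>\<open>C\<close> depends on the time \<open>n\<close>, but neither on \<open>u\<close>
  nor on \<open>\<epsilon>\<close>: later \<open>u\<close> runs over all starting points, and a
  common remainder keeps the suprema under control.\<close>

lemma exp_moment_taylor:
  obtains \<epsilon>1 C where "\<epsilon>1 > 0" "C \<ge> 0"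
    "\<And>\<epsilon> u. 0 < \<epsilon> \<Longrightarrow> \<epsilon> \<le> \<epsilon>1 \<Longrightarrow> u \<in> borel_measurable \<mu> \<Longrightarrow>
      (\<And>g. g \<in> space \<mu> \<Longrightarrow> \<bar>u g\<bar> \<le> 2 * l g) \<Longrightarrow>
      (\<integral>\<^sup>+g. ennreal (exp (\<epsilon> * u g)) \<partial>walk n) \<le> ennreal (1 + \<epsilon> * (\<integral>g. u g \<partial>walk n) + \<epsilon>\<^sup>2 * C)"
proof
  interpret W: prob_space "walk n" by (rule prob_space_walk)
  \<comment> \<open>Put w = \<tau> l / 3. For \<epsilon> \<le> \<tau> / 6 and |u| \<le> 2 l both
    \<epsilon> |u| \<le> w and |u| \<le> 6 w / \<tau> hold, so the quadratic remainder is at most 36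
    \<epsilon>^2 / \<tau>^2 times w^2 exp w, and w^2 exp w \<le> exp (3 w) = exp (\<tau> l).\<close>
  let ?C = "36 / \<tau>\<^sup>2 * (\<integral>g. exp (\<tau> * l g) \<partial>walk n)"
  show "\<tau> / 6 > 0" using \<tau>_pos by simp
  show "?C \<ge> 0" by simp
  fix \<epsilon> :: real and u :: "'a \<Rightarrow> real"
  assume eps: "0 < \<epsilon>" "\<epsilon> \<le> \<tau> / 6" and u [measurable]: "u \<in> borel_measurable \<mu>"
    and le: "\<And>g. g \<in> space \<mu> \<Longrightarrow> \<bar>u g\<bar> \<le> 2 * l g"
  have int_u: "integrable (walk n) u"
    using integrable_le_l[OF u le] .
  let ?b = "\<lambda>g. 1 + \<epsilon> * u g + \<epsilon>\<^sup>2 * (36 / \<tau>\<^sup>2 * exp (\<tau> * l g))"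
  have bound: "exp (\<epsilon> * u g) \<le> ?b g" if g: "g \<in> space \<mu>" for g
  proof -
    define w where "w = \<tau> / 6 * (2 * l g)"
    have w0: "0 \<le> w" using \<tau>_pos l_nonneg[OF g] by (simp add: w_def)
    have "\<epsilon> * \<bar>u g\<bar> \<le> \<tau> / 6 * (2 * l g)"
      using eps le[OF g] by (intro mult_mono) auto
    then have ew: "\<bar>\<epsilon> * u g\<bar> \<le> w" using eps by (simp add: abs_mult w_def)
    have "\<bar>u g\<bar> \<le> 6 / \<tau> * w" using le[OF g] \<tau>_pos by (simp add: w_def)
    then have "\<epsilon> * \<bar>u g\<bar> \<le> \<epsilon> * (6 / \<tau> * w)" using eps by (intro mult_left_mono) auto
    then have "\<bar>\<epsilon> * u g\<bar> \<le> \<epsilon> * (6 / \<tau> * w)" using eps by (simp add: abs_mult)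
    then have "(\<epsilon> * u g)\<^sup>2 \<le> (\<epsilon> * (6 / \<tau> * w))\<^sup>2"
      by (metis abs_ge_zero power2_abs power_mono)
    also have "\<dots> = \<epsilon>\<^sup>2 * (36 / \<tau>\<^sup>2) * w\<^sup>2" by (simp add: power2_eq_square)
    also have "\<dots> \<le> \<epsilon>\<^sup>2 * (36 / \<tau>\<^sup>2) * exp (2 * w)"
    proof (rule mult_left_mono)
      have "w \<le> exp w" using exp_ge_add_one_self[of w] by linarith
      then have "w\<^sup>2 \<le> (exp w)\<^sup>2" using w0 by (intro power_mono)
      then show "w\<^sup>2 \<le> exp (2 * w)" by (simp add: exp_double)
    qed simp
    finally have sq: "(\<epsilon> * u g)\<^sup>2 \<le> \<epsilon>\<^sup>2 * (36 / \<tau>\<^sup>2) * exp (2 * w)" .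
    have "(\<epsilon> * u g)\<^sup>2 * exp \<bar>\<epsilon> * u g\<bar> \<le> \<epsilon>\<^sup>2 * (36 / \<tau>\<^sup>2) * exp (2 * w) * exp w"
      using sq ew by (intro mult_mono) auto
    also have "\<dots> = \<epsilon>\<^sup>2 * (36 / \<tau>\<^sup>2) * exp (2 * w + w)" by (simp only: exp_add mult.assoc)
    also have "2 * w + w = \<tau> * l g" by (simp add: w_def)
    finally show ?thesis using exp_le_quadratic[of "\<epsilon> * u g"] by simp
  qed
  have int_b: "integrable (walk n) ?b"
    using int_u integrable_exp_l[of n] by simp
  have "(\<integral>\<^sup>+g. ennreal (exp (\<epsilon> * u g)) \<partial>walk n) \<le> (\<integral>\<^sup>+g. ennreal (?b g) \<partial>walk n)"
    by (intro nn_integral_mono ennreal_leI bound) simp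
  also have "\<dots> = ennreal (\<integral>g. ?b g \<partial>walk n)"
  proof (rule nn_integral_eq_integral[OF int_b])
    show "AE g in walk n. 0 \<le> ?b g"
    proof (rule AE_I2)
      fix g assume "g \<in> space (walk n)"
      then have "exp (\<epsilon> * u g) \<le> ?b g" by (intro bound) simp
      then show "0 \<le> ?b g" by (rule order_trans[rotated]) simp
    qed
  qed
  also have "(\<integral>g. ?b g \<partial>walk n) = 1 + \<epsilon> * (\<integral>g. u g \<partial>walk n) + \<epsilon>\<^sup>2 * ?C"
    using int_u integrable_exp_l[of n] by simp
  finally show "(\<integral>\<^sup>+g. ennreal (exp (\<epsilon> * u g)) \<partial>walk n) \<le>
      ennreal (1 + \<epsilon> * (\<integral>g. u g \<partial>walk n) + \<epsilon>\<^sup>2 * ?C)" .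
qed

section \<open>Mean growth and the worst exponent\<close>

definition \<phi> :: "nat \<Rightarrow> 'x \<Rightarrow> real" where
  "\<phi> n x = (\<integral>g. c g x \<partial>walk n)"

lemma abs_\<phi>_le: "x \<in> X \<Longrightarrow> \<bar>\<phi> n x\<bar> \<le> (\<integral>g. l g \<partial>walk n)"
proof -
  assume x: "x \<in> X"
  have "\<bar>\<phi> n x\<bar> \<le> (\<integral>g. \<bar>c g x\<bar> \<partial>walk n)"
    unfolding \<phi>_def by (rule integral_abs_bound)
  also have "\<dots> \<le> (\<integral>g. l g \<partial>walk n)"
    using integrable_c[OF x] integrable_l abs_c_le[OF _ x] by (intro integral_mono) auto
  finally show ?thesis .
qed

text \<open>By the cocycle identity the function is the difference of c (g \<odot> h) x and c h x,
  which are measurable for fixed \<open>x\<close>; in this way no measurable structure on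
  \<open>X\<close> enters.\<close>

lemma c_act_measurable:
  assumes x: "x \<in> X"
  shows "(\<lambda>(g, h). c g (act h x)) \<in> borel_measurable (\<mu> \<Otimes>\<^sub>M \<mu>)"
proof -
  note c_measurable[OF x, measurable]
  have "(\<lambda>p. c (fst p \<odot> snd p) x - c (snd p) x) \<in> borel_measurable (\<mu> \<Otimes>\<^sub>M \<mu>)"
    using measurable_compose[OF measurable_mult c_measurable[OF x]]
    by (intro borel_measurable_diff) (auto simp: case_prod_unfold)
  then show ?thesis
    using c_mult[OF _ _ x]
    by (subst measurable_cong[where g = "\<lambda>p. c (fst p \<odot> snd p) x - c (snd p) x"])
      (auto simp: space_pair_measure)
qed

lemma c_act_measurable_walk:
  "x \<in> X \<Longrightarrow> (\<lambda>(g, h). c g (act h x)) \<in> borel_measurable (walk n \<Otimes>\<^sub>M walk m)"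
  using c_act_measurable[of x] by (simp cong: measurable_cong_sets sets_pair_measure_cong)

lemma \<phi>_act_measurable [measurable]:
  assumes x: "x \<in> X" shows "(\<lambda>h. \<phi> n (act h x)) \<in> borel_measurable \<mu>"
proof -
  interpret W: prob_space "walk n" by (rule prob_space_walk)
  have "(\<lambda>(h, g). c g (act h x)) \<in> borel_measurable (\<mu> \<Otimes>\<^sub>M \<mu>)"
    using measurable_compose[OF measurable_pair_swap' c_act_measurable[OF x]]
    by (simp add: case_prod_unfold)
  then have "(\<lambda>(h, g). c g (act h x)) \<in> borel_measurable (\<mu> \<Otimes>\<^sub>M walk n)"
    by (simp cong: measurable_cong_sets sets_pair_measure_cong)
  from W.borel_measurable_lebesgue_integral[OF this] show ?thesis
    by (simp add: \<phi>_def)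
qed

lemma integrable_\<phi>_act:
  assumes x: "x \<in> X" shows "integrable (walk m) (\<lambda>h. \<phi> n (act h x))"
proof -
  interpret W: prob_space "walk m" by (rule prob_space_walk)
  show ?thesis
    using abs_\<phi>_le[OF act_in[OF _ x]] \<phi>_act_measurable[OF x]
    by (intro W.integrable_const_bound[where B = "\<integral>g. l g \<partial>walk n"]) (auto intro!: AE_I2)
qed

text \<open>Expectation of the cocycle identity, split into the first \<open>m\<close> and the
  \<open>n\<close> later steps.\<close>

lemma \<phi>_add:
  assumes x: "x \<in> X"
  shows "\<phi> (n + m) x = (\<integral>h. \<phi> n (act h x) \<partial>walk m) + \<phi> m x"
proof -
  interpret A: prob_space "walk n" by (rule prob_space_walk)
  interpret B: prob_space "walk m" by (rule prob_space_walk)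
  interpret Q: pair_prob_space "walk n" "walk m" ..
  note c_measurable[OF x, measurable]
  have int: "integrable (walk n \<Otimes>\<^sub>M walk m) (\<lambda>p. c (fst p \<odot> snd p) x)"
    using integrable_c[OF x, of "n + m"] measurable_mult_walk[of n m]
    by (simp add: walk_add integrable_distr_eq case_prod_unfold)
  have "\<phi> (n + m) x = (\<integral>p. c (fst p \<odot> snd p) x \<partial>(walk n \<Otimes>\<^sub>M walk m))"
    using measurable_mult_walk[of n m]
    by (simp add: \<phi>_def walk_add integral_distr case_prod_unfold)
  also have "\<dots> = (\<integral>h. \<integral>g. c (g \<odot> h) x \<partial>walk n \<partial>walk m)"
    using Q.integral_snd[of "\<lambda>g h. c (g \<odot> h) x"] int by (simp add: case_prod_unfold)
  also have "\<dots> = (\<integral>h. \<phi> n (act h x) + c h x \<partial>walk m)"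
  proof (rule Bochner_Integration.integral_cong[OF refl])
    fix h assume "h \<in> space (walk m)"
    then have h: "h \<in> space \<mu>" by simp
    have "(\<integral>g. c (g \<odot> h) x \<partial>walk n) = (\<integral>g. c g (act h x) + c h x \<partial>walk n)"
      using c_mult[OF _ h x] by (intro Bochner_Integration.integral_cong) auto
    also have "\<dots> = \<phi> n (act h x) + c h x"
      using integrable_c[OF act_in[OF h x]] by (simp add: \<phi>_def)
    finally show "(\<integral>g. c (g \<odot> h) x \<partial>walk n) = \<phi> n (act h x) + c h x" .
  qed
  also have "\<dots> = (\<integral>h. \<phi> n (act h x) \<partial>walk m) + \<phi> m x"
    using integrable_\<phi>_act[OF x] integrable_c[OF x] by (simp add: \<phi>_def)
  finally show ?thesis .
qed

text \<open>The growth exponent from the worst starting point.\<close>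

definition \<beta> :: real where
  "\<beta> = (SUP n\<in>{1..}. (INF x\<in>X. \<phi> n x) / real n)"

lemma bdd_below_\<phi>: "bdd_below (\<phi> n ` X)"
  using abs_\<phi>_le by (intro bdd_belowI2[of _ "- (\<integral>g. l g \<partial>walk n)"]) (auto simp: abs_le_iff minus_le_iff)

text \<open>Makes the supremum in \<open>\<beta>\<close> finite: each further step adds at most the
  mean length of one step.\<close>

lemma \<phi>_le_linear:
  assumes x: "x \<in> X" shows "\<phi> n x \<le> real n * (\<integral>g. l g \<partial>walk 1)"
proof (induction n)
  case 0
  have "\<phi> 0 x = c one x"
    using c_measurable[OF x] by (simp add: \<phi>_def integral_return one_in_space)
  then show ?case using c_one[OF x] by simp
next
  case (Suc n)
  interpret W: prob_space "walk n" by (rule prob_space_walk)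
  have "(\<integral>h. \<phi> 1 (act h x) \<partial>walk n) \<le> (\<integral>h. (\<integral>g. l g \<partial>walk 1) \<partial>walk n)"
    using integrable_\<phi>_act[OF x] abs_\<phi>_le[OF act_in[OF _ x], of _ 1]
    by (intro integral_mono) (auto simp: abs_le_iff simp del: walk.simps)
  then show ?case
    using \<phi>_add[OF x, of 1 n] Suc by (simp add: algebra_simps del: walk.simps)
qed

lemma INF_\<phi>_le: "x \<in> X \<Longrightarrow> (INF x\<in>X. \<phi> n x) \<le> \<phi> n x"
  by (intro cINF_lower bdd_below_\<phi>)

lemma bdd_above_\<beta>: "bdd_above ((\<lambda>n. (INF x\<in>X. \<phi> n x) / real n) ` {1..})"
proof (rule bdd_aboveI2)
  fix n :: nat assume n: "n \<in> {1..}"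
  obtain x where x: "x \<in> X" using X_nonempty by blast
  have "(INF x\<in>X. \<phi> n x) \<le> real n * (\<integral>g. l g \<partial>walk 1)"
    using INF_\<phi>_le[OF x] \<phi>_le_linear[OF x] by (rule order_trans)
  then show "(INF x\<in>X. \<phi> n x) / real n \<le> (\<integral>g. l g \<partial>walk 1)"
    using n by (simp add: field_simps)
qed

text \<open>With \<open>exists_\<phi>_le\<close> this is what the argument draws from
  \<open>\<beta>\<close>: one block length good for all starting points, and for each time a point
  which is bad up to the error 1, as the infimum may not be attained.\<close>

lemma exists_\<phi>_ge:
  assumes "\<delta> > 0"
  obtains b where "b \<ge> 1" "\<And>x. x \<in> X \<Longrightarrow> real b * (\<beta> - \<delta>) \<le> \<phi> b x"
proof -
  have "\<beta> - \<delta> < (SUP n\<in>{1..}. (INF x\<in>X. \<phi> n x) / real n)"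
    using assms by (simp add: \<beta>_def)
  then obtain b :: nat where b: "b \<in> {1..}" "\<beta> - \<delta> < (INF x\<in>X. \<phi> b x) / real b"
    by (subst (asm) less_cSUP_iff[OF _ bdd_above_\<beta>]) auto
  then have "real b * (\<beta> - \<delta>) \<le> (INF x\<in>X. \<phi> b x)"
    by (simp add: field_simps)
  then have "real b * (\<beta> - \<delta>) \<le> \<phi> b x" if "x \<in> X" for x
    using INF_\<phi>_le[OF that] by (rule order_trans)
  with b(1) show ?thesis
    by (intro that[of b]) auto
qed

lemma exists_\<phi>_le:
  assumes "n \<ge> 1"
  obtains x where "x \<in> X" "\<phi> n x \<le> real n * \<beta> + 1"
proof -
  have "(INF x\<in>X. \<phi> n x) / real n \<le> \<beta>"
    unfolding \<beta>_def using assms by (intro cSUP_upper bdd_above_\<beta>) simp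
  then have "(INF x\<in>X. \<phi> n x) < real n * \<beta> + 1"
    using assms by (simp add: field_simps)
  then obtain x where "x \<in> X" "\<phi> n x < real n * \<beta> + 1"
    by (subst (asm) cINF_less_iff[OF X_nonempty bdd_below_\<phi>]) auto
  then show ?thesis
    by (intro that[of x]) auto
qed

text \<open>
  With \<open>Y = m \<beta> - c g x\<close> and \<open>m = k b\<close>, exponential moments of \<open>Y\<close> are controlled block by block, and
  \<open>max 0 Y \<le> a + exp (\<epsilon> (Y - a)) / \<epsilon>\<close> for \<open>a \<ge> 0\<close>.
\<close>

lemma lower_deviation:
  assumes \<delta>: "\<delta> > 0"
  obtains b a where "b \<ge> 1" "a \<ge> 0" "\<And>k x. x \<in> X \<Longrightarrow>
    (\<integral>g. max 0 (real (k * b) * \<beta> - c g x) \<partial>walk (k * b)) \<le> real (k * b) * \<delta> + a"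
proof -
  obtain b where b: "b \<ge> 1" "\<And>x. x \<in> X \<Longrightarrow> real b * (\<beta> - \<delta> / 2) \<le> \<phi> b x"
    using exists_\<phi>_ge[of "\<delta> / 2"] \<delta> by auto
  obtain \<epsilon>1 C where eC: "\<epsilon>1 > 0" "C \<ge> 0"
    "\<And>\<epsilon> u. 0 < \<epsilon> \<Longrightarrow> \<epsilon> \<le> \<epsilon>1 \<Longrightarrow> u \<in> borel_measurable \<mu> \<Longrightarrow>
      (\<And>g. g \<in> space \<mu> \<Longrightarrow> \<bar>u g\<bar> \<le> 2 * l g) \<Longrightarrow>
      (\<integral>\<^sup>+g. ennreal (exp (\<epsilon> * u g)) \<partial>walk b) \<le> ennreal (1 + \<epsilon> * (\<integral>g. u g \<partial>walk b) + \<epsilon>\<^sup>2 * C)"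
    using exp_moment_taylor[of b] by blast
  \<comment> \<open>The quadratic term costs at most \<epsilon> b \<delta> / 2; the other half was
    spent on the choice of \<open>b\<close>. A block moment is then at most 1 - \<epsilon> b
    (\<beta> - \<delta>), hence at most \<open>A\<close>. The denominator C + 1 is positive even for
    C = 0.\<close>
  define \<epsilon> where "\<epsilon> = min \<epsilon>1 (real b * \<delta> / 2 / (C + 1))"
  have eps: "0 < \<epsilon>" "\<epsilon> \<le> \<epsilon>1" "\<epsilon> * C \<le> real b * \<delta> / 2"
  proof -
    show "0 < \<epsilon>" "\<epsilon> \<le> \<epsilon>1" using eC(1,2) b(1) \<delta> by (simp_all add: \<epsilon>_def)
    have "\<epsilon> * (C + 1) \<le> real b * \<delta> / 2"
      using eC(2) by (subst pos_le_divide_eq[symmetric]) (simp_all add: \<epsilon>_def)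
    then show "\<epsilon> * C \<le> real b * \<delta> / 2" using \<open>0 < \<epsilon>\<close> by (simp add: algebra_simps)
  qed
  define A where "A = exp (- (\<epsilon> * (real b * (\<beta> - \<delta>))))"
  have one_block: "(\<integral>\<^sup>+g. ennreal (exp (\<epsilon> * (- c g x))) \<partial>walk b) \<le> ennreal A" if x: "x \<in> X" for x
  proof -
    have "\<bar>- c g x\<bar> \<le> 2 * l g" if "g \<in> space \<mu>" for g
      using abs_c_le[OF that x] l_nonneg[OF that] by simp
    then have "(\<integral>\<^sup>+g. ennreal (exp (\<epsilon> * (- c g x))) \<partial>walk b) \<le>
        ennreal (1 + \<epsilon> * (\<integral>g. - c g x \<partial>walk b) + \<epsilon>\<^sup>2 * C)"
      using eps c_measurable[OF x] by (intro eC(3)) auto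
    also have "\<dots> \<le> ennreal A"
    proof (rule ennreal_leI)
      have "\<epsilon> * (\<integral>g. - c g x \<partial>walk b) \<le> \<epsilon> * (- (real b * (\<beta> - \<delta> / 2)))"
        using b(2)[OF x] eps(1) by (intro mult_left_mono) (auto simp: \<phi>_def)
      moreover have "\<epsilon>\<^sup>2 * C \<le> \<epsilon> * (real b * \<delta> / 2)"
        using eps(1,3) by (simp add: power2_eq_square mult.assoc)
      ultimately have "1 + \<epsilon> * (\<integral>g. - c g x \<partial>walk b) + \<epsilon>\<^sup>2 * C \<le> 1 + - (\<epsilon> * (real b * (\<beta> - \<delta>)))"
        by (simp add: algebra_simps)
      also have "\<dots> \<le> A" unfolding A_def by (rule exp_ge_add_one_self)
      finally show "1 + \<epsilon> * (\<integral>g. - c g x \<partial>walk b) + \<epsilon>\<^sup>2 * C \<le> A" .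
    qed
    finally show ?thesis .
  qed
  \<comment> \<open>The bound A ^ k cancels the factor exp (\<epsilon> m (\<beta> - \<delta>))
    exactly, so the excess over m \<delta> is 1 / \<epsilon> for every number of blocks.\<close>
  have main: "(\<integral>g. max 0 (real (k * b) * \<beta> - c g x) \<partial>walk (k * b)) \<le> real (k * b) * \<delta> + 1 / \<epsilon>"
    if x: "x \<in> X" for k x
  proof -
    let ?m = "real (k * b)"
    note c_measurable[OF x, measurable]
    have blocks: "(\<integral>\<^sup>+g. ennreal (exp (\<epsilon> * (- c g x))) \<partial>walk (k * b)) \<le> ennreal A ^ k"
    proof (rule exp_moment_mult[where u = "\<lambda>g x. \<epsilon> * (- c g x)"])
      show "(\<lambda>g. \<epsilon> * - c g y) \<in> borel_measurable \<mu>" if "y \<in> X" for y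
        using c_measurable[OF that] by simp
    qed (use c_mult c_one one_block x in \<open>auto simp: algebra_simps\<close>)
    have Ak: "ennreal A ^ k = ennreal (exp (- (\<epsilon> * (?m * (\<beta> - \<delta>)))))"
      by (simp add: A_def ennreal_power exp_of_nat_mult[symmetric] algebra_simps)
    have pt: "max 0 (?m * \<beta> - c g x) \<le>
        ?m * \<delta> + (1 / \<epsilon>) * (exp (\<epsilon> * (?m * (\<beta> - \<delta>))) * exp (\<epsilon> * (- c g x)))" for g
    proof -
      let ?z = "?m * \<beta> - c g x - ?m * \<delta>"
      have "\<epsilon> * ?z \<le> exp (\<epsilon> * ?z)" using exp_ge_add_one_self[of "\<epsilon> * ?z"] by linarith
      then have "?z \<le> (1 / \<epsilon>) * exp (\<epsilon> * ?z)" using eps(1) by (simp add: field_simps)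
      moreover have "0 \<le> ?m * \<delta>" using \<delta> by simp
      moreover have "0 \<le> (1 / \<epsilon>) * exp (\<epsilon> * ?z)" using eps(1) by simp
      moreover have "max 0 p \<le> r + w" if "p - r \<le> w" "0 \<le> r" "0 \<le> w" for p r w :: real
        using that by auto
      ultimately have "max 0 (?m * \<beta> - c g x) \<le> ?m * \<delta> + (1 / \<epsilon>) * exp (\<epsilon> * ?z)"
        by blast
      also have "exp (\<epsilon> * ?z) = exp (\<epsilon> * (?m * (\<beta> - \<delta>))) * exp (\<epsilon> * (- c g x))"
        by (simp add: exp_add[symmetric] algebra_simps)
      finally show ?thesis .
    qed
    have "(\<integral>\<^sup>+g. ennreal (max 0 (?m * \<beta> - c g x)) \<partial>walk (k * b)) \<le>
        (\<integral>\<^sup>+g. ennreal (?m * \<delta>) + ennreal (1 / \<epsilon> * exp (\<epsilon> * (?m * (\<beta> - \<delta>)))) *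
          ennreal (exp (\<epsilon> * (- c g x))) \<partial>walk (k * b))"
      using pt eps(1) \<delta>
      by (intro nn_integral_mono)
        (simp add: ennreal_mult[symmetric] ennreal_plus[symmetric] ennreal_leI mult.assoc del: ennreal_plus)
    also have "\<dots> = ennreal (?m * \<delta>) + ennreal (1 / \<epsilon> * exp (\<epsilon> * (?m * (\<beta> - \<delta>)))) *
          (\<integral>\<^sup>+g. ennreal (exp (\<epsilon> * (- c g x))) \<partial>walk (k * b))"
      by (simp add: nn_integral_add nn_integral_cmult prob_space.emeasure_space_1[OF prob_space_walk, simplified])
    also have "\<dots> \<le> ennreal (?m * \<delta>) + ennreal (1 / \<epsilon> * exp (\<epsilon> * (?m * (\<beta> - \<delta>)))) *
          ennreal (exp (- (\<epsilon> * (?m * (\<beta> - \<delta>)))))"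
      using blocks unfolding Ak by (intro add_left_mono mult_left_mono) auto
    also have "\<dots> = ennreal (?m * \<delta> + 1 / \<epsilon>)"
    proof -
      have "1 / \<epsilon> * exp (\<epsilon> * (?m * (\<beta> - \<delta>))) * exp (- (\<epsilon> * (?m * (\<beta> - \<delta>)))) = 1 / \<epsilon>"
        by (simp only: mult.assoc exp_minus_inverse mult_1_right)
      then show ?thesis using eps(1) \<delta>
        by (simp add: ennreal_mult[symmetric] ennreal_plus[symmetric] del: ennreal_plus)
    qed
    finally have *: "(\<integral>\<^sup>+g. ennreal (max 0 (?m * \<beta> - c g x)) \<partial>walk (k * b)) \<le> ennreal (?m * \<delta> + 1 / \<epsilon>)" .
    have "integrable (walk (k * b)) (\<lambda>g. max 0 (?m * \<beta> - c g x))"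
      using integrable_c[OF x] prob_space.finite_measure[OF prob_space_walk, of "k * b"]
      by (intro integrable_max) (auto simp: finite_measure.integrable_const)
    then have "(\<integral>\<^sup>+g. ennreal (max 0 (?m * \<beta> - c g x)) \<partial>walk (k * b)) =
        ennreal (\<integral>g. max 0 (?m * \<beta> - c g x) \<partial>walk (k * b))"
      by (intro nn_integral_eq_integral) auto
    with * have "ennreal (\<integral>g. max 0 (?m * \<beta> - c g x) \<partial>walk (k * b)) \<le> ennreal (?m * \<delta> + 1 / \<epsilon>)"
      by (simp only:)
    moreover have "0 \<le> ?m * \<delta> + 1 / \<epsilon>"
      using eps(1) \<delta> by simp
    ultimately show ?thesis
      using ennreal_le_iff by blast
  qed
  show ?thesis
    by (rule that[of b "1 / \<epsilon>"]) (use b main eps in auto)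
qed

text \<open>
  The average of the first \<open>n\<close> laws of \<open>g\<^sub>j \<cdots> g\<^sub>1 x\<close>, with \<open>x\<close> nearly worst for time \<open>n\<close>, replaces a
  stationary measure of minimal exponent: against it \<open>c g y - m \<beta>\<close> has mean at most \<open>1\<close>, its negative
  part is small, and \<open>spread\<close> lets its positive part dominate \<open>t g - \<kappa> - m \<beta>\<close>.
\<close>

lemma integral_t_le:
  fixes D :: nat and \<eta> \<kappa> B :: real
  assumes \<eta>: "\<eta> > 0" and D: "D \<ge> 1"
    and spread: "\<And>g x. g \<in> space \<mu> \<Longrightarrow> x \<in> X \<Longrightarrow>
      ennreal \<eta> \<le> (\<Sum>i<D. emeasure (walk i) {h \<in> space \<mu>. t g - \<kappa> \<le> c g (act h x)})"
    and B: "\<And>x. x \<in> X \<Longrightarrow> (\<integral>g. max 0 (real m * \<beta> - c g x) \<partial>walk m) \<le> B"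
  shows "(\<integral>g. t g \<partial>walk m) \<le> real m * \<beta> + \<kappa> + real D / \<eta> * (1 + B)"
proof -
  let ?M = "real m * \<beta>"
  let ?C = "\<Sum>i<m. \<integral>g. l g \<partial>walk i"
  interpret WM: prob_space "walk m" by (rule prob_space_walk)
  have B0: "B \<ge> 0"
  proof -
    obtain x where "x \<in> X" using X_nonempty by blast
    moreover have "0 \<le> (\<integral>g. max 0 (?M - c g x) \<partial>walk m)" for x
      by (intro Bochner_Integration.integral_nonneg) simp
    ultimately show ?thesis using B by (meson order_trans)
  qed
  \<comment> \<open>The time n = N D can be cut into windows of \<open>D\<close> times, and it is at
    least m + 2 C, which dominates the boundary terms of the telescoping sum below.\<close>
  define N where "N = nat \<lceil>real m + 2 * ?C\<rceil> + 1"
  define n where "n = N * D"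
  have N1: "N \<ge> 1" by (simp add: N_def)
  have n1: "n \<ge> 1" using N1 D by (simp add: n_def)
  have "real N \<ge> real m + 2 * ?C" unfolding N_def by linarith
  also have "real N \<le> real n" unfolding n_def using D by (intro of_nat_mono) simp
  finally have n_ge: "real m + 2 * ?C \<le> real n" by simp
  obtain x where x: "x \<in> X" "\<phi> n x \<le> real n * \<beta> + 1" using exists_\<phi>_le[OF n1] .
  define F where "F g y = max 0 (c g y - ?M)" for g y
  have F_act_meas: "(\<lambda>(g, h). F g (act h y)) \<in> borel_measurable (walk i \<Otimes>\<^sub>M walk j)"
    if "y \<in> X" for y i j
    using c_act_measurable_walk[OF that, of i j] by (simp add: F_def case_prod_unfold)
  have F_act_meas2: "(\<lambda>h. F g (act h y)) \<in> borel_measurable \<mu>" if "y \<in> X" "g \<in> space \<mu>" for g y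
    using measurable_compose[OF measurable_Pair1'[of g "walk 0" "walk 0"] F_act_meas[OF that(1), of 0 0]] that(2)
    by simp
  let ?J = "\<Sum>j<n. \<integral>\<^sup>+h. \<integral>\<^sup>+g. ennreal (F g (act h x)) \<partial>walk m \<partial>walk j"

  \<comment> \<open>The positive part is the signed value plus the negative part, so its mean is
    governed by \<phi> m y up to \<open>B\<close>.\<close>
  have inner: "(\<integral>\<^sup>+g. ennreal (F g y) \<partial>walk m) \<le> ennreal (\<phi> m y - ?M + B)"
      and inner_nonneg: "0 \<le> \<phi> m y - ?M + B" if y: "y \<in> X" for y
  proof -
    have i1: "integrable (walk m) (\<lambda>g. max 0 (?M - c g y))"
      using integrable_c[OF y] by (intro integrable_max) auto
    have i2: "integrable (walk m) (\<lambda>g. F g y)"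
      unfolding F_def using integrable_c[OF y] by (intro integrable_max) auto
    have "(\<integral>g. F g y \<partial>walk m) = (\<integral>g. (c g y - ?M) + max 0 (?M - c g y) \<partial>walk m)"
      by (intro Bochner_Integration.integral_cong) (auto simp: F_def)
    also have "\<dots> = \<phi> m y - ?M + (\<integral>g. max 0 (?M - c g y) \<partial>walk m)"
      using i1 integrable_c[OF y] by (simp add: \<phi>_def)
    finally have le: "(\<integral>g. F g y \<partial>walk m) \<le> \<phi> m y - ?M + B" using B[OF y] by simp
    have nn: "0 \<le> (\<integral>g. F g y \<partial>walk m)" by (intro Bochner_Integration.integral_nonneg) (simp add: F_def)
    show "0 \<le> \<phi> m y - ?M + B" using le nn by linarith
    have "(\<integral>\<^sup>+g. ennreal (F g y) \<partial>walk m) = ennreal (\<integral>g. F g y \<partial>walk m)"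
      using i2 by (intro nn_integral_eq_integral) (auto simp: F_def)
    then show "(\<integral>\<^sup>+g. ennreal (F g y) \<partial>walk m) \<le> ennreal (\<phi> m y - ?M + B)"
      using le by (simp add: ennreal_leI)
  qed
  have step: "(\<integral>\<^sup>+h. \<integral>\<^sup>+g. ennreal (F g (act h x)) \<partial>walk m \<partial>walk j) \<le>
      ennreal (\<phi> (m + j) x - \<phi> j x - ?M + B)"
    and step_nonneg: "0 \<le> \<phi> (m + j) x - \<phi> j x - ?M + B" for j
  proof -
    interpret W: prob_space "walk j" by (rule prob_space_walk)
    have i: "integrable (walk j) (\<lambda>h. \<phi> m (act h x) - ?M + B)"
      using integrable_\<phi>_act[OF x(1)] by simp
    have val: "(\<integral>h. \<phi> m (act h x) - ?M + B \<partial>walk j) = \<phi> (m + j) x - \<phi> j x - ?M + B"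
      using integrable_\<phi>_act[OF x(1)] \<phi>_add[OF x(1), of m j] by simp
    have nn: "AE h in walk j. 0 \<le> \<phi> m (act h x) - ?M + B"
      using inner_nonneg act_in[OF _ x(1)] by (intro AE_I2) simp
    have "(\<integral>\<^sup>+h. \<integral>\<^sup>+g. ennreal (F g (act h x)) \<partial>walk m \<partial>walk j) \<le>
        (\<integral>\<^sup>+h. ennreal (\<phi> m (act h x) - ?M + B) \<partial>walk j)"
      using inner act_in[OF _ x(1)] by (intro nn_integral_mono) simp
    also have "\<dots> = ennreal (\<phi> (m + j) x - \<phi> j x - ?M + B)"
      using nn_integral_eq_integral[OF i nn] val by simp
    finally show "(\<integral>\<^sup>+h. \<integral>\<^sup>+g. ennreal (F g (act h x)) \<partial>walk m \<partial>walk j) \<le>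
      ennreal (\<phi> (m + j) x - \<phi> j x - ?M + B)" .
    show "0 \<le> \<phi> (m + j) x - \<phi> j x - ?M + B"
      using integral_nonneg_AE[OF nn] val by simp
  qed
  \<comment> \<open>Shifting by \<open>m\<close> leaves \<open>m\<close> terms at either end. At the
    far end \<phi> (n + i) x exceeds \<phi> n x by at most the mean length of \<open>i\<close>
    steps, and \<phi> n x \<le> n \<beta> + 1 by the choice of \<open>x\<close>.\<close>
  have telescope: "(\<Sum>j<n. \<phi> (m + j) x - \<phi> j x) \<le> real m * (real n * \<beta> + 1) + 2 * ?C"
  proof -
    have "(\<Sum>j<n. \<phi> (m + j) x) + (\<Sum>i<m. \<phi> i x) = (\<Sum>i<m. \<phi> (n + i) x) + (\<Sum>j<n. \<phi> j x)"
    proof -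
      have "(\<Sum>j<a + b. \<phi> j x) = (\<Sum>j<a. \<phi> j x) + (\<Sum>j<b. \<phi> (a + j) x)" for a b :: nat
        by (induction b) auto
      from this[of m n] this[of n m] show ?thesis by (simp add: add.commute)
    qed
    moreover have "(\<Sum>i<m. \<phi> (n + i) x) \<le> (\<Sum>i<m. (\<integral>g. l g \<partial>walk i) + (real n * \<beta> + 1))"
    proof (rule sum_mono)
      fix i
      interpret W: prob_space "walk n" by (rule prob_space_walk)
      have "(\<integral>h. \<phi> i (act h x) \<partial>walk n) \<le> (\<integral>h. (\<integral>g. l g \<partial>walk i) \<partial>walk n)"
        using integrable_\<phi>_act[OF x(1)] abs_\<phi>_le[OF act_in[OF _ x(1)], of _ i]
        by (intro integral_mono) (auto simp: abs_le_iff)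
      then show "\<phi> (n + i) x \<le> (\<integral>g. l g \<partial>walk i) + (real n * \<beta> + 1)"
        using \<phi>_add[OF x(1), of i n] x(2) by (simp add: add.commute)
    qed
    moreover have "(\<Sum>i<m. - \<phi> i x) \<le> ?C"
      using abs_\<phi>_le[OF x(1)] by (intro sum_mono) (simp add: abs_le_iff)
    ultimately show ?thesis by (simp add: sum.distrib sum_subtractf sum_negf)
  qed
  have upper: "?J \<le> ennreal (real n * (1 + B))"
  proof -
    have "?J \<le> (\<Sum>j<n. ennreal (\<phi> (m + j) x - \<phi> j x - ?M + B))"
      by (intro sum_mono step)
    also have "\<dots> = ennreal (\<Sum>j<n. \<phi> (m + j) x - \<phi> j x - ?M + B)"
      by (intro sum_ennreal step_nonneg)
    also have "\<dots> \<le> ennreal (real n * (1 + B))"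
    proof (rule ennreal_leI)
      have "(\<Sum>j<n. \<phi> (m + j) x - \<phi> j x - ?M + B) = (\<Sum>j<n. \<phi> (m + j) x - \<phi> j x) + real n * (B - ?M)"
        by (simp add: sum.distrib sum_subtractf algebra_simps)
      then show "(\<Sum>j<n. \<phi> (m + j) x - \<phi> j x - ?M + B) \<le> real n * (1 + B)"
        using telescope n_ge by (simp add: algebra_simps)
    qed
    finally show ?thesis .
  qed

  \<comment> \<open>For any \<open>D\<close> consecutive times: condition on the position after
    \<open>r\<close> steps and apply \<open>spread\<close> there. On the good set the positive part
    is at least t g - \<kappa> - m \<beta>.\<close>
  have window: "(\<Sum>i<D. \<integral>\<^sup>+h. ennreal (F g (act h x)) \<partial>walk (i + r)) \<ge> ennreal (\<eta> * (t g - \<kappa> - ?M))"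
    if g: "g \<in> space \<mu>" for g r
  proof -
    interpret W: prob_space "walk r" by (rule prob_space_walk)
    let ?s = "max 0 (t g - \<kappa> - ?M)"
    let ?G = "\<lambda>y. {h \<in> space \<mu>. t g - \<kappa> \<le> c g (act h y)}"
    have G: "?G y \<in> sets \<mu>" if "y \<in> X" for y
    proof -
      have "(\<lambda>h. c g (act h y)) \<in> borel_measurable \<mu>"
        using measurable_compose[OF measurable_Pair1'[OF g] c_act_measurable[OF that]] by simp
      then show ?thesis by measurable
    qed
    have meas: "(\<lambda>h'. \<integral>\<^sup>+h. ennreal (F g (act (h \<odot> h') x)) \<partial>walk i) \<in> borel_measurable (walk r)" for i
    proof -
      interpret V: prob_space "walk i" by (rule prob_space_walk)
      have "(\<lambda>(h, h'). ennreal (F g (act (h \<odot> h') x))) \<in> borel_measurable (\<mu> \<Otimes>\<^sub>M \<mu>)"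
        using F_act_meas2[OF x(1) g] by (intro measurable_mult_compose) measurable
      from measurable_compose[OF measurable_pair_swap' this]
      have "(\<lambda>(h', h). ennreal (F g (act (h \<odot> h') x))) \<in> borel_measurable (walk r \<Otimes>\<^sub>M walk i)"
        by (simp add: case_prod_unfold cong: measurable_cong_sets sets_pair_measure_cong)
      from V.borel_measurable_nn_integral[OF this] show ?thesis by simp
    qed
    have "ennreal (\<eta> * (t g - \<kappa> - ?M)) \<le> ennreal (\<eta> * ?s)"
      using \<eta> by (intro ennreal_leI mult_left_mono) auto
    also have "\<dots> = (\<integral>\<^sup>+h'. ennreal (\<eta> * ?s) \<partial>walk r)"
      using W.emeasure_space_1 by simp
    also have "\<dots> \<le> (\<integral>\<^sup>+h'. (\<Sum>i<D. \<integral>\<^sup>+h. ennreal (F g (act (h \<odot> h') x)) \<partial>walk i) \<partial>walk r)"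
    proof (rule nn_integral_mono)
      fix h' assume "h' \<in> space (walk r)"
      then have h': "h' \<in> space \<mu>" by simp
      let ?y = "act h' x"
      have y: "?y \<in> X" using act_in[OF h' x(1)] .
      have "ennreal (\<eta> * ?s) = ennreal ?s * ennreal \<eta>"
        using \<eta> by (subst mult.commute, intro ennreal_mult) auto
      also have "\<dots> \<le> ennreal ?s * (\<Sum>i<D. emeasure (walk i) (?G ?y))"
        by (intro mult_left_mono spread g y) simp
      also have "\<dots> = (\<Sum>i<D. \<integral>\<^sup>+h. ennreal ?s * indicator (?G ?y) h \<partial>walk i)"
        using G[OF y] by (simp add: sum_distrib_left nn_integral_cmult_indicator)
      also have "\<dots> \<le> (\<Sum>i<D. \<integral>\<^sup>+h. ennreal (F g (act (h \<odot> h') x)) \<partial>walk i)"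
      proof (intro sum_mono nn_integral_mono)
        fix i h assume "h \<in> space (walk i)"
        then show "ennreal ?s * indicator (?G ?y) h \<le> ennreal (F g (act (h \<odot> h') x))"
          using act_mult[OF _ h' x(1)] by (auto simp: indicator_def F_def intro!: ennreal_leI)
      qed
      finally show "ennreal (\<eta> * ?s) \<le> (\<Sum>i<D. \<integral>\<^sup>+h. ennreal (F g (act (h \<odot> h') x)) \<partial>walk i)" .
    qed
    also have "\<dots> = (\<Sum>i<D. \<integral>\<^sup>+h'. \<integral>\<^sup>+h. ennreal (F g (act (h \<odot> h') x)) \<partial>walk i \<partial>walk r)"
      using meas by (intro nn_integral_sum) simp
    also have "\<dots> = (\<Sum>i<D. \<integral>\<^sup>+h. ennreal (F g (act h x)) \<partial>walk (i + r))"
      using F_act_meas2[OF x(1) g] by (intro sum.cong refl nn_integral_walk_add[symmetric]) measurable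
    finally show ?thesis .
  qed
  \<comment> \<open>The \<open>N\<close> windows fill the times below \<open>n\<close>; integrating
    over \<open>g\<close> and exchanging the integrals leads back to the quantity bounded in
    \<open>upper\<close>.\<close>
  have lower: "ennreal (real N * \<eta> * ((\<integral>g. t g \<partial>walk m) - \<kappa> - ?M)) \<le> ?J"
  proof -
    have pt: "ennreal (real N * \<eta> * (t g - \<kappa> - ?M)) \<le> (\<Sum>j<n. \<integral>\<^sup>+h. ennreal (F g (act h x)) \<partial>walk j)"
      if g: "g \<in> space \<mu>" for g
    proof -
      have "ennreal (real N * \<eta> * (t g - \<kappa> - ?M)) = (\<Sum>k<N. ennreal (\<eta> * (t g - \<kappa> - ?M)))"
        by (simp add: ennreal_mult' mult.assoc ennreal_of_nat_eq_real_of_nat)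
      also have "\<dots> \<le> (\<Sum>k<N. \<Sum>i<D. \<integral>\<^sup>+h. ennreal (F g (act h x)) \<partial>walk (i + k * D))"
        by (intro sum_mono window g)
      also have "\<dots> = (\<Sum>k<N. \<Sum>j\<in>{k * D..<k * D + D}. \<integral>\<^sup>+h. ennreal (F g (act h x)) \<partial>walk j)"
      proof (rule sum.cong[OF refl])
        fix k
        show "(\<Sum>i<D. \<integral>\<^sup>+h. ennreal (F g (act h x)) \<partial>walk (i + k * D)) =
            (\<Sum>j\<in>{k * D..<k * D + D}. \<integral>\<^sup>+h. ennreal (F g (act h x)) \<partial>walk j)"
          using sum.shift_bounds_nat_ivl[of "\<lambda>j. \<integral>\<^sup>+h. ennreal (F g (act h x)) \<partial>walk j" 0 "k * D" D]
          by (simp add: atLeast0LessThan add.commute)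
      qed
      also have "\<dots> = (\<Sum>j<n. \<integral>\<^sup>+h. ennreal (F g (act h x)) \<partial>walk j)"
        unfolding n_def by (rule sum.nat_group)
      finally show ?thesis .
    qed
    have meas: "(\<lambda>g. \<integral>\<^sup>+h. ennreal (F g (act h x)) \<partial>walk j) \<in> borel_measurable (walk m)" for j
    proof -
      interpret V: prob_space "walk j" by (rule prob_space_walk)
      have "(\<lambda>(g, h). ennreal (F g (act h x))) \<in> borel_measurable (walk m \<Otimes>\<^sub>M walk j)"
        using F_act_meas[OF x(1), of m j] by (simp add: case_prod_unfold)
      from V.borel_measurable_nn_integral[OF this] show ?thesis by simp
    qed
    let ?u = "\<lambda>g. real N * \<eta> * (t g - \<kappa> - ?M)"
    have "ennreal (real N * \<eta> * ((\<integral>g. t g \<partial>walk m) - \<kappa> - ?M)) = ennreal (\<integral>g. ?u g \<partial>walk m)"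
      using integrable_t by simp
    also have "\<dots> \<le> ennreal (\<integral>g. max 0 (?u g) \<partial>walk m)"
      using integrable_t by (intro ennreal_leI integral_mono integrable_max) auto
    also have "\<dots> = (\<integral>\<^sup>+g. ennreal (max 0 (?u g)) \<partial>walk m)"
      using integrable_t by (intro nn_integral_eq_integral[symmetric] integrable_max) auto
    also have "\<dots> \<le> (\<integral>\<^sup>+g. (\<Sum>j<n. \<integral>\<^sup>+h. ennreal (F g (act h x)) \<partial>walk j) \<partial>walk m)"
      using pt by (intro nn_integral_mono) (simp add: max_def)
    also have "\<dots> = (\<Sum>j<n. \<integral>\<^sup>+g. \<integral>\<^sup>+h. ennreal (F g (act h x)) \<partial>walk j \<partial>walk m)"
      using meas by (intro nn_integral_sum)
    also have "\<dots> = ?J"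
    proof (rule sum.cong[OF refl])
      fix j
      interpret V: prob_space "walk j" by (rule prob_space_walk)
      interpret pair_prob_space "walk m" "walk j" ..
      have f: "(\<lambda>(g, h). ennreal (F g (act h x))) \<in> borel_measurable (walk m \<Otimes>\<^sub>M walk j)"
        using F_act_meas[OF x(1), of m j] by (simp add: case_prod_unfold)
      from Fubini'[OF f]
      show "(\<integral>\<^sup>+g. \<integral>\<^sup>+h. ennreal (F g (act h x)) \<partial>walk j \<partial>walk m) =
          (\<integral>\<^sup>+h. \<integral>\<^sup>+g. ennreal (F g (act h x)) \<partial>walk m \<partial>walk j)" by simp
    qed
    finally show ?thesis .
  qed
  have "0 \<le> real n * (1 + B)" using B0 by simp
  then have "real N * \<eta> * ((\<integral>g. t g \<partial>walk m) - \<kappa> - ?M) \<le> real n * (1 + B)"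
    using order_trans[OF lower upper] ennreal_le_iff by blast
  \<comment> \<open>As n = N D, the auxiliary number \<open>N\<close> drops out and the factor D /
    \<eta> remains.\<close>
  then have "\<eta> * ((\<integral>g. t g \<partial>walk m) - \<kappa> - ?M) \<le> real D * (1 + B)"
    using N1 by (simp add: n_def mult.assoc)
  then have "(\<integral>g. t g \<partial>walk m) - \<kappa> - ?M \<le> real D * (1 + B) / \<eta>"
    using \<eta> by (simp add: pos_le_divide_eq mult.commute)
  then show ?thesis by simp
qed

text \<open>Budget for \<gamma>: a quarter goes to the mean over a block, a quarter to the Taylor
  remainder, a quarter to the incomplete block at the end, and the last one to the cross term in the
  product of the two rates.\<close>

theorem exp_moment_ratio:
  fixes D :: nat and \<eta> \<kappa> \<gamma> :: real
  assumes \<eta>: "\<eta> > 0" and D: "D \<ge> 1"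
    and spread: "\<And>g x. g \<in> space \<mu> \<Longrightarrow> x \<in> X \<Longrightarrow>
      ennreal \<eta> \<le> (\<Sum>i<D. emeasure (walk i) {h \<in> space \<mu>. t g - \<kappa> \<le> c g (act h x)})"
    and \<gamma>: "\<gamma> > 0"
  obtains \<epsilon>0 n0 where "\<epsilon>0 > 0" "n0 > 0" "\<And>\<epsilon> n x. 0 < \<epsilon> \<Longrightarrow> \<epsilon> < \<epsilon>0 \<Longrightarrow> n > n0 \<Longrightarrow> x \<in> X \<Longrightarrow>
    (\<integral>\<^sup>+g. ennreal (exp (\<epsilon> * (t g - c g x))) \<partial>walk n) \<le> ennreal ((1 + \<epsilon> * \<gamma>) ^ n)"
proof -
  define Q where "Q = real D / \<eta>"
  have Q: "Q \<ge> 0" using \<eta> by (simp add: Q_def)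
  \<comment> \<open>Chosen for (Q + 1) \<delta> = \<gamma> / 8: the deviation error enters once
    directly and \<open>Q\<close> times through \<open>integral_t_le\<close>.\<close>
  define \<delta> where "\<delta> = \<gamma> / (8 * (Q + 1))"
  have \<delta>: "\<delta> > 0" using \<gamma> Q by (simp add: \<delta>_def)
  obtain b a where b: "b \<ge> 1" and a: "a \<ge> 0"
    and dev: "\<And>k x. x \<in> X \<Longrightarrow>
      (\<integral>g. max 0 (real (k * b) * \<beta> - c g x) \<partial>walk (k * b)) \<le> real (k * b) * \<delta> + a"
    using lower_deviation[OF \<delta>] by blast
  \<comment> \<open>\<open>Z\<close> gathers what does not grow with \<open>m\<close>; enough blocks
    of length \<open>b\<close> make it at most m \<gamma> / 8.\<close>
  define Z where "Z = \<kappa> + Q + (Q + 1) * a"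
  define k where "k = nat \<lceil>8 * \<bar>Z\<bar> / \<gamma>\<rceil> + 1"
  define m where "m = k * b"
  have "real k \<ge> 8 * \<bar>Z\<bar> / \<gamma>" unfolding k_def by linarith
  moreover have "real k \<le> real m"
    unfolding m_def using b by (intro of_nat_mono) simp
  ultimately have "8 * \<bar>Z\<bar> / \<gamma> \<le> real m" by linarith
  then have "8 * \<bar>Z\<bar> \<le> real m * \<gamma>"
    using \<gamma> by (simp add: pos_divide_le_eq)
  then have "Z \<le> real m * \<gamma> / 8" by linarith
  then have m_ge: "\<kappa> + Q + (Q + 1) * a \<le> real m * \<gamma> / 8" by (simp add: Z_def)
  have m1: "m \<ge> 1" using b by (simp add: m_def k_def)
  define B where "B = real m * \<delta> + a"
  have B: "(\<integral>g. max 0 (real m * \<beta> - c g x) \<partial>walk m) \<le> B" if "x \<in> X" for x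
    using dev[OF that, of k] by (simp add: B_def m_def)
  have mean: "(\<integral>g. t g - c g x \<partial>walk m) \<le> real m * \<gamma> / 4" if x: "x \<in> X" for x
  proof -
    interpret WM: prob_space "walk m" by (rule prob_space_walk)
    have "real m * \<beta> - \<phi> m x = (\<integral>g. real m * \<beta> - c g x \<partial>walk m)"
      using integrable_c[OF x] by (simp add: \<phi>_def)
    also have "\<dots> \<le> (\<integral>g. max 0 (real m * \<beta> - c g x) \<partial>walk m)"
      using integrable_c[OF x]
      by (intro integral_mono integrable_max) auto
    also have "\<dots> \<le> B" by (rule B[OF x])
    finally have "real m * \<beta> - \<phi> m x \<le> B" .
    moreover have "(\<integral>g. t g \<partial>walk m) \<le> real m * \<beta> + \<kappa> + Q * (1 + B)"
      unfolding Q_def using integral_t_le[OF \<eta> D spread B] by blast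
    moreover have "(\<integral>g. t g - c g x \<partial>walk m) = (\<integral>g. t g \<partial>walk m) - \<phi> m x"
      using integrable_t integrable_c[OF x] by (simp add: \<phi>_def)
    ultimately have "(\<integral>g. t g - c g x \<partial>walk m) \<le> (\<kappa> + Q + (Q + 1) * a) + (Q + 1) * \<delta> * real m"
      by (simp add: B_def algebra_simps)
    also have "(Q + 1) * \<delta> = \<gamma> / 8" using Q by (simp add: \<delta>_def divide_simps)
    finally show ?thesis using m_ge by (simp add: algebra_simps)
  qed
  have u_meas: "(\<lambda>g. t g - c g x) \<in> borel_measurable \<mu>" if "x \<in> X" for x
    using c_measurable[OF that] by simp
  have u_le: "\<bar>t g - c g x\<bar> \<le> 2 * l g" if "x \<in> X" "g \<in> space \<mu>" for x g
    using abs_t_le[OF that(2)] abs_c_le[OF that(2,1)] by linarith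
  obtain \<epsilon>1 C where eC: "\<epsilon>1 > 0" "C \<ge> 0"
    "\<And>\<epsilon> u. 0 < \<epsilon> \<Longrightarrow> \<epsilon> \<le> \<epsilon>1 \<Longrightarrow> u \<in> borel_measurable \<mu> \<Longrightarrow>
      (\<And>g. g \<in> space \<mu> \<Longrightarrow> \<bar>u g\<bar> \<le> 2 * l g) \<Longrightarrow>
      (\<integral>\<^sup>+g. ennreal (exp (\<epsilon> * u g)) \<partial>walk m) \<le> ennreal (1 + \<epsilon> * (\<integral>g. u g \<partial>walk m) + \<epsilon>\<^sup>2 * C)"
    using exp_moment_taylor[of m] by blast
  obtain \<epsilon>2 C2 where eC2: "\<epsilon>2 > 0" "C2 \<ge> 0"
    "\<And>\<epsilon> u. 0 < \<epsilon> \<Longrightarrow> \<epsilon> \<le> \<epsilon>2 \<Longrightarrow> u \<in> borel_measurable \<mu> \<Longrightarrow>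
      (\<And>g. g \<in> space \<mu> \<Longrightarrow> \<bar>u g\<bar> \<le> 2 * l g) \<Longrightarrow>
      (\<integral>\<^sup>+g. ennreal (exp (\<epsilon> * u g)) \<partial>walk 1) \<le> ennreal (1 + \<epsilon> * (\<integral>g. u g \<partial>walk 1) + \<epsilon>\<^sup>2 * C2)"
    using exp_moment_taylor[of 1] by blast
  \<comment> \<open>A crude rate for single steps, applied to the fewer than \<open>m\<close> steps
    left over after division by \<open>m\<close>.\<close>
  define L where "L = (\<integral>g. 2 * l g \<partial>walk 1) + C2"
  have L: "L \<ge> 0"
    unfolding L_def using l_nonneg eC2(2) by (intro add_nonneg_nonneg integral_nonneg_AE AE_I2) simp_all
  \<comment> \<open>By Bernoulli 1 + \<epsilon> L \<le> (1 + \<epsilon> \<gamma> / 4) ^ K for every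
    \<epsilon> > 0, so the leftover steps cost at most (1 + \<epsilon> \<gamma> / 4) ^ n as soon as
    n \<ge> K m, a threshold independent of \<epsilon>.\<close>
  define K where "K = nat \<lceil>4 * L / \<gamma>\<rceil>"
  \<comment> \<open>The bound 2 / \<gamma> keeps (1 + \<epsilon> \<gamma> / 4) (1 + \<epsilon>
    \<gamma> / 2) below 1 + \<epsilon> \<gamma>; the last term keeps \<epsilon>^2 C below \<epsilon>
    m \<gamma> / 4.\<close>
  define \<epsilon>0 where "\<epsilon>0 = min (min \<epsilon>1 \<epsilon>2) (min (min 1 (2 / \<gamma>)) (real m * \<gamma> / 4 / (C + 1)))"
  define n0 where "n0 = K * m + 1"
  show ?thesis
  proof (rule that)
    show "\<epsilon>0 > 0" using eC(1,2) eC2(1) \<gamma> m1 by (simp add: \<epsilon>0_def)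
    show "n0 > 0" by (simp add: n0_def)
    fix \<epsilon> n x assume eps: "0 < \<epsilon>" "\<epsilon> < \<epsilon>0" and n: "n > n0" and x: "x \<in> X"
    have e: "\<epsilon> \<le> \<epsilon>1" "\<epsilon> \<le> \<epsilon>2" "\<epsilon> \<le> 1" "\<epsilon> \<le> 2 / \<gamma>" "\<epsilon> \<le> real m * \<gamma> / 4 / (C + 1)"
      using eps(2) by (auto simp: \<epsilon>0_def)
    have e\<gamma>: "\<epsilon> * \<gamma> \<le> 2" using e(4) \<gamma> by (simp add: field_simps)
    have eCm: "\<epsilon> * C \<le> real m * \<gamma> / 4"
    proof -
      have "\<epsilon> * (C + 1) \<le> real m * \<gamma> / 4"
        using e(5) eC(2) by (subst pos_le_divide_eq[symmetric]) simp_all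
      then show ?thesis using eps(1) by (simp add: algebra_simps)
    qed
    have sub: "\<epsilon> * (t (g \<odot> h) - c (g \<odot> h) y) \<le> \<epsilon> * (t g - c g (act h y)) + \<epsilon> * (t h - c h y)"
      if "g \<in> space \<mu>" "h \<in> space \<mu>" "y \<in> X" for g h y
    proof -
      have "t (g \<odot> h) - c (g \<odot> h) y \<le> (t g - c g (act h y)) + (t h - c h y)"
        using t_mult[OF that(1,2)] c_mult[OF that] by simp
      then have "\<epsilon> * (t (g \<odot> h) - c (g \<odot> h) y) \<le> \<epsilon> * ((t g - c g (act h y)) + (t h - c h y))"
        using eps(1) by (intro mult_left_mono) auto
      then show ?thesis by (simp add: distrib_left)
    qed
    have one: "\<epsilon> * (t one - c one y) \<le> 0" if "y \<in> X" for y
      using t_one c_one[OF that] eps(1) by (simp add: mult_le_0_iff)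
    have meas: "(\<lambda>g. \<epsilon> * (t g - c g y)) \<in> borel_measurable \<mu>" if "y \<in> X" for y
      using u_meas[OF that] by simp
    have block: "(\<integral>\<^sup>+g. ennreal (exp (\<epsilon> * (t g - c g y))) \<partial>walk m) \<le> ennreal ((1 + \<epsilon> * (\<gamma> / 2)) ^ m)"
      if y: "y \<in> X" for y
    proof -
      have "(\<integral>\<^sup>+g. ennreal (exp (\<epsilon> * (t g - c g y))) \<partial>walk m) \<le>
          ennreal (1 + \<epsilon> * (\<integral>g. t g - c g y \<partial>walk m) + \<epsilon>\<^sup>2 * C)"
        by (rule eC(3)[OF eps(1) e(1) u_meas[OF y] u_le[OF y]])
      also have "\<dots> \<le> ennreal ((1 + \<epsilon> * (\<gamma> / 2)) ^ m)"
      proof (rule ennreal_leI)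
        have "\<epsilon> * (\<integral>g. t g - c g y \<partial>walk m) \<le> \<epsilon> * (real m * \<gamma> / 4)"
          using mean[OF y] eps(1) by (intro mult_left_mono) auto
        moreover have "\<epsilon>\<^sup>2 * C \<le> \<epsilon> * (real m * \<gamma> / 4)"
          using eCm eps(1) by (simp add: power2_eq_square mult.assoc)
        ultimately have "1 + \<epsilon> * (\<integral>g. t g - c g y \<partial>walk m) + \<epsilon>\<^sup>2 * C \<le> 1 + real m * (\<epsilon> * (\<gamma> / 2))"
          by (simp add: algebra_simps)
        also have "\<dots> \<le> (1 + \<epsilon> * (\<gamma> / 2)) ^ m"
          using mult_pos_pos[OF eps(1) \<gamma>] by (intro Bernoulli_inequality) simp
        finally show "1 + \<epsilon> * (\<integral>g. t g - c g y \<partial>walk m) + \<epsilon>\<^sup>2 * C \<le> (1 + \<epsilon> * (\<gamma> / 2)) ^ m" .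
      qed
      finally show ?thesis .
    qed
    have single: "(\<integral>\<^sup>+g. ennreal (exp (\<epsilon> * (t g - c g y))) \<partial>walk 1) \<le> ennreal (1 + \<epsilon> * L)"
      if y: "y \<in> X" for y
    proof -
      have "(\<integral>\<^sup>+g. ennreal (exp (\<epsilon> * (t g - c g y))) \<partial>walk 1) \<le>
          ennreal (1 + \<epsilon> * (\<integral>g. t g - c g y \<partial>walk 1) + \<epsilon>\<^sup>2 * C2)"
        by (rule eC2(3)[OF eps(1) e(2) u_meas[OF y] u_le[OF y]])
      also have "\<dots> \<le> ennreal (1 + \<epsilon> * L)"
      proof (rule ennreal_leI)
        have "(\<integral>g. t g - c g y \<partial>walk 1) \<le> (\<integral>g. 2 * l g \<partial>walk 1)"
        proof (rule integral_mono)
          show "integrable (walk 1) (\<lambda>g. t g - c g y)"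
            using integrable_t integrable_c[OF y] by (rule Bochner_Integration.integrable_diff)
          show "integrable (walk 1) (\<lambda>g. 2 * l g)"
            using integrable_l[of 1] by simp
          show "t g - c g y \<le> 2 * l g" if "g \<in> space (walk 1)" for g
            using u_le[OF y, of g] that unfolding space_walk by simp
        qed
        then have "\<epsilon> * (\<integral>g. t g - c g y \<partial>walk 1) \<le> \<epsilon> * (\<integral>g. 2 * l g \<partial>walk 1)"
          using eps(1) by (intro mult_left_mono) auto
        moreover have "\<epsilon>\<^sup>2 * C2 \<le> \<epsilon> * C2"
          using e(3) eps(1) eC2(2) by (intro mult_right_mono) (auto simp: power2_eq_square)
        ultimately show "1 + \<epsilon> * (\<integral>g. t g - c g y \<partial>walk 1) + \<epsilon>\<^sup>2 * C2 \<le> 1 + \<epsilon> * L"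
          by (simp add: L_def distrib_left del: walk.simps)
      qed
      finally show ?thesis .
    qed
    define q r where "q = n div m" and "r = n mod m"
    have nqr: "n = r * 1 + q * m" by (simp add: q_def r_def)
    have rm: "r \<le> m" using m1 by (simp add: r_def)
    have "(\<integral>\<^sup>+g. ennreal (exp (\<epsilon> * (t g - c g x))) \<partial>walk (r * 1 + q * m)) \<le>
        ennreal (1 + \<epsilon> * L) ^ r * ennreal ((1 + \<epsilon> * (\<gamma> / 2)) ^ m) ^ q"
    proof (rule exp_moment_add[where u = "\<lambda>g y. \<epsilon> * (t g - c g y)", OF meas sub _ _ x])
      show "(\<integral>\<^sup>+g. ennreal (exp (\<epsilon> * (t g - c g y))) \<partial>walk (r * 1)) \<le> ennreal (1 + \<epsilon> * L) ^ r"
        if "y \<in> X" for y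
        by (rule exp_moment_mult[where u = "\<lambda>g y. \<epsilon> * (t g - c g y)", OF meas sub one single that])
      show "(\<integral>\<^sup>+g. ennreal (exp (\<epsilon> * (t g - c g y))) \<partial>walk (q * m)) \<le>
          ennreal ((1 + \<epsilon> * (\<gamma> / 2)) ^ m) ^ q" if "y \<in> X" for y
        by (rule exp_moment_mult[where u = "\<lambda>g y. \<epsilon> * (t g - c g y)", OF meas sub one block that])
    qed
    also have "\<dots> = ennreal ((1 + \<epsilon> * L) ^ r * ((1 + \<epsilon> * (\<gamma> / 2)) ^ m) ^ q)"
      using eps(1) L \<gamma> by (simp add: ennreal_power ennreal_mult del: ennreal_plus)
    also have "\<dots> \<le> ennreal ((1 + \<epsilon> * \<gamma>) ^ n)"
    proof (rule ennreal_leI)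
      have p0: "0 \<le> \<epsilon> * (\<gamma> / 4)" "0 \<le> \<epsilon> * (\<gamma> / 2)" "0 \<le> \<epsilon> * L" using eps(1) \<gamma> L by simp_all
      have "4 * L / \<gamma> \<le> real K" unfolding K_def by linarith
      then have "L \<le> real K * (\<gamma> / 4)" using \<gamma> by (simp add: field_simps)
      then have "\<epsilon> * L \<le> \<epsilon> * (real K * (\<gamma> / 4))" using eps(1) by (intro mult_left_mono) auto
      then have "1 + \<epsilon> * L \<le> 1 + real K * (\<epsilon> * (\<gamma> / 4))" by (simp add: algebra_simps)
      also have "\<dots> \<le> (1 + \<epsilon> * (\<gamma> / 4)) ^ K"
        using p0 by (intro Bernoulli_inequality) linarith
      finally have K: "1 + \<epsilon> * L \<le> (1 + \<epsilon> * (\<gamma> / 4)) ^ K" .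
      have "(1 + \<epsilon> * L) ^ r \<le> (1 + \<epsilon> * L) ^ m"
        using p0(3) rm by (intro power_increasing) auto
      also have "\<dots> \<le> ((1 + \<epsilon> * (\<gamma> / 4)) ^ K) ^ m"
        using p0(3) K by (intro power_mono) auto
      also have "\<dots> = (1 + \<epsilon> * (\<gamma> / 4)) ^ (K * m)" by (simp add: power_mult)
      also have "\<dots> \<le> (1 + \<epsilon> * (\<gamma> / 4)) ^ n"
        using p0(1) n by (intro power_increasing) (auto simp: n0_def)
      finally have 1: "(1 + \<epsilon> * L) ^ r \<le> (1 + \<epsilon> * (\<gamma> / 4)) ^ n" .
      have "((1 + \<epsilon> * (\<gamma> / 2)) ^ m) ^ q = (1 + \<epsilon> * (\<gamma> / 2)) ^ (m * q)" by (simp add: power_mult)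
      also have "\<dots> \<le> (1 + \<epsilon> * (\<gamma> / 2)) ^ n"
        using p0(2) nqr by (intro power_increasing) auto
      finally have 2: "((1 + \<epsilon> * (\<gamma> / 2)) ^ m) ^ q \<le> (1 + \<epsilon> * (\<gamma> / 2)) ^ n" .
      have "(1 + \<epsilon> * L) ^ r * ((1 + \<epsilon> * (\<gamma> / 2)) ^ m) ^ q \<le>
          (1 + \<epsilon> * (\<gamma> / 4)) ^ n * (1 + \<epsilon> * (\<gamma> / 2)) ^ n"
        using 1 2 p0 by (intro mult_mono) auto
      also have "\<dots> = ((1 + \<epsilon> * (\<gamma> / 4)) * (1 + \<epsilon> * (\<gamma> / 2))) ^ n"
        by (simp add: power_mult_distrib)
      also have "\<dots> \<le> (1 + \<epsilon> * \<gamma>) ^ n"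
      proof (rule power_mono)
        have "(\<epsilon> * \<gamma>) * (\<epsilon> * \<gamma>) \<le> 2 * (\<epsilon> * \<gamma>)"
          using e\<gamma> eps(1) \<gamma> by (intro mult_right_mono) auto
        then show "(1 + \<epsilon> * (\<gamma> / 4)) * (1 + \<epsilon> * (\<gamma> / 2)) \<le> 1 + \<epsilon> * \<gamma>"
          by (simp add: algebra_simps)
        show "0 \<le> (1 + \<epsilon> * (\<gamma> / 4)) * (1 + \<epsilon> * (\<gamma> / 2))" using p0 by simp
      qed
      finally show "(1 + \<epsilon> * L) ^ r * ((1 + \<epsilon> * (\<gamma> / 2)) ^ m) ^ q \<le> (1 + \<epsilon> * \<gamma>) ^ n" .
    qed
    finally show "(\<integral>\<^sup>+g. ennreal (exp (\<epsilon> * (t g - c g x))) \<partial>walk n) \<le> ennreal ((1 + \<epsilon> * \<gamma>) ^ n)"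
      using nqr by (simp only:)
  qed
qed

end

section \<open>Measurability without second countability\<close>

text \<open>Separability is carried by an explicit set: it follows from the hypothesis
  \<open>compact_balls\<close> and not from the type class of the field.\<close>

definition countable_dense :: "'a::metric_space set \<Rightarrow> bool" where
  "countable_dense D \<longleftrightarrow> countable D \<and> (\<forall>x. \<forall>e>0. \<exists>d\<in>D. dist x d < e)"

text \<open>Union of finite nets of mesh 1 / (m + 1) in the balls of radius
  \<open>n\<close>.\<close>

lemma countable_dense_compact_balls:
  assumes "compact_balls (UNIV :: 'k::valued_field set)"
  obtains D :: "'k::valued_field set" where "countable_dense D"
proof -
  have "\<exists>F. finite F \<and> {x :: 'k. absv x \<le> real n} \<subseteq> (\<Union>x\<in>F. ball x (1 / real (Suc m)))" for n m
    using assms[unfolded compact_balls_def, rule_format, of "real n", unfolded compact_eq_totally_bounded]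
    by simp
  then obtain F where F: "\<And>n m. finite (F n m)"
    "\<And>n m. {x :: 'k. absv x \<le> real n} \<subseteq> (\<Union>x\<in>F n m. ball x (1 / real (Suc m)))"
    by metis
  have "\<exists>d\<in>(\<Union>n. \<Union>m. F n m). dist x d < e" if e: "e > 0" for x e
  proof -
    obtain m where m: "1 / real (Suc m) < e" using nat_approx_posE[OF e] by blast
    obtain n where "absv x \<le> real n" using real_arch_simple by blast
    then have "x \<in> (\<Union>d\<in>F n m. ball d (1 / real (Suc m)))" using F(2) by blast
    then obtain d where "d \<in> F n m" "dist d x < 1 / real (Suc m)" by auto
    then have "d \<in> (\<Union>n. \<Union>m. F n m)" "dist x d < e" using m by (auto simp: dist_commute)
    then show ?thesis by blast
  qed
  moreover have "countable (\<Union>n. \<Union>m. F n m)" using F(1) by (intro countable_UN) (auto intro: countable_finite)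
  ultimately show ?thesis using that unfolding countable_dense_def by blast
qed

lemma countable_dense_vec:
  fixes D :: "'a::metric_space set"
  assumes "countable_dense D"
  shows "countable_dense {v :: 'a ^ 'n. \<forall>i. v $ i \<in> D}"
  unfolding countable_dense_def
proof (intro conjI allI impI)
  have "{v :: 'a ^ 'n. \<forall>i. v $ i \<in> D} \<subseteq> vec_lambda ` (PiE UNIV (\<lambda>_. D))"
  proof
    fix v :: "'a ^ 'n" assume "v \<in> {v. \<forall>i. v $ i \<in> D}"
    then show "v \<in> vec_lambda ` (PiE UNIV (\<lambda>_. D))"
      by (intro image_eqI[of _ _ "\<lambda>i. v $ i"]) (auto simp: vec_lambda_eta)
  qed
  moreover have "countable (PiE (UNIV :: 'n set) (\<lambda>_. D))"
    using assms by (intro countable_PiE) (auto simp: countable_dense_def)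
  ultimately show "countable {v :: 'a ^ 'n. \<forall>i. v $ i \<in> D}"
    by (rule countable_subset[OF _ countable_image])
next
  fix x :: "'a ^ 'n" and e :: real assume "0 < e"
  then have e: "e / real CARD('n) > 0" by simp
  then have "\<forall>i. \<exists>d. d \<in> D \<and> dist (x $ i) d < e / real CARD('n)"
    using assms unfolding countable_dense_def by blast
  then obtain d where d: "\<And>i. d i \<in> D" "\<And>i. dist (x $ i) (d i) < e / real CARD('n)"
    unfolding choice_iff by blast
  have "dist x (vec_lambda d) \<le> (\<Sum>i\<in>UNIV. \<bar>dist (x $ i) (d i)\<bar>)"
    using L2_set_le_sum_abs[of "\<lambda>i. dist (x $ i) (d i)" UNIV] by (simp add: dist_vec_def)
  also have "\<dots> < (\<Sum>i\<in>(UNIV :: 'n set). e / real CARD('n))"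
    using d(2) by (intro sum_strict_mono) auto
  finally show "\<exists>d\<in>{v. \<forall>i. v $ i \<in> D}. dist x d < e"
    using d(1) by (intro bexI[of _ "vec_lambda d"]) auto
qed

text \<open>The Borel sets of a product of metric spaces may exceed the product sigma-algebra. With
  countable dense sets every open subset of the product is a countable union of products of balls,
  so measurability of the two components is enough.\<close>

lemma measurable_continuous_Pair:
  fixes f :: "'a::metric_space \<times> 'b::metric_space \<Rightarrow> 'c::topological_space"
    and D :: "'a set" and D' :: "'b set"
  assumes D: "countable_dense D" "countable_dense D'" and f: "continuous_on UNIV f"
    and u: "u \<in> borel_measurable M" and v: "v \<in> borel_measurable M"
  shows "(\<lambda>x. f (u x, v x)) \<in> borel_measurable M"
proof (rule borel_measurableI)
  fix U :: "'c set" assume "open U"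
  then have V: "open (f -` U)" using f by (rule open_vimage)
  let ?r = "\<lambda>n. 1 / real (Suc n)"
  define I where "I = {(d, d', n). d \<in> D \<and> d' \<in> D' \<and> ball d (?r n) \<times> ball d' (?r n) \<subseteq> f -` U}"
  have "I \<subseteq> D \<times> D' \<times> UNIV" by (auto simp: I_def)
  then have cI: "countable I"
    using D unfolding countable_dense_def by (meson countable_SIGMA countable_subset uncountable_def countableI_type)
  have "(\<lambda>x. f (u x, v x)) -` U \<inter> space M =
      (\<Union>(d, d', n)\<in>I. (u -` ball d (?r n) \<inter> space M) \<inter> (v -` ball d' (?r n) \<inter> space M))"
  proof (intro set_eqI iffI)
    fix x assume x: "x \<in> (\<lambda>x. f (u x, v x)) -` U \<inter> space M"
    then have "(u x, v x) \<in> f -` U" by simp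
    then obtain A B where AB: "open A" "open B" "u x \<in> A" "v x \<in> B" "A \<times> B \<subseteq> f -` U"
      using open_prod_elim[OF V] by (metis SigmaE2)
    obtain e1 where e1: "e1 > 0" "ball (u x) e1 \<subseteq> A" using AB open_contains_ball by blast
    obtain e2 where e2: "e2 > 0" "ball (v x) e2 \<subseteq> B" using AB open_contains_ball by blast
    have "min e1 e2 / 2 > 0" using e1 e2 by simp
    then obtain n where n: "?r n < min e1 e2 / 2" using nat_approx_posE by blast
    have r: "?r n > 0" by simp
    obtain d d' where d: "d \<in> D" "dist (u x) d < ?r n" "d' \<in> D'" "dist (v x) d' < ?r n"
      using D r unfolding countable_dense_def by meson
    have "ball d (?r n) \<subseteq> ball (u x) e1"
    proof
      fix z assume "z \<in> ball d (?r n)"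
      then show "z \<in> ball (u x) e1" using d(2) n dist_triangle[of "u x" z d] by simp
    qed
    moreover have "ball d' (?r n) \<subseteq> ball (v x) e2"
    proof
      fix z assume "z \<in> ball d' (?r n)"
      then show "z \<in> ball (v x) e2" using d(4) n dist_triangle[of "v x" z d'] by simp
    qed
    ultimately have "ball d (?r n) \<times> ball d' (?r n) \<subseteq> f -` U"
      using e1(2) e2(2) AB(5) by blast
    then have "(d, d', n) \<in> I" using d by (simp add: I_def)
    moreover have "x \<in> (u -` ball d (?r n) \<inter> space M) \<inter> (v -` ball d' (?r n) \<inter> space M)"
      using d x by (simp add: dist_commute)
    ultimately show "x \<in> (\<Union>(d, d', n)\<in>I. (u -` ball d (?r n) \<inter> space M) \<inter> (v -` ball d' (?r n) \<inter> space M))"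
      by blast
  next
    fix x assume "x \<in> (\<Union>(d, d', n)\<in>I. (u -` ball d (?r n) \<inter> space M) \<inter> (v -` ball d' (?r n) \<inter> space M))"
    then obtain d d' n where I: "(d, d', n) \<in> I"
      and uv: "u x \<in> ball d (?r n)" "v x \<in> ball d' (?r n)" "x \<in> space M"
      by auto
    have "ball d (?r n) \<times> ball d' (?r n) \<subseteq> f -` U" using I by (simp add: I_def)
    with uv have "(u x, v x) \<in> f -` U" by blast
    with uv show "x \<in> (\<lambda>x. f (u x, v x)) -` U \<inter> space M" by simp
  qed
  also have "\<dots> \<in> sets M"
    using cI u v by (intro sets.countable_UN') (auto intro!: sets.Int measurable_sets)
  finally show "(\<lambda>x. f (u x, v x)) -` U \<inter> space M \<in> sets M" .
qed

section \<open>The canonical norm and the operator norm\<close>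

lemma absv_le_vnorm: "absv (x $ i) \<le> vnorm (x :: 'k::valued_field ^ 'd)"
  unfolding vnorm_def by (auto intro!: member_le_L2_set Max_ge)

text \<open>The factor \<open>CARD('d)\<close> is crude but covers the Euclidean and the maximum
  norm at once; such constants end up in \<open>\<kappa>\<close> and
  \<open>log_size\<close>.\<close>

lemma vnorm_le:
  fixes x :: "'k::valued_field ^ 'd"
  assumes "\<And>i. absv (x $ i) \<le> m"
  shows "vnorm x \<le> real CARD('d) * m"
proof -
  have m: "0 \<le> m" using assms absv_nonneg order_trans by blast
  have "L2_set (\<lambda>i. absv (x $ i)) UNIV \<le> (\<Sum>i\<in>UNIV. absv (x $ i))"
    by (rule L2_set_le_sum) simp
  also have "\<dots> \<le> (\<Sum>i\<in>(UNIV :: 'd set). m)" by (intro sum_mono assms)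
  finally have 1: "L2_set (\<lambda>i. absv (x $ i)) UNIV \<le> real CARD('d) * m" by simp
  have "Max (range (\<lambda>i. absv (x $ i))) \<le> 1 * m" using assms by simp
  also have "\<dots> \<le> real CARD('d) * m" using m by (intro mult_right_mono) (auto simp: Suc_le_eq)
  finally show ?thesis using 1 by (simp add: vnorm_def)
qed

lemma vnorm_nonneg: "0 \<le> vnorm (x :: 'k::valued_field ^ 'd)"
  by (rule order_trans[OF absv_nonneg absv_le_vnorm])

lemma vnorm_eq_0: "vnorm (x :: 'k::valued_field ^ 'd) = 0 \<longleftrightarrow> x = 0"
proof
  assume "vnorm x = 0"
  then have "absv (x $ i) \<le> 0" for i using absv_le_vnorm[of x i] by simp
  then have "x $ i = 0" for i using absv_nonneg[of "x $ i"] absv_eq_0 by (metis order_antisym)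
  then show "x = 0" by (simp add: vec_eq_iff)
next
  assume "x = 0"
  then show "vnorm x = 0" using vnorm_le[of x 0] vnorm_nonneg[of x] by simp
qed

lemma vnorm_pos: "0 < vnorm (x :: 'k::valued_field ^ 'd) \<longleftrightarrow> x \<noteq> 0"
  using vnorm_nonneg[of x] vnorm_eq_0[of x] by linarith

lemma vnorm_scale: "vnorm (c *s x) = absv c * vnorm (x :: 'k::valued_field ^ 'd)"
proof -
  have "Max ((\<lambda>i. absv c * absv (x $ i)) ` UNIV) = absv c * Max (range (\<lambda>i. absv (x $ i)))"
    using mono_Max_commute[of "\<lambda>y. absv c * y" "range (\<lambda>i. absv (x $ i))"]
    by (simp add: mono_def mult_left_mono image_image)
  then show ?thesis
    by (simp add: vnorm_def absv_mult L2_set_right_distrib)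
qed

lemma continuous_on_Max_image:
  fixes f :: "'i \<Rightarrow> 'a::topological_space \<Rightarrow> real"
  assumes "finite I" "I \<noteq> {}" "\<And>i. i \<in> I \<Longrightarrow> continuous_on S (f i)"
  shows "continuous_on S (\<lambda>x. Max ((\<lambda>i. f i x) ` I))"
  using assms
proof (induction I rule: finite_ne_induct)
  case (insert i I)
  have "(\<lambda>x. Max ((\<lambda>i. f i x) ` insert i I)) = (\<lambda>x. max (f i x) (Max ((\<lambda>i. f i x) ` I)))"
    using insert by (auto intro!: Max_insert)
  then show ?case using insert by (auto intro!: continuous_on_max)
qed simp

lemma continuous_on_vnorm [continuous_intros]:
  fixes f :: "'a::topological_space \<Rightarrow> 'k::valued_field ^ 'd"
  assumes "continuous_on S f"
  shows "continuous_on S (\<lambda>x. vnorm (f x))"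
proof -
  have c: "continuous_on S (\<lambda>x. absv (f x $ i))" for i
    by (intro continuous_intros assms)
  show ?thesis
  proof (cases "archimedean TYPE('k)")
    case True
    then show ?thesis
      unfolding vnorm_def L2_set_def if_P[OF True]
      by (intro continuous_on_real_sqrt continuous_on_sum continuous_on_power c)
  next
    case False
    then show ?thesis
      unfolding vnorm_def if_not_P[OF False] by (intro continuous_on_Max_image c) auto
  qed
qed

lemma vnorm_axis: "vnorm (axis i 1 :: 'k::valued_field ^ 'd) = 1"
proof -
  have "L2_set (\<lambda>j. absv ((axis i 1 :: 'k ^ 'd) $ j)) UNIV = sqrt (\<Sum>j\<in>UNIV. if j = i then 1 else 0)"
    unfolding L2_set_def by (intro arg_cong[where f = sqrt] sum.cong) (auto simp: axis_def)
  moreover have "Max (range (\<lambda>j. absv ((axis i 1 :: 'k ^ 'd) $ j))) = 1"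
    by (intro Max_eqI) (auto simp: axis_def intro: image_eqI[of _ _ i])
  ultimately show ?thesis by (simp add: vnorm_def)
qed

text \<open>With \<open>absv_entry_le_opnorm\<close> this makes the operator norm comparable to the
  largest entry, for either canonical norm.\<close>

lemma absv_matrix_vector_le:
  fixes g :: "'k::valued_field ^ 'd ^ 'd"
  assumes "\<And>i j. absv (g $ i $ j) \<le> m"
  shows "vnorm (g *v x) \<le> (real CARD('d))\<^sup>2 * m * vnorm x"
proof -
  have "absv ((g *v x) $ i) \<le> real CARD('d) * m * vnorm x" for i
  proof -
    have "absv ((g *v x) $ i) \<le> (\<Sum>j\<in>UNIV. absv (g $ i $ j * x $ j))"
      by (simp add: matrix_vector_mult_def absv_sum_le)
    also have "\<dots> \<le> (\<Sum>j\<in>(UNIV :: 'd set). m * vnorm x)"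
      unfolding absv_mult using assms order_trans[OF absv_nonneg assms]
      by (intro sum_mono mult_mono absv_le_vnorm) auto
    finally show ?thesis by (simp add: mult.assoc)
  qed
  from vnorm_le[OF this] show ?thesis by (simp add: power2_eq_square mult.assoc)
qed

lemma exists_max_entry:
  fixes g :: "'k::valued_field ^ 'd ^ 'd"
  obtains i j where "\<And>i' j'. absv (g $ i' $ j') \<le> absv (g $ i $ j)"
proof -
  let ?R = "range (\<lambda>(i, j). absv (g $ i $ j))"
  have "Max ?R \<in> ?R" by (intro Max_in) auto
  then obtain p where "Max ?R = (case p of (i, j) \<Rightarrow> absv (g $ i $ j))" by (rule imageE)
  then obtain i j where "Max ?R = absv (g $ i $ j)" by (cases p) auto
  moreover have "absv (g $ i' $ j') \<le> Max ?R" for i' j' by (intro Max_ge) (auto intro: image_eqI[of _ _ "(i', j')"])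
  ultimately show ?thesis by (intro that[of i j]) simp
qed

lemma bdd_above_opnorm: "bdd_above (range (\<lambda>x. vnorm ((g :: 'k::valued_field ^ 'd ^ 'd) *v x) / vnorm x))"
proof -
  obtain i j where m: "\<And>i' j'. absv (g $ i' $ j') \<le> absv (g $ i $ j)" using exists_max_entry[of g] by blast
  show ?thesis
  proof (rule bdd_aboveI2)
    fix x :: "'k ^ 'd"
    \<comment> \<open>For x = 0 the quotient is 0 / 0 = 0, so the supremum in \<open>opnorm\<close>
      may run over all vectors.\<close>
    show "vnorm (g *v x) / vnorm x \<le> (real CARD('d))\<^sup>2 * absv (g $ i $ j)"
      using absv_matrix_vector_le[OF m, of x] vnorm_nonneg[of x]
      by (cases "vnorm x = 0") (auto simp: divide_le_eq)
  qed
qed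

lemma vnorm_div_le_opnorm: "vnorm (g *v x) / vnorm x \<le> opnorm (g :: 'k::valued_field ^ 'd ^ 'd)"
  unfolding opnorm_def by (intro cSUP_upper bdd_above_opnorm) simp

lemma opnorm_least: "(\<And>x. vnorm (g *v x) / vnorm x \<le> B) \<Longrightarrow> opnorm (g :: 'k::valued_field ^ 'd ^ 'd) \<le> B"
  unfolding opnorm_def by (intro cSUP_least) auto

lemma vnorm_mult_le: "vnorm (g *v x) \<le> opnorm (g :: 'k::valued_field ^ 'd ^ 'd) * vnorm x"
proof (cases "x = 0")
  case False
  then show ?thesis using vnorm_div_le_opnorm[of g x] vnorm_pos[of x] by (simp add: pos_divide_le_eq)
qed (simp add: vnorm_eq_0[THEN iffD2])

lemma opnorm_nonneg: "0 \<le> opnorm (g :: 'k::valued_field ^ 'd ^ 'd)"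
  by (rule order_trans[OF _ vnorm_div_le_opnorm[of g 0]]) (simp add: vnorm_nonneg)

lemma opnorm_mult: "opnorm (g ** h) \<le> opnorm g * opnorm (h :: 'k::valued_field ^ 'd ^ 'd)"
proof (rule opnorm_least)
  fix x :: "'k ^ 'd"
  have "vnorm ((g ** h) *v x) \<le> opnorm g * vnorm (h *v x)"
    using vnorm_mult_le[of g "h *v x"] by (simp add: matrix_vector_mul_assoc)
  also have "\<dots> \<le> opnorm g * (opnorm h * vnorm x)"
    by (intro mult_left_mono vnorm_mult_le opnorm_nonneg)
  finally show "vnorm ((g ** h) *v x) / vnorm x \<le> opnorm g * opnorm h"
    using vnorm_nonneg[of x] opnorm_nonneg[of g] opnorm_nonneg[of h]
    by (cases "vnorm x = 0") (auto simp: divide_le_eq mult.assoc)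
qed

lemma opnorm_one_le: "opnorm (mat 1 :: 'k::valued_field ^ 'd ^ 'd) \<le> 1"
  by (rule opnorm_least) simp

lemma absv_entry_le_opnorm: "absv (g $ i $ j) \<le> opnorm (g :: 'k::valued_field ^ 'd ^ 'd)"
proof -
  have "(g *v axis j 1) $ i = g $ i $ j"
    by (simp add: matrix_vector_mult_def axis_def if_distrib cong: if_cong)
  then show ?thesis
    using absv_le_vnorm[of "g *v axis j 1" i] vnorm_mult_le[of g "axis j 1"] by (simp add: vnorm_axis)
qed

lemma absv_det_le:
  fixes B :: "'k::valued_field ^ 'd ^ 'd"
  assumes "\<And>i j. absv (B $ i $ j) \<le> m"
  shows "absv (det B) \<le> fact CARD('d) * m ^ CARD('d)"
proof -
  have "absv (det B) \<le> (\<Sum>p | p permutes (UNIV :: 'd set). absv (of_int (sign p) * (\<Prod>i\<in>UNIV. B $ i $ p i)))"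
    unfolding det_def by (rule absv_sum_le)
  also have "\<dots> \<le> (\<Sum>p | p permutes (UNIV :: 'd set). m ^ CARD('d))"
  proof (rule sum_mono)
    fix p
    have "(\<Prod>i\<in>UNIV. absv (B $ i $ p i)) \<le> (\<Prod>i\<in>(UNIV :: 'd set). m)"
      using assms by (intro prod_mono) auto
    then show "absv (of_int (sign p) * (\<Prod>i\<in>UNIV. B $ i $ p i)) \<le> m ^ CARD('d)"
      by (simp add: absv_mult absv_sign absv_prod)
  qed
  also have "\<dots> = fact CARD('d) * m ^ CARD('d)"
    by (simp add: card_permutations[OF refl finite])
  finally show ?thesis .
qed

lemma SL_mult_nonzero:
  assumes "g \<in> SL" "x \<noteq> 0" shows "g *v x \<noteq> (0 :: 'k::valued_field ^ 'd)"
proof -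
  have "invertible g" using assms(1) by (simp add: SL_def invertible_det_nz)
  then show ?thesis using assms(2) by (metis invertible_def matrix_vector_mul_assoc matrix_vector_mul_lid matrix_vector_mult_0_right)
qed

lemma exists_max_coordinate:
  fixes x :: "'k::valued_field ^ 'd"
  obtains i where "\<And>j. absv (x $ j) \<le> absv (x $ i)"
proof -
  have "Max (range (\<lambda>i. absv (x $ i))) \<in> range (\<lambda>i. absv (x $ i))" by (intro Max_in) auto
  then obtain i where "Max (range (\<lambda>i. absv (x $ i))) = absv (x $ i)" by (rule imageE)
  moreover have "absv (x $ j) \<le> Max (range (\<lambda>i. absv (x $ i)))" for j by (intro Max_ge) auto
  ultimately show ?thesis by (intro that[of i]) simp
qed

text \<open>Cramer's rule, after normalising the right hand side by its largest coordinate.\<close>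

lemma vnorm_le_mult_SL:
  fixes g :: "'k::valued_field ^ 'd ^ 'd"
  assumes g: "g \<in> SL" and x: "x \<noteq> 0"
  shows "vnorm x \<le> real CARD('d) * fact CARD('d) * max 1 (opnorm g) ^ CARD('d) * vnorm (g *v x)"
proof -
  obtain i where i: "\<And>j. absv ((g *v x) $ j) \<le> absv ((g *v x) $ i)"
    using exists_max_coordinate[of "g *v x"] by blast
  define b where "b = (g *v x) $ i"
  have b: "b \<noteq> 0"
  proof
    assume "b = 0"
    then have "(g *v x) $ j = 0" for j using i[of j] absv_nonneg[of "(g *v x) $ j"] by (simp add: b_def)
    then have "g *v x = 0" by (simp add: vec_eq_iff)
    then show False using SL_mult_nonzero[OF g x] by simp
  qed
  define z where "z = inverse b *s x"
  define y where "y = g *v z"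
  have yz: "y = inverse b *s (g *v x)" by (simp add: y_def z_def vector_scalar_commute)
  have y1: "absv (y $ j) \<le> 1" for j
  proof -
    have "y $ j = (g *v x) $ j / b" by (simp add: yz divide_inverse_commute)
    then have "absv (y $ j) = absv ((g *v x) $ j) / absv b" by (simp only: absv_divide)
    moreover have "absv ((g *v x) $ j) \<le> absv b" unfolding b_def by (rule i)
    moreover have "0 < absv b" using b by simp
    ultimately show ?thesis by (simp only: divide_le_eq_1_pos)
  qed
  \<comment> \<open>Bounds the entries of \<open>g\<close> as well as those of the normalised right
    hand side, hence all entries of the Cramer matrices.\<close>
  let ?m = "max 1 (opnorm g)"
  have coord: "absv (x $ k) \<le> fact CARD('d) * ?m ^ CARD('d) * absv b" for k
  proof -
    have "z = (\<chi> k. det (\<chi> i j. if j = k then y $ i else g $ i $ j) / det g)"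
    proof (rule iffD1[OF cramer])
      show "det g \<noteq> 0" using g by (simp add: SL_def)
      show "g *v z = y" by (simp only: y_def)
    qed
    from arg_cong[OF this, of "\<lambda>v. v $ k"]
    have "z $ k = det (\<chi> i j. if j = k then y $ i else g $ i $ j)"
      using g by (simp add: SL_def)
    moreover have "absv (det (\<chi> i j. if j = k then y $ i else g $ i $ j)) \<le> fact CARD('d) * ?m ^ CARD('d)"
    proof (rule absv_det_le)
      fix i j
      have "absv (y $ i) \<le> ?m" by (rule order_trans[OF y1 max.cobounded1])
      moreover have "absv (g $ i $ j) \<le> ?m" by (rule order_trans[OF absv_entry_le_opnorm max.cobounded2])
      ultimately show "absv ((\<chi> i j. if j = k then y $ i else g $ i $ j) $ i $ j) \<le> ?m" by simp
    qed
    ultimately have zk: "absv (z $ k) \<le> fact CARD('d) * ?m ^ CARD('d)" by (simp only:)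
    have "x $ k = z $ k * b" using b by (simp add: z_def)
    then have "absv (x $ k) = absv (z $ k) * absv b" by (simp only: absv_mult)
    then show ?thesis using zk by (simp only: mult_right_mono absv_nonneg)
  qed
  have "vnorm x \<le> real CARD('d) * (fact CARD('d) * ?m ^ CARD('d) * absv b)"
    by (rule vnorm_le[OF coord])
  also have "\<dots> \<le> real CARD('d) * (fact CARD('d) * ?m ^ CARD('d) * vnorm (g *v x))"
    unfolding b_def by (intro mult_left_mono absv_le_vnorm) auto
  finally show ?thesis by (simp add: mult.assoc)
qed

text \<open>A supremum of continuous functions is lower semicontinuous, so
  \<open>{g. a < opnorm g}\<close> is open although uncountably many vectors are involved.\<close>

lemma borel_measurable_opnorm: "(opnorm :: 'k::valued_field ^ 'd ^ 'd \<Rightarrow> real) \<in> borel_measurable borel"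
  unfolding borel_measurable_iff_greater
proof
  fix a
  have "{g :: 'k ^ 'd ^ 'd. a < opnorm g} = (\<Union>x. {g. a < vnorm (g *v x) / vnorm x})"
    unfolding opnorm_def by (auto simp: less_cSUP_iff[OF _ bdd_above_opnorm])
  moreover have "open {g :: 'k ^ 'd ^ 'd. a < vnorm (g *v x) / vnorm x}" for x
    unfolding divide_inverse
    by (rule open_Collect_less[OF continuous_on_const continuous_on_mult[OF continuous_on_vnorm[OF
          continuous_on_matrix_vector_mult[OF continuous_on_id continuous_on_const]] continuous_on_const]])
  ultimately have "open {g :: 'k ^ 'd ^ 'd. a < opnorm g}" by auto
  then show "{g \<in> space borel. a < opnorm (g :: 'k ^ 'd ^ 'd)} \<in> sets borel" by simp
qed

section \<open>Random walks on the special linear group\<close>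

lemma axis_nonzero: "axis i 1 \<noteq> (0 :: 'k::valued_field ^ 'd)"
  using vnorm_pos[of "axis i 1 :: 'k ^ 'd"] vnorm_axis[of i, where 'k = 'k] by simp

locale matrix_walk =
  fixes \<mu> :: "('k::valued_field ^ 'd ^ 'd) measure" and \<tau> :: real
  assumes compact_balls_field: "compact_balls (UNIV :: 'k set)"
    and prob_SL: "prob_measure_on_SL \<mu>"
    and \<tau>_positive: "\<tau> > 0"
    and moment: "(\<integral>\<^sup>+ g. ennreal (opnorm g powr \<tau>) \<partial>\<mu>) < \<infinity>"
begin

lemma sets_\<mu>: "sets \<mu> = sets (restrict_space borel SL)"
  using prob_SL by (simp add: prob_measure_on_SL_def)

lemma space_\<mu>: "space \<mu> = SL"
  using sets_eq_imp_space_eq[OF sets_\<mu>] by (simp add: space_restrict_space)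

lemma measurable_\<mu>: "f \<in> measurable borel N \<Longrightarrow> f \<in> measurable \<mu> N"
  unfolding measurable_cong_sets[OF sets_\<mu> refl] by (rule measurable_restrict_space1)

lemma countable_dense_matrices: "\<exists>D :: ('k ^ 'd ^ 'd) set. countable_dense D"
proof -
  obtain D :: "'k set" where "countable_dense D"
    by (rule countable_dense_compact_balls[OF compact_balls_field])
  from countable_dense_vec[OF countable_dense_vec[OF this]] show ?thesis by (rule exI)
qed

lemma measurable_matrix_mult:
  fixes u v :: "'a \<Rightarrow> 'k ^ 'd ^ 'd"
  assumes "u \<in> borel_measurable M" "v \<in> borel_measurable M"
  shows "(\<lambda>x. u x ** v x) \<in> borel_measurable M"
proof -
  obtain D :: "('k ^ 'd ^ 'd) set" where D: "countable_dense D" using countable_dense_matrices by blast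
  have "continuous_on UNIV (\<lambda>p :: ('k ^ 'd ^ 'd) \<times> ('k ^ 'd ^ 'd). fst p ** snd p)"
    by (intro continuous_on_matrix_mult continuous_on_fst continuous_on_snd continuous_on_id)
  from measurable_continuous_Pair[OF D D this assms] show ?thesis by simp
qed

lemma measurable_matrix_mult_\<mu>: "(\<lambda>(g, h). g ** h) \<in> measurable (\<mu> \<Otimes>\<^sub>M \<mu>) \<mu>"
proof -
  have id: "(\<lambda>g. g) \<in> measurable \<mu> borel" by (rule measurable_\<mu>) simp
  have "(\<lambda>p. fst p ** snd p) \<in> borel_measurable (\<mu> \<Otimes>\<^sub>M \<mu>)"
    using measurable_compose[OF measurable_fst id] measurable_compose[OF measurable_snd id]
    by (intro measurable_matrix_mult) auto
  then have "(\<lambda>p. fst p ** snd p) \<in> measurable (\<mu> \<Otimes>\<^sub>M \<mu>) (restrict_space borel SL)"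
    by (intro measurable_restrict_space2) (auto simp: space_pair_measure space_\<mu> SL_def det_mul)
  then show ?thesis
    unfolding case_prod_unfold measurable_cong_sets[OF refl sets_\<mu>] .
qed

section \<open>The norm cocycle and its length function\<close>

definition cocyc :: "'k ^ 'd ^ 'd \<Rightarrow> 'k ^ 'd \<Rightarrow> real" where
  "cocyc g x = ln (vnorm (g *v x) / vnorm x)"

definition lognorm :: "'k ^ 'd ^ 'd \<Rightarrow> real" where
  "lognorm g = ln (opnorm g)"

text \<open>Logarithm of the constant in \<open>vnorm_le_mult_SL\<close>. The additive constant is
  nonnegative and the positive part of \<open>lognorm\<close> is subadditive on \<open>SL\<close>,
  so this is a length function dominating both growth and contraction of vectors.\<close>

definition log_size :: "'k ^ 'd ^ 'd \<Rightarrow> real" where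
  "log_size g = ln (real CARD('d) * fact CARD('d)) + real CARD('d) * max 0 (lognorm g)"

lemma opnorm_pos: "g \<in> SL \<Longrightarrow> 0 < opnorm (g :: 'k ^ 'd ^ 'd)"
proof -
  assume g: "g \<in> SL"
  let ?e = "axis undefined 1 :: 'k ^ 'd"
  have e: "?e \<noteq> 0" by (simp add: axis_nonzero)
  have "0 < vnorm (g *v ?e) / vnorm ?e"
    using e SL_mult_nonzero[OF g e] by (simp add: vnorm_pos)
  then show ?thesis using vnorm_div_le_opnorm[of g ?e] by linarith
qed

lemma ratio_pos: "g \<in> SL \<Longrightarrow> x \<noteq> 0 \<Longrightarrow> 0 < vnorm (g *v x) / vnorm (x :: 'k ^ 'd)"
  by (simp add: vnorm_pos SL_mult_nonzero)

lemma cocyc_le_lognorm: "g \<in> SL \<Longrightarrow> x \<noteq> 0 \<Longrightarrow> cocyc g x \<le> lognorm g"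
  unfolding cocyc_def lognorm_def
  using ratio_pos[of g x] vnorm_div_le_opnorm[of g x] by (subst ln_le_cancel_iff) auto

lemma size_const_nonneg: "0 \<le> ln (real CARD('d) * fact CARD('d))"
proof -
  have "(1::real) * 1 \<le> real CARD('d) * fact CARD('d)"
    by (intro mult_mono fact_ge_1) (auto simp: Suc_le_eq)
  then show ?thesis by simp
qed

lemma lognorm_le_size: "lognorm g \<le> log_size g"
proof -
  have "1 * max 0 (lognorm g) \<le> real CARD('d) * max 0 (lognorm g)"
    by (intro mult_right_mono) (auto simp: Suc_le_eq)
  then show ?thesis using size_const_nonneg unfolding log_size_def by linarith
qed

lemma neg_size_le_cocyc:
  assumes g: "g \<in> SL" and x: "x \<noteq> 0"
  shows "- log_size g \<le> cocyc g x"
proof -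
  have g0: "0 < opnorm g" by (rule opnorm_pos[OF g])
  let ?K = "real CARD('d) * fact CARD('d) * max 1 (opnorm g) ^ CARD('d)"
  have K: "0 < ?K" by simp
  have "1 / ?K \<le> vnorm (g *v x) / vnorm x"
    using vnorm_le_mult_SL[OF g x] K x by (simp add: divide_le_eq le_divide_eq vnorm_pos mult.commute)
  then have "ln (1 / ?K) \<le> cocyc g x"
    unfolding cocyc_def using K ratio_pos[OF g x] by (subst ln_le_cancel_iff) auto
  moreover have "ln (1 / ?K) = - ln ?K" using K by (simp add: ln_div)
  moreover have "ln ?K = ln (real CARD('d) * fact CARD('d)) + real CARD('d) * ln (max 1 (opnorm g))"
    by (subst ln_mult_pos) (auto simp: ln_realpow)
  moreover have "ln (max 1 (opnorm g)) = max 0 (lognorm g)"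
    using g0 by (simp add: max_def lognorm_def)
  ultimately show ?thesis by (simp add: log_size_def)
qed

lemma abs_cocyc_le: "g \<in> SL \<Longrightarrow> x \<noteq> 0 \<Longrightarrow> \<bar>cocyc g x\<bar> \<le> log_size g"
  using neg_size_le_cocyc[of g x] cocyc_le_lognorm[of g x] lognorm_le_size[of g] by linarith

lemma abs_lognorm_le:
  assumes g: "g \<in> SL" shows "\<bar>lognorm g\<bar> \<le> log_size g"
proof -
  have e: "(axis undefined 1 :: 'k ^ 'd) \<noteq> 0" by (simp add: axis_nonzero)
  show ?thesis
    using neg_size_le_cocyc[OF g e] cocyc_le_lognorm[OF g e] lognorm_le_size[of g] by linarith
qed

lemma cocyc_mult:
  assumes g: "g \<in> SL" and h: "h \<in> SL" and x: "x \<noteq> 0"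
  shows "cocyc (g ** h) x = cocyc g (h *v x) + cocyc h x"
proof -
  have hx: "h *v x \<noteq> 0" by (rule SL_mult_nonzero[OF h x])
  have "vnorm ((g ** h) *v x) / vnorm x = (vnorm (g *v (h *v x)) / vnorm (h *v x)) * (vnorm (h *v x) / vnorm x)"
    using vnorm_pos[of "h *v x"] hx by (simp add: matrix_vector_mul_assoc)
  then show ?thesis
    unfolding cocyc_def using ratio_pos[OF g hx] ratio_pos[OF h x] by (simp only: ln_mult_pos)
qed

lemma lognorm_mult:
  assumes g: "g \<in> SL" and h: "h \<in> SL"
  shows "lognorm (g ** h) \<le> lognorm g + lognorm h"
proof -
  have gh: "g ** h \<in> SL" using g h by (simp add: SL_def det_mul)
  have "ln (opnorm (g ** h)) \<le> ln (opnorm g * opnorm h)"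
    using opnorm_mult[of g h] opnorm_pos[OF gh] opnorm_pos[OF g] opnorm_pos[OF h]
    by (subst ln_le_cancel_iff) auto
  also have "\<dots> = ln (opnorm g) + ln (opnorm h)"
    using opnorm_pos[OF g] opnorm_pos[OF h] by (rule ln_mult_pos)
  finally show ?thesis by (simp add: lognorm_def)
qed

lemma size_mult:
  assumes g: "g \<in> SL" and h: "h \<in> SL"
  shows "log_size (g ** h) \<le> log_size g + log_size h"
proof -
  have "max 0 (lognorm (g ** h)) \<le> max 0 (lognorm g) + max 0 (lognorm h)"
    using lognorm_mult[OF g h] by linarith
  then have "real CARD('d) * max 0 (lognorm (g ** h)) \<le> real CARD('d) * (max 0 (lognorm g) + max 0 (lognorm h))"
    by (intro mult_left_mono) auto
  then show ?thesis
    using size_const_nonneg unfolding log_size_def distrib_left by linarith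
qed

lemma cocyc_measurable: "(\<lambda>g. cocyc g x) \<in> borel_measurable \<mu>"
proof -
  have "(\<lambda>g :: 'k ^ 'd ^ 'd. vnorm (g *v x)) \<in> borel_measurable borel"
    by (intro borel_measurable_continuous_onI continuous_on_vnorm continuous_on_matrix_vector_mult
        continuous_on_id continuous_on_const)
  then show ?thesis
    unfolding cocyc_def
    by (intro measurable_\<mu> borel_measurable_ln borel_measurable_divide borel_measurable_const)
qed

lemma lognorm_measurable: "lognorm \<in> borel_measurable \<mu>"
  unfolding lognorm_def[abs_def] by (rule measurable_\<mu>[OF borel_measurable_ln[OF borel_measurable_opnorm]])

lemma size_measurable: "log_size \<in> borel_measurable \<mu>"
  unfolding log_size_def[abs_def]
  by (intro borel_measurable_add borel_measurable_times borel_measurable_max borel_measurable_const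
      lognorm_measurable)

text \<open>The factor \<open>CARD('d)\<close> in \<open>log_size\<close> forces the exponent \<tau>
  / d; the positive part of the logarithm then contributes at most 1 +
  \<open>opnorm g powr \<tau>\<close>.\<close>

lemma exp_size_moment:
  "(\<integral>\<^sup>+ g. ennreal (exp (\<tau> / real CARD('d) * log_size g)) \<partial>\<mu>) < \<infinity>"
proof -
  interpret prob_space \<mu> using prob_SL by (simp add: prob_measure_on_SL_def)
  let ?A = "exp (\<tau> / real CARD('d) * ln (real CARD('d) * fact CARD('d)))"
  have meas: "(\<lambda>g. ennreal (opnorm g powr \<tau>)) \<in> borel_measurable \<mu>"
    by (rule measurable_\<mu>[OF measurable_compose[OF
            powr_real_measurable[OF borel_measurable_opnorm borel_measurable_const] measurable_ennreal]])
  have "exp (\<tau> / real CARD('d) * log_size g) \<le> ?A * (1 + opnorm g powr \<tau>)" if "g \<in> SL" for g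
  proof -
    have "\<tau> / real CARD('d) * log_size g =
        \<tau> / real CARD('d) * ln (real CARD('d) * fact CARD('d)) + \<tau> * max 0 (lognorm g)"
      by (simp add: log_size_def distrib_left)
    then have "exp (\<tau> / real CARD('d) * log_size g) = ?A * exp (\<tau> * max 0 (lognorm g))"
      by (simp only: exp_add)
    also have "exp (\<tau> * max 0 (lognorm g)) \<le> 1 + opnorm g powr \<tau>"
      using opnorm_pos[OF that] by (auto simp: max_def lognorm_def powr_def mult.commute)
    finally show ?thesis by simp
  qed
  then have "(\<integral>\<^sup>+ g. ennreal (exp (\<tau> / real CARD('d) * log_size g)) \<partial>\<mu>) \<le>
      (\<integral>\<^sup>+ g. ennreal ?A * (1 + ennreal (opnorm g powr \<tau>)) \<partial>\<mu>)"
    by (intro nn_integral_mono)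
      (simp add: space_\<mu> ennreal_1[symmetric] ennreal_plus[symmetric] ennreal_mult[symmetric] ennreal_leI
        del: ennreal_1 ennreal_plus)
  also have "\<dots> = ennreal ?A * (1 + (\<integral>\<^sup>+ g. ennreal (opnorm g powr \<tau>) \<partial>\<mu>))"
    using meas by (simp add: nn_integral_cmult nn_integral_add emeasure_space_1)
  also have "\<dots> < \<infinity>"
    using moment by (simp add: ennreal_mult_less_top)
  finally show ?thesis .
qed

sublocale cocycle_walk \<mu> "(**)" "mat 1" "(*v)" "{x. x \<noteq> 0}" cocyc lognorm log_size "\<tau> / real CARD('d)"
proof (intro cocycle_walk.intro random_walk.intro cocycle_walk_axioms.intro)
  show "prob_space \<mu>" using prob_SL by (simp add: prob_measure_on_SL_def)
  show "(\<lambda>(g, h). g ** h) \<in> \<mu> \<Otimes>\<^sub>M \<mu> \<rightarrow>\<^sub>M \<mu>" by (rule measurable_matrix_mult_\<mu>)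
  show "mat 1 \<in> space \<mu>" by (simp add: space_\<mu> SL_def)
  show "(g ** h) ** k = g ** (h ** k)" for g h k :: "'k ^ 'd ^ 'd" by (simp add: matrix_mul_assoc)
  show "{x :: 'k ^ 'd. x \<noteq> 0} \<noteq> {}"
  proof -
    have "(axis undefined 1 :: 'k ^ 'd) \<in> {x. x \<noteq> 0}" by (simp add: axis_nonzero)
    then show ?thesis by blast
  qed
  show "lognorm (mat 1) \<le> 0"
    using opnorm_one_le[where 'k = 'k and 'd = 'd] opnorm_nonneg[of "mat 1 :: 'k ^ 'd ^ 'd"]
    unfolding lognorm_def by (cases "opnorm (mat 1 :: 'k ^ 'd ^ 'd) = 0") auto
  show "(\<integral>\<^sup>+ g. ennreal (exp (\<tau> / real CARD('d) * log_size g)) \<partial>\<mu>) < \<infinity>"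
    by (rule exp_size_moment)
  show "\<tau> / real CARD('d) > 0" using \<tau>_positive by simp
qed (simp_all only: space_\<mu> mem_Collect_eq SL_mult_nonzero cocyc_mult cocyc_measurable
    lognorm_measurable size_measurable lognorm_mult size_mult cocyc_le_lognorm abs_cocyc_le
    abs_lognorm_le matrix_vector_mul_assoc matrix_mul_lid matrix_vector_mul_lid not_False_eq_True)

end

section \<open>Uniform transversality\<close>

text \<open>Bilinear, without conjugation over the complex numbers: \<open>f\<close> stands for a
  linear form, in the application a row of a matrix.\<close>

definition dotp :: "'k::field ^ 'd \<Rightarrow> 'k ^ 'd \<Rightarrow> 'k" where
  "dotp f v = (\<Sum>i\<in>UNIV. f $ i * v $ i)"

lemma dotp_add: "dotp f (v + w) = dotp f v + dotp f w"
  by (simp add: dotp_def distrib_left sum.distrib)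

lemma dotp_scale: "dotp f (c *s v) = c * dotp f v"
  by (simp add: dotp_def sum_distrib_left mult.left_commute)

lemma continuous_on_dotp [continuous_intros]:
  fixes f g :: "'a::topological_space \<Rightarrow> 'k::valued_field ^ 'd"
  shows "continuous_on S f \<Longrightarrow> continuous_on S g \<Longrightarrow> continuous_on S (\<lambda>x. dotp (f x) (g x))"
  unfolding dotp_def by (intro continuous_intros)

text \<open>Representatives of all lines; dividing by \<open>vnorm x\<close> is impossible, as it is a real number.\<close>

definition normalized :: "('k::valued_field ^ 'd) set" where
  "normalized = {x. (\<forall>i. absv (x $ i) \<le> 1) \<and> (\<exists>i. x $ i = 1)}"

lemma normalize:
  fixes x :: "'k::valued_field ^ 'd"
  assumes "\<And>j. absv (x $ j) \<le> absv (x $ i)" and "x $ i \<noteq> 0"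
  shows "inverse (x $ i) *s x \<in> normalized"
proof -
  have "absv ((inverse (x $ i) *s x) $ j) \<le> 1" for j
  proof -
    have "(inverse (x $ i) *s x) $ j = x $ j / x $ i" by (simp add: divide_inverse_commute)
    then have "absv ((inverse (x $ i) *s x) $ j) = absv (x $ j) / absv (x $ i)" by (simp only: absv_divide)
    moreover have "0 < absv (x $ i)" using assms(2) by simp
    ultimately show ?thesis using assms(1)[of j] by (simp only: divide_le_eq_1_pos)
  qed
  moreover have "(inverse (x $ i) *s x) $ i = 1" using assms(2) by simp
  ultimately show ?thesis unfolding normalized_def by blast
qed

lemma normalized_nonzero: "x \<in> normalized \<Longrightarrow> x \<noteq> (0 :: 'k::valued_field ^ 'd)"
  by (auto simp: normalized_def)

text \<open>A product of unit balls is compact by Tychonoff's theorem and \<open>vec_lambda\<close>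
  is continuous; that some coordinate equals 1 is a finite union of closed conditions.\<close>

lemma compact_normalized:
  assumes "compact_balls (UNIV :: 'k::valued_field set)"
  shows "compact (normalized :: ('k::valued_field ^ 'd) set)"
proof -
  let ?B = "{a :: 'k. absv a \<le> 1}"
  have "compact ?B" using assms unfolding compact_balls_def by (metis (no_types, lifting) Collect_cong UNIV_I)
  then have "compactin (product_topology (\<lambda>i. euclidean) UNIV) (PiE (UNIV :: 'd set) (\<lambda>_. ?B))"
    by (simp add: compactin_PiE)
  then have "compact (PiE (UNIV :: 'd set) (\<lambda>_. ?B))"
    by (simp add: euclidean_product_topology)
  moreover have "continuous_on (PiE (UNIV :: 'd set) (\<lambda>_. ?B)) (\<lambda>c. vec_lambda c :: 'k ^ 'd)"
    by (intro continuous_on_vec_lambda continuous_on_product_coordinates[THEN continuous_on_subset]) auto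
  ultimately have "compact ((\<lambda>c. vec_lambda c :: 'k ^ 'd) ` PiE (UNIV :: 'd set) (\<lambda>_. ?B))"
    by (intro compact_continuous_image)
  moreover have "closed (\<Union>i. {x :: 'k ^ 'd. x $ i = 1})"
    by (intro closed_UN ballI closed_Collect_eq continuous_intros) auto
  ultimately have "compact ((\<lambda>c. vec_lambda c :: 'k ^ 'd) ` PiE (UNIV :: 'd set) (\<lambda>_. ?B) \<inter> (\<Union>i. {x. x $ i = 1}))"
    by (rule compact_Int_closed)
  also have "(\<lambda>c. vec_lambda c :: 'k ^ 'd) ` PiE (UNIV :: 'd set) (\<lambda>_. ?B) \<inter> (\<Union>i. {x. x $ i = 1}) = normalized"
  proof (intro set_eqI iffI)
    fix x :: "'k ^ 'd" assume x: "x \<in> normalized"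
    then have "(\<lambda>i. x $ i) \<in> PiE UNIV (\<lambda>_. ?B)" by (simp add: normalized_def PiE_UNIV_domain)
    moreover have "x = vec_lambda (\<lambda>i. x $ i)" by (simp add: vec_lambda_eta)
    ultimately show "x \<in> (\<lambda>c. vec_lambda c) ` PiE UNIV (\<lambda>_. ?B) \<inter> (\<Union>i. {x. x $ i = 1})"
      using x unfolding normalized_def by blast
  qed (auto simp: normalized_def)
  finally show ?thesis .
qed

context matrix_walk begin

lemma walk_1: "walk 1 = \<mu>"
proof (rule measure_eqI)
  fix E assume "E \<in> sets (walk 1)"
  then have E: "E \<in> sets \<mu>" by simp
  have "emeasure (walk (Suc 0)) E = (\<integral>\<^sup>+g. indicator E g \<partial>walk (Suc 0))"
    using E by (simp del: walk.simps)
  also have "\<dots> = (\<integral>\<^sup>+h. \<integral>\<^sup>+g. indicator E (g ** h) \<partial>\<mu> \<partial>walk 0)"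
    using E by (intro nn_integral_walk_Suc) simp
  also have "\<dots> = (\<integral>\<^sup>+g. indicator E (g ** mat 1) \<partial>\<mu>)"
  proof -
    interpret W: prob_space \<mu> by (rule prob_space_step)
    have "(\<lambda>(h, g). indicator E (g ** h) :: ennreal) \<in> borel_measurable (\<mu> \<Otimes>\<^sub>M \<mu>)"
      using measurable_compose[OF measurable_pair_swap' measurable_mult_compose[of "indicator E"]] E
      by (simp add: case_prod_unfold)
    from W.borel_measurable_nn_integral[OF this] show ?thesis
      by (simp add: nn_integral_return one_in_space)
  qed
  also have "\<dots> = emeasure \<mu> E"
    using E by (simp add: matrix_mul_rid)
  finally show "emeasure (walk 1) E = emeasure \<mu> E" by simp
qed simp

lemma measurable_continuous:
  assumes "continuous_on UNIV (f :: 'k ^ 'd ^ 'd \<Rightarrow> real)"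
  shows "f \<in> borel_measurable \<mu>"
  by (rule measurable_\<mu>[OF borel_measurable_continuous_onI[OF assms]])

lemma continuous_on_dotp_act: "continuous_on UNIV (\<lambda>h :: 'k ^ 'd ^ 'd. absv (dotp f (h *v v)))"
  by (intro continuous_on_absv continuous_on_dotp continuous_on_matrix_vector_mult continuous_on_id
      continuous_on_const)

text \<open>
  The vectors almost surely annihilated by \<open>f\<close> along the whole walk form a closed subspace invariant
  under \<open>\<Gamma> \<mu>\<close>.
\<close>

lemma irreducible_not_annihilated:
  fixes f y :: "'k ^ 'd"
  assumes irr: "strongly_irreducible (\<Gamma> \<mu>)" and f: "f \<noteq> 0" and y: "y \<noteq> 0"
    and ann: "\<And>i. AE h in walk i. dotp f (h *v y) = 0"
  shows False
proof -
  define W where "W = {v. \<forall>i. AE h in walk i. dotp f (h *v v) = 0}"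
  have sub: "vec.subspace W"
  proof (rule vec.subspaceI)
    show "0 \<in> W" by (simp add: W_def dotp_def)
  next
    fix v w assume "v \<in> W" "w \<in> W"
    then have vw: "AE h in walk i. dotp f (h *v v) = 0" "AE h in walk i. dotp f (h *v w) = 0" for i
      by (simp_all add: W_def)
    have "AE h in walk i. dotp f (h *v (v + w)) = 0" for i
      using vw[of i] by eventually_elim (simp add: matrix_vector_right_distrib dotp_add)
    then show "v + w \<in> W" by (simp add: W_def)
  next
    fix c v assume "v \<in> W"
    then have v: "AE h in walk i. dotp f (h *v v) = 0" for i
      by (simp add: W_def)
    have "AE h in walk i. dotp f (h *v (c *s v)) = 0" for i
      using v[of i] by eventually_elim (simp add: vector_scalar_commute dotp_scale)
    then show "c *s v \<in> W" by (simp add: W_def)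
  qed
  have closed_W: "closed W"
    unfolding closed_sequential_limits
  proof (intro allI impI)
    fix s v assume s: "(\<forall>n. s n \<in> W) \<and> s \<longlonglongrightarrow> v"
    have "AE h in walk i. dotp f (h *v v) = 0" for i
    proof -
      have "AE h in walk i. \<forall>n. dotp f (h *v s n) = 0"
        using s unfolding W_def AE_all_countable by blast
      then show ?thesis
      proof (rule eventually_mono)
        fix h assume h: "\<forall>n. dotp f (h *v s n) = 0"
        have "continuous_on UNIV (\<lambda>v. dotp f (h *v v))"
          by (intro continuous_on_dotp continuous_on_matrix_vector_mult continuous_on_id continuous_on_const)
        then have "(\<lambda>n. dotp f (h *v s n)) \<longlonglongrightarrow> dotp f (h *v v)"
          using s by (intro continuous_on_tendsto_compose[where s = UNIV and f = "\<lambda>v. dotp f (h *v v)"]) auto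
        then show "dotp f (h *v v) = 0" using h by (simp add: LIMSEQ_const_iff)
      qed
    qed
    then show "v \<in> W" by (simp add: W_def)
  qed
  \<comment> \<open>Split off the first step \<open>g\<close> from a walk of i + 1 steps: a
    nonnegative function has integral 0, so for almost every \<open>g\<close> it vanishes for almost
    every \<open>h\<close>, and this for all \<open>i\<close> at once. The null set still depends on
    \<open>v\<close>.\<close>
  have invariant_AE: "AE g in \<mu>. g *v v \<in> W" if v: "v \<in> W" for v
  proof -
    have "AE g in \<mu>. AE h in walk i. dotp f (h *v (g *v v)) = 0" for i
    proof -
      interpret V: prob_space "walk i" by (rule prob_space_walk)
      let ?F = "\<lambda>h :: 'k ^ 'd ^ 'd. ennreal (absv (dotp f (h *v v)))"
      have F: "?F \<in> borel_measurable \<mu>"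
        by (intro measurable_compose[OF measurable_continuous[OF continuous_on_dotp_act] measurable_ennreal])
      have "AE h in walk (i + 1). ?F h = 0"
        using v unfolding W_def by auto
      then have "(\<integral>\<^sup>+h. ?F h \<partial>walk (i + 1)) = 0"
        using F by (subst nn_integral_0_iff_AE) (auto simp del: walk.simps)
      then have 0: "(\<integral>\<^sup>+g. \<integral>\<^sup>+h. ?F (h ** g) \<partial>walk i \<partial>\<mu>) = 0"
        using nn_integral_walk_add[OF F, of i 1] unfolding walk_1 by simp
      have "(\<lambda>(h, g). ?F (h ** g)) \<in> borel_measurable (\<mu> \<Otimes>\<^sub>M \<mu>)"
        by (rule measurable_mult_compose[OF F])
      from measurable_compose[OF measurable_pair_swap' this]
      have "(\<lambda>(g, h). ?F (h ** g)) \<in> borel_measurable (\<mu> \<Otimes>\<^sub>M walk i)"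
        by (simp add: case_prod_unfold cong: measurable_cong_sets sets_pair_measure_cong)
      from V.borel_measurable_nn_integral[OF this]
      have "(\<lambda>g. \<integral>\<^sup>+h. ?F (h ** g) \<partial>walk i) \<in> borel_measurable \<mu>" by simp
      then have null: "AE g in \<mu>. (\<integral>\<^sup>+h. ?F (h ** g) \<partial>walk i) = 0"
        using 0 by (simp add: nn_integral_0_iff_AE)
      have section_null: "AE h in walk i. dotp f (h *v (g *v v)) = 0"
        if "(\<integral>\<^sup>+h. ?F (h ** g) \<partial>walk i) = 0" "g \<in> space \<mu>" for g
      proof -
        have "(\<lambda>h. ?F (h ** g)) \<in> borel_measurable (walk i)"
          using measurable_compose[OF measurable_mult_left[OF that(2)] F] by simp
        then have "AE h in walk i. ?F (h ** g) = 0"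
          using that(1) by (simp add: nn_integral_0_iff_AE)
        then show ?thesis by (simp add: matrix_vector_mul_assoc)
      qed
      show ?thesis
        by (rule AE_mp[OF null], rule AE_I2) (blast intro: section_null)
    qed
    then show ?thesis unfolding W_def mem_Collect_eq AE_all_countable by blast
  qed
  \<comment> \<open>The elements of \<open>SL\<close> preserving \<open>W\<close> form a closed
    semigroup because \<open>W\<close> is closed; by definition of \<open>\<Gamma> \<mu>\<close> it
    remains to see that it contains the support.\<close>
  define T where "T = {g \<in> SL. \<forall>w\<in>W. g *v w \<in> W}"
  have "closed_semigroup T"
    unfolding closed_semigroup_def
  proof (intro conjI ballI)
    have "closed (\<Inter>w\<in>W. (\<lambda>g :: 'k ^ 'd ^ 'd. g *v w) -` W)"
      by (intro closed_INT ballI closed_vimage closed_W continuous_on_matrix_vector_mult continuous_on_id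
          continuous_on_const)
    moreover have "T = SL \<inter> (\<Inter>w\<in>W. (\<lambda>g. g *v w) -` W)" by (auto simp: T_def)
    ultimately show "closedin (top_of_set SL) T" by (auto simp: closedin_closed)
    fix g h assume "g \<in> T" "h \<in> T"
    then show "g ** h \<in> T"
      by (auto simp: T_def SL_def det_mul matrix_vector_mul_assoc[symmetric])
  qed
  moreover have "msupport \<mu> \<subseteq> T"
  proof
    fix g assume g: "g \<in> msupport \<mu>"
    then have "g \<in> SL" by (auto simp: msupport_def space_\<mu>)
    moreover have "g *v w \<in> W" if w: "w \<in> W" for w
    proof (rule ccontr)
      \<comment> \<open>If g w left the closed set \<open>W\<close>, this open set around a point of
        the support would have positive measure, against the almost sure invariance.\<close>
      let ?U = "(\<lambda>g :: 'k ^ 'd ^ 'd. g *v w) -` (- W)"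
      assume "g *v w \<notin> W"
      moreover have "open ?U"
        using closed_W by (intro open_vimage continuous_on_matrix_vector_mult continuous_on_id
            continuous_on_const) auto
      ultimately have pos: "emeasure \<mu> (?U \<inter> space \<mu>) > 0"
        using g by (auto simp: msupport_def)
      have "?U \<inter> space \<mu> \<in> sets \<mu>"
        unfolding sets_\<mu> space_\<mu> sets_restrict_space
        using \<open>open ?U\<close> by (intro image_eqI[of _ _ ?U]) auto
      moreover have "?U \<inter> space \<mu> = {g \<in> space \<mu>. \<not> g *v w \<in> W}" by auto
      ultimately have "?U \<inter> space \<mu> \<in> null_sets \<mu>"
        using invariant_AE[OF w] by (simp only: AE_iff_null)
      then show False using pos by auto
    qed
    ultimately show "g \<in> T" by (simp add: T_def)
  qed
  ultimately have "\<Gamma> \<mu> \<subseteq> T" by (auto simp: \<Gamma>_def)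
  then have inv: "(\<lambda>v. g *v v) ` W \<subseteq> W" if "g \<in> \<Gamma> \<mu>" for g
    using that by (auto simp: T_def)
  have "y \<in> W" using ann by (simp add: W_def)
  then have "W \<noteq> {0}" using y by auto
  moreover have "W \<noteq> UNIV"
  proof -
    obtain j where j: "f $ j \<noteq> 0" using f by (auto simp: vec_eq_iff)
    have d: "dotp f (axis j 1) = f $ j"
      by (simp add: dotp_def axis_def if_distrib cong: if_cong)
    \<comment> \<open>At time 0 the walk sits at the identity, so \<open>W\<close> lies in the
      kernel of \<open>f\<close>; a coordinate vector on which \<open>f\<close> does not vanish is
      outside.\<close>
    have "\<not> (AE h in walk 0. dotp f (h *v axis j 1) = 0)"
    proof
      assume "AE h in walk 0. dotp f (h *v axis j 1) = 0"
      then have "AE h in return \<mu> (mat 1). dotp f (h *v axis j 1) = 0" by (simp only: walk.simps(1))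
      moreover have "Measurable.pred \<mu> (\<lambda>h. dotp f (h *v axis j 1) = 0)"
      proof -
        have "Measurable.pred \<mu> (\<lambda>h. absv (dotp f (h *v axis j 1)) = 0)"
          using measurable_continuous[OF continuous_on_dotp_act] by measurable
        then show ?thesis by simp
      qed
      ultimately have "dotp f (mat 1 *v axis j 1) = 0"
        using AE_return[OF one_in_space, of "\<lambda>h. dotp f (h *v axis j 1) = 0"] by blast
      then show False using j d by simp
    qed
    then have "axis j 1 \<notin> W" unfolding W_def by blast
    then show ?thesis by blast
  qed
  ultimately have "\<not> strongly_irreducible (\<Gamma> \<mu>)"
    using sub inv unfolding strongly_irreducible_def not_not
    by (intro exI[of _ "{W}"]) simp
  then show False using irr by simp
qed

section \<open>Margins of linear forms along the walk\<close>

lemma c_act_measurable_\<mu>: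
  assumes "g \<in> SL" "x \<noteq> 0"
  shows "(\<lambda>h. cocyc g (h *v x)) \<in> borel_measurable \<mu>"
proof -
  have "g \<in> space \<mu>" "x \<in> {x. x \<noteq> 0}" using assms by (simp_all add: space_\<mu>)
  from measurable_compose[OF measurable_Pair1'[OF this(1)] c_act_measurable[OF this(2)]] show ?thesis
    by simp
qed

text \<open>Quantitative form of \<open>dotp f (h *v y) \<noteq> 0\<close>; the margin is relative
  to the norm of the image, hence unchanged when \<open>y\<close> is multiplied by a non-zero
  scalar.\<close>

definition transversal :: "real \<Rightarrow> 'k ^ 'd \<Rightarrow> 'k ^ 'd \<Rightarrow> ('k ^ 'd ^ 'd) set" where
  "transversal e f y = {h \<in> SL. e * vnorm (h *v y) \<le> absv (dotp f (h *v y))}"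

lemma transversal_sets: "transversal e f y \<in> sets \<mu>"
proof -
  have "continuous_on UNIV (\<lambda>h :: 'k ^ 'd ^ 'd. absv (dotp f (h *v y)) - e * vnorm (h *v y))"
    by (intro continuous_on_diff continuous_on_dotp_act continuous_on_mult continuous_on_const
        continuous_on_vnorm continuous_on_matrix_vector_mult continuous_on_id)
  from measurable_sets[OF measurable_continuous[OF this], of "{0..}"]
  have "{h \<in> SL. 0 \<le> absv (dotp f (h *v y)) - e * vnorm (h *v y)} \<in> sets \<mu>"
    by (simp add: vimage_def Int_def space_\<mu> conj_commute)
  then show ?thesis by (simp add: transversal_def)
qed

text \<open>
  If this fails, compactness yields a limit pair \<open>(y, f)\<close> for which, by Fatou's lemma, \<open>f\<close> annihilates
  the walk started at \<open>y\<close> almost surely at all times.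
\<close>

lemma uniform_transversality:
  assumes irr: "strongly_irreducible (\<Gamma> \<mu>)"
  obtains n :: nat where "\<And>y f. y \<in> normalized \<Longrightarrow> f \<in> normalized \<Longrightarrow>
    ennreal (1 / real (Suc n)) \<le> (\<Sum>i<Suc n. emeasure (walk i) (transversal (1 / real (Suc n)) f y))"
proof (rule ccontr)
  assume "\<not> thesis"
  \<comment> \<open>One integer serves as number of times, margin and probability; failure for every
    \<open>n\<close> gives a sequence of pairs along which all three degenerate together.\<close>
  then have "\<forall>n. \<exists>p. p \<in> normalized \<times> normalized \<and>
    (\<Sum>i<Suc n. emeasure (walk i) (transversal (1 / real (Suc n)) (snd p) (fst p))) < ennreal (1 / real (Suc n))"
    using that by (auto simp: not_le simp del: sum.lessThan_Suc) (meson not_le)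
  then obtain p where p: "\<And>n. p n \<in> normalized \<times> normalized"
    and small: "\<And>n. (\<Sum>i<Suc n. emeasure (walk i) (transversal (1 / real (Suc n)) (snd (p n)) (fst (p n))))
      < ennreal (1 / real (Suc n))"
    unfolding choice_iff by blast
  have "compact ((normalized :: ('k ^ 'd) set) \<times> (normalized :: ('k ^ 'd) set))"
    by (intro compact_Times compact_normalized compact_balls_field)
  then obtain q r where q: "q \<in> normalized \<times> normalized" and r: "strict_mono r" "(p \<circ> r) \<longlonglongrightarrow> q"
    using p unfolding compact_def by metis
  define y f where "y = fst q" and "f = snd q"
  have y: "y \<noteq> 0" and f: "f \<noteq> 0"
    using q normalized_nonzero[of "fst q"] normalized_nonzero[of "snd q"]
    by (auto simp: y_def f_def mem_Times_iff)
  have lim_y: "(\<lambda>n. fst (p (r n))) \<longlonglongrightarrow> y" and lim_f: "(\<lambda>n. snd (p (r n))) \<longlonglongrightarrow> f"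
    using tendsto_fst[OF r(2)] tendsto_snd[OF r(2)] by (simp_all add: o_def y_def f_def)
  let ?E = "\<lambda>n. transversal (1 / real (Suc (r n))) (snd (p (r n))) (fst (p (r n)))"
  have "AE h in walk i. dotp f (h *v y) = 0" for i
  proof -
    let ?Z = "{h \<in> SL. dotp f (h *v y) \<noteq> 0}"
    have Z: "?Z \<in> sets \<mu>"
    proof -
      have "(\<lambda>h. absv (dotp f (h *v y))) -` {0} \<inter> space \<mu> \<in> sets \<mu>"
        by (rule measurable_sets[OF measurable_continuous[OF continuous_on_dotp_act]]) simp
      then have "space \<mu> - (\<lambda>h. absv (dotp f (h *v y))) -` {0} \<inter> space \<mu> \<in> sets \<mu>" by simp
      also have "space \<mu> - (\<lambda>h. absv (dotp f (h *v y))) -` {0} \<inter> space \<mu> = ?Z"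
        by (auto simp: space_\<mu>)
      finally show ?thesis .
    qed
    \<comment> \<open>The margin tends to 0 while the value at the limit pair is non-zero, so each
      such \<open>h\<close> eventually enters the sets; this is the pointwise input to Fatou's
      lemma.\<close>
    have ev: "eventually (\<lambda>n. h \<in> ?E n) sequentially" if h: "h \<in> ?Z" for h
    proof -
      have "(\<lambda>n. absv (dotp (snd (p (r n))) (h *v fst (p (r n)))) -
          1 / real (Suc (r n)) * vnorm (h *v fst (p (r n)))) \<longlonglongrightarrow>
          absv (dotp f (h *v y)) - 0 * vnorm (h *v y)"
      proof (intro tendsto_diff tendsto_mult)
        have "continuous_on UNIV (\<lambda>w :: ('k ^ 'd) \<times> ('k ^ 'd). absv (dotp (snd w) (h *v fst w)))"
          by (intro continuous_on_absv continuous_on_dotp continuous_on_matrix_vector_mult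
              continuous_on_const continuous_on_fst continuous_on_snd continuous_on_id)
        from continuous_on_tendsto_compose[OF this tendsto_Pair[OF lim_y lim_f]]
        show "(\<lambda>n. absv (dotp (snd (p (r n))) (h *v fst (p (r n))))) \<longlonglongrightarrow> absv (dotp f (h *v y))"
          by simp
        have "continuous_on UNIV (\<lambda>w. vnorm (h *v w))"
          by (intro continuous_on_vnorm continuous_on_matrix_vector_mult continuous_on_const continuous_on_id)
        from continuous_on_tendsto_compose[OF this lim_y]
        show "(\<lambda>n. vnorm (h *v fst (p (r n)))) \<longlonglongrightarrow> vnorm (h *v y)" by simp
        show "(\<lambda>n. 1 / real (Suc (r n))) \<longlonglongrightarrow> 0"
          using LIMSEQ_subseq_LIMSEQ[OF LIMSEQ_Suc[OF lim_1_over_n] r(1)] by (simp add: o_def)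
      qed
      moreover have "0 < absv (dotp f (h *v y)) - 0 * vnorm (h *v y)" using h by simp
      ultimately have "eventually (\<lambda>n. 0 < absv (dotp (snd (p (r n))) (h *v fst (p (r n)))) -
          1 / real (Suc (r n)) * vnorm (h *v fst (p (r n)))) sequentially"
        by (rule order_tendstoD)
      then show ?thesis
        using h by (auto simp: transversal_def elim!: eventually_mono)
    qed
    have "emeasure (walk i) ?Z = (\<integral>\<^sup>+h. indicator ?Z h \<partial>walk i)" using Z by simp
    also have "\<dots> \<le> (\<integral>\<^sup>+h. liminf (\<lambda>n. indicator (?E n) h) \<partial>walk i)"
    proof (rule nn_integral_mono)
      fix h
      show "indicator ?Z h \<le> liminf (\<lambda>n. indicator (?E n) h :: ennreal)"
      proof (cases "h \<in> ?Z")
        case True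
        have "eventually (\<lambda>n. 1 \<le> (indicator (?E n) h :: ennreal)) sequentially"
          using ev[OF True] by (rule eventually_mono) (simp add: indicator_def)
        then have "1 \<le> liminf (\<lambda>n. indicator (?E n) h :: ennreal)" by (rule Liminf_bounded)
        then show ?thesis by (simp add: indicator_def)
      qed simp
    qed
    also have "\<dots> \<le> liminf (\<lambda>n. \<integral>\<^sup>+h. indicator (?E n) h \<partial>walk i)"
      using transversal_sets by (intro nn_integral_liminf) simp
    also have "\<dots> = liminf (\<lambda>n. emeasure (walk i) (?E n))"
      using transversal_sets by simp
    also have "\<dots> \<le> 0"
    proof -
      have "eventually (\<lambda>n. emeasure (walk i) (?E n) \<le> ennreal (1 / real (Suc (r n)))) sequentially"
        using eventually_ge_at_top[of i]
      proof (rule eventually_mono)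
        \<comment> \<open>i \<le> n \<le> r n places time \<open>i\<close> among the times summed in
          \<open>small\<close>.\<close>
        fix n assume n: "i \<le> n"
        also have "n \<le> r n" by (rule seq_suble[OF r(1)])
        finally have "emeasure (walk i) (?E n) \<le> (\<Sum>j<Suc (r n). emeasure (walk j) (?E n))"
          by (intro member_le_sum) auto
        also have "\<dots> \<le> ennreal (1 / real (Suc (r n)))" using small[of "r n"] by (rule less_imp_le)
        finally show "emeasure (walk i) (?E n) \<le> ennreal (1 / real (Suc (r n)))" .
      qed
      then have "liminf (\<lambda>n. emeasure (walk i) (?E n)) \<le> liminf (\<lambda>n. ennreal (1 / real (Suc (r n))))"
        by (rule Liminf_mono)
      also have "\<dots> = 0"
      proof (rule lim_imp_Liminf)
        have "(\<lambda>n. 1 / real (Suc (r n))) \<longlonglongrightarrow> 0"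
          using LIMSEQ_subseq_LIMSEQ[OF LIMSEQ_Suc[OF lim_1_over_n] r(1)] by (simp add: o_def)
        from tendsto_ennrealI[OF this] show "(\<lambda>n. ennreal (1 / real (Suc (r n)))) \<longlonglongrightarrow> 0" by simp
      qed simp
      finally show ?thesis .
    qed
    finally have "emeasure (walk i) ?Z = 0" by simp
    then have "?Z \<in> null_sets (walk i)" using Z by auto
    then show ?thesis
      by (rule AE_I') (auto simp: space_\<mu>)
  qed
  from irreducible_not_annihilated[OF irr f y this] show False .
qed

text \<open>Let \<open>a\<close> be the largest entry of \<open>g\<close> in absolute value and
  \<open>f\<close> its row divided by \<open>a\<close>. In that row g v has the coordinate a f(v),
  while opnorm g \<le> d^2 |a|. So a margin \<open>e\<close> for \<open>f\<close> at h x gives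
  \<parallel>g h x\<parallel> \<ge> (e / d^2) \<parallel>g\<parallel> \<parallel>h x\<parallel>, and
  \<kappa> = ln (d^2 / e) is the same for all \<open>g\<close> and \<open>x\<close>.\<close>

lemma spread:
  assumes irr: "strongly_irreducible (\<Gamma> \<mu>)"
  obtains D :: nat and \<eta> \<kappa> :: real where "\<eta> > 0" "D \<ge> 1"
    "\<And>g x. g \<in> SL \<Longrightarrow> x \<noteq> 0 \<Longrightarrow>
      ennreal \<eta> \<le> (\<Sum>i<D. emeasure (walk i) {h \<in> SL. lognorm g - \<kappa> \<le> cocyc g (h *v x)})"
proof -
  obtain n :: nat where n: "\<And>y f. y \<in> normalized \<Longrightarrow> f \<in> normalized \<Longrightarrow>
    ennreal (1 / real (Suc n)) \<le> (\<Sum>i<Suc n. emeasure (walk i) (transversal (1 / real (Suc n)) f y))"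
    by (rule uniform_transversality[OF irr]) blast
  define e where "e = 1 / real (Suc n)"
  define \<kappa> where "\<kappa> = ln ((real CARD('d))\<^sup>2 / e)"
  have e: "e > 0" by (simp add: e_def)
  show ?thesis
  proof (rule that[of e "Suc n" \<kappa>])
    fix g :: "'k ^ 'd ^ 'd" and x :: "'k ^ 'd" assume g: "g \<in> SL" and x: "x \<noteq> 0"
    obtain i j where m: "\<And>i' j'. absv (g $ i' $ j') \<le> absv (g $ i $ j)" using exists_max_entry[of g] by blast
    define a where "a = g $ i $ j"
    have op: "opnorm g \<le> (real CARD('d))\<^sup>2 * absv a"
    proof (rule opnorm_least)
      fix v show "vnorm (g *v v) / vnorm v \<le> (real CARD('d))\<^sup>2 * absv a"
        using absv_matrix_vector_le[OF m, of v] vnorm_nonneg[of v]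
        by (cases "vnorm v = 0") (auto simp: divide_le_eq a_def)
    qed
    then have a0: "a \<noteq> 0" using opnorm_pos[OF g] by auto
    define f where "f = inverse (g $ i $ j) *s (g $ i)"
    have f: "f \<in> normalized" unfolding f_def using m[of i] a0 by (intro normalize) (auto simp: a_def)
    obtain l where l: "\<And>l'. absv (x $ l') \<le> absv (x $ l)" using exists_max_coordinate[of x] by blast
    have xl: "x $ l \<noteq> 0"
    proof
      assume "x $ l = 0"
      then have "x $ l' = 0" for l' using l[of l'] absv_nonneg[of "x $ l'"] by simp
      then show False using x by (simp add: vec_eq_iff)
    qed
    define y where "y = inverse (x $ l) *s x"
    have y: "y \<in> normalized" unfolding y_def by (rule normalize[OF l xl])
    have x_eq: "x = (x $ l) *s y" using xl by (simp add: y_def vec_eq_iff)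
    have "transversal e f y \<subseteq> {h \<in> SL. lognorm g - \<kappa> \<le> cocyc g (h *v x)}"
    proof
      fix h assume "h \<in> transversal e f y"
      then have h: "h \<in> SL" and le: "e * vnorm (h *v y) \<le> absv (dotp f (h *v y))"
        by (auto simp: transversal_def)
      have hx: "h *v x \<noteq> 0" by (rule SL_mult_nonzero[OF h x])
      have hxy: "h *v x = (x $ l) *s (h *v y)" by (subst x_eq) (simp add: vector_scalar_commute)
      have "(g *v (h *v x)) $ i = a * dotp f (h *v x)"
        using a0 by (simp add: matrix_vector_mult_def dotp_def f_def a_def sum_distrib_left mult.assoc[symmetric])
      then have "absv a * absv (dotp f (h *v x)) \<le> vnorm (g *v (h *v x))"
        using absv_le_vnorm[of "g *v (h *v x)" i] by (simp add: absv_mult)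
      moreover have "e * vnorm (h *v x) \<le> absv (dotp f (h *v x))"
        using mult_left_mono[OF le, of "absv (x $ l)"]
        by (simp add: hxy vnorm_scale dotp_scale absv_mult mult.left_commute)
      then have "absv a * (e * vnorm (h *v x)) \<le> absv a * absv (dotp f (h *v x))"
        by (rule mult_left_mono) simp
      ultimately have "absv a * e \<le> vnorm (g *v (h *v x)) / vnorm (h *v x)"
        using hx vnorm_pos[of "h *v x"] by (simp add: pos_le_divide_eq mult.assoc)
      moreover have "opnorm g / ((real CARD('d))\<^sup>2 / e) \<le> absv a * e"
        using op e by (simp add: field_simps)
      ultimately have "ln (opnorm g / ((real CARD('d))\<^sup>2 / e)) \<le> cocyc g (h *v x)"
        unfolding cocyc_def using opnorm_pos[OF g] e ratio_pos[OF g hx]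
        by (subst ln_le_cancel_iff) auto
      also have "ln (opnorm g / ((real CARD('d))\<^sup>2 / e)) = lognorm g - \<kappa>"
        unfolding lognorm_def \<kappa>_def using opnorm_pos[OF g] e by (intro ln_divide_pos) auto
      finally show "h \<in> {h \<in> SL. lognorm g - \<kappa> \<le> cocyc g (h *v x)}" using h by simp
    qed
    moreover have "{h \<in> SL. lognorm g - \<kappa> \<le> cocyc g (h *v x)} \<in> sets \<mu>"
      using measurable_sets[OF c_act_measurable_\<mu>[OF g x], of "{lognorm g - \<kappa>..}"]
      by (simp add: vimage_def Int_def space_\<mu> conj_commute)
    ultimately have "(\<Sum>i<Suc n. emeasure (walk i) (transversal e f y)) \<le>
        (\<Sum>i<Suc n. emeasure (walk i) {h \<in> SL. lognorm g - \<kappa> \<le> cocyc g (h *v x)})"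
      by (intro sum_mono emeasure_mono) auto
    then show "ennreal e \<le> (\<Sum>i<Suc n. emeasure (walk i) {h \<in> SL. lognorm g - \<kappa> \<le> cocyc g (h *v x)})"
      using n[OF y f] unfolding e_def by (rule order_trans[rotated])
  qed (use e in auto)
qed

end

section \<open>Products of independent matrices\<close>

lemma left_prod_cong:
  "(\<And>i. i \<in> {1..n} \<Longrightarrow> A i = B i) \<Longrightarrow> left_prod A n = left_prod B n"
  by (induction n) auto

context matrix_walk begin

text \<open>On the space of coordinate families, since independence of the next variable from the
  earlier ones is transported through a measurable function of the earlier coordinates.\<close>

lemma measurable_left_prod:
  "{1..n} \<subseteq> J \<Longrightarrow> (\<lambda>A. left_prod A n) \<in> measurable (PiM J (\<lambda>_. \<mu>)) \<mu>"
proof (induction n)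
  case 0
  then show ?case using one_in_space by simp
next
  case (Suc n)
  have "(\<lambda>A. left_prod A n) \<in> measurable (PiM J (\<lambda>_. \<mu>)) \<mu>"
    by (rule Suc.IH) (use Suc.prems in auto)
  moreover have "(\<lambda>A. A (Suc n)) \<in> measurable (PiM J (\<lambda>_. \<mu>)) \<mu>"
    by (rule measurable_component_singleton) (use Suc.prems in auto)
  ultimately have "(\<lambda>A. (A (Suc n), left_prod A n)) \<in> measurable (PiM J (\<lambda>_. \<mu>)) (\<mu> \<Otimes>\<^sub>M \<mu>)"
    by (intro measurable_Pair)
  from measurable_compose[OF this measurable_matrix_mult_\<mu>] show ?case by simp
qed

text \<open>The newest variable is independent of the product of the earlier ones, so the law of the
  longer product is the pushforward in the recursion of \<open>walk\<close>.\<close>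

lemma law_left_prod:
  assumes iid: "iid_sequence P \<mu> X"
  shows "(\<lambda>\<omega>. left_prod (\<lambda>i. X i \<omega>) n) \<in> measurable P \<mu> \<and>
    distr P \<mu> (\<lambda>\<omega>. left_prod (\<lambda>i. X i \<omega>) n) = walk n"
proof (induction n)
  case 0
  interpret P: prob_space P using iid by (simp add: iid_sequence_def)
  show ?case using one_in_space by (simp add: P.distr_const)
next
  case (Suc n)
  interpret P: prob_space P using iid by (simp add: iid_sequence_def)
  let ?S = "\<lambda>\<omega>. left_prod (\<lambda>i. X i \<omega>) n"
  have indep: "P.indep_vars (\<lambda>_. \<mu>) X {1..}" and law: "distr P \<mu> (X (Suc n)) = \<mu>"
    using iid by (auto simp: iid_sequence_def)
  have "P.indep_var (PiM {Suc n} (\<lambda>_. \<mu>)) (\<lambda>\<omega>. restrict (\<lambda>i. X i \<omega>) {Suc n})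
      (PiM {1..n} (\<lambda>_. \<mu>)) (\<lambda>\<omega>. restrict (\<lambda>i. X i \<omega>) {1..n})"
    by (rule P.indep_var_restrict[OF indep]) auto
  from P.indep_var_compose[OF this measurable_component_singleton[of "Suc n" "{Suc n}" "\<lambda>_. \<mu>"]
      measurable_left_prod[of n "{1..n}"]]
  have "P.indep_var \<mu> (X (Suc n)) \<mu> (\<lambda>\<omega>. left_prod (restrict (\<lambda>i. X i \<omega>) {1..n}) n)"
    by (simp add: o_def)
  also have "(\<lambda>\<omega>. left_prod (restrict (\<lambda>i. X i \<omega>) {1..n}) n) = ?S"
    by (intro ext left_prod_cong) simp
  finally have "P.indep_var \<mu> (X (Suc n)) \<mu> ?S" .
  then have X: "X (Suc n) \<in> measurable P \<mu>" and S: "?S \<in> measurable P \<mu>"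
    and joint: "distr P \<mu> (X (Suc n)) \<Otimes>\<^sub>M distr P \<mu> ?S = distr P (\<mu> \<Otimes>\<^sub>M \<mu>) (\<lambda>\<omega>. (X (Suc n) \<omega>, ?S \<omega>))"
    unfolding P.indep_var_distribution_eq by auto
  have pair: "(\<lambda>\<omega>. (X (Suc n) \<omega>, ?S \<omega>)) \<in> measurable P (\<mu> \<Otimes>\<^sub>M \<mu>)"
    using X S by (rule measurable_Pair)
  have "(\<lambda>\<omega>. X (Suc n) \<omega> ** ?S \<omega>) \<in> measurable P \<mu>"
    using measurable_compose[OF pair measurable_matrix_mult_\<mu>] by simp
  moreover have "distr P \<mu> (\<lambda>\<omega>. X (Suc n) \<omega> ** ?S \<omega>) =
      distr (distr P (\<mu> \<Otimes>\<^sub>M \<mu>) (\<lambda>\<omega>. (X (Suc n) \<omega>, ?S \<omega>))) \<mu> (\<lambda>(g, h). g ** h)"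
    using pair measurable_matrix_mult_\<mu> by (simp add: distr_distr o_def)
  moreover have "\<dots> = walk (Suc n)"
    using joint law Suc.IH by simp
  ultimately show ?case by simp
qed

section \<open>From laws back to random variables: moments and tails\<close>

lemma ratio_powr:
  assumes g: "g \<in> SL" and x: "vnorm x = 1"
  shows "(opnorm g / vnorm (g *v x)) powr \<epsilon> = exp (\<epsilon> * (lognorm g - cocyc g x))"
proof -
  have x0: "x \<noteq> 0" using x vnorm_eq_0[of x] by auto
  have "ln (opnorm g / vnorm (g *v x)) = lognorm g - cocyc g x"
    using opnorm_pos[OF g] ratio_pos[OF g x0] x by (simp add: lognorm_def cocyc_def ln_divide_pos)
  moreover have "opnorm g \<noteq> 0" "vnorm (g *v x) \<noteq> 0"
    using opnorm_pos[OF g] ratio_pos[OF g x0] by auto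
  ultimately show ?thesis by (simp add: powr_def)
qed

lemma nn_integral_ratio:
  fixes n :: nat
  assumes iid: "iid_sequence P \<mu> X" and x: "vnorm x = 1"
  defines "S \<equiv> \<lambda>\<omega>. left_prod (\<lambda>i. X i \<omega>) n"
  shows "(\<integral>\<^sup>+ \<omega>. ennreal ((opnorm (S \<omega>) / vnorm (S \<omega> *v x)) powr \<epsilon>) \<partial>P) =
    (\<integral>\<^sup>+ g. ennreal (exp (\<epsilon> * (lognorm g - cocyc g x))) \<partial>walk n)"
    and "(\<lambda>\<omega>. ennreal ((opnorm (S \<omega>) / vnorm (S \<omega> *v x)) powr \<epsilon>)) \<in> borel_measurable P"
proof -
  have S: "S \<in> measurable P \<mu>" and law: "distr P \<mu> S = walk n"
    using law_left_prod[OF iid, of n] by (simp_all add: S_def)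
  have F: "(\<lambda>g. ennreal (exp (\<epsilon> * (lognorm g - cocyc g x)))) \<in> borel_measurable \<mu>"
    using lognorm_measurable cocyc_measurable[of x] by measurable
  have eq: "ennreal ((opnorm (S \<omega>) / vnorm (S \<omega> *v x)) powr \<epsilon>) =
      ennreal (exp (\<epsilon> * (lognorm (S \<omega>) - cocyc (S \<omega>) x)))" if "\<omega> \<in> space P" for \<omega>
    using ratio_powr[OF _ x] measurable_space[OF S that] by (simp add: space_\<mu>)
  have "(\<integral>\<^sup>+ \<omega>. ennreal ((opnorm (S \<omega>) / vnorm (S \<omega> *v x)) powr \<epsilon>) \<partial>P) =
      (\<integral>\<^sup>+ \<omega>. ennreal (exp (\<epsilon> * (lognorm (S \<omega>) - cocyc (S \<omega>) x))) \<partial>P)"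
    by (rule nn_integral_cong) (rule eq)
  also have "\<dots> = (\<integral>\<^sup>+ g. ennreal (exp (\<epsilon> * (lognorm g - cocyc g x))) \<partial>distr P \<mu> S)"
    by (rule nn_integral_distr[OF S, symmetric]) (use F in simp)
  finally show "(\<integral>\<^sup>+ \<omega>. ennreal ((opnorm (S \<omega>) / vnorm (S \<omega> *v x)) powr \<epsilon>) \<partial>P) =
    (\<integral>\<^sup>+ g. ennreal (exp (\<epsilon> * (lognorm g - cocyc g x))) \<partial>walk n)"
    unfolding law .
  show "(\<lambda>\<omega>. ennreal ((opnorm (S \<omega>) / vnorm (S \<omega> *v x)) powr \<epsilon>)) \<in> borel_measurable P"
    using measurable_compose[OF S F] by (subst measurable_cong[OF eq])
qed

end

lemma (in prob_space) prob_ge_le_exp_moment: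
  fixes R :: "'a \<Rightarrow> real"
  assumes meas: "(\<lambda>\<omega>. ennreal (R \<omega> powr s)) \<in> borel_measurable M" and s: "s > 0"
    and moment: "(\<integral>\<^sup>+ \<omega>. ennreal (R \<omega> powr s) \<partial>M) \<le> ennreal B" and B: "B \<ge> 0"
  shows "prob {\<omega> \<in> space M. R \<omega> \<ge> exp a} \<le> exp (- (s * a)) * B"
proof (cases "{\<omega> \<in> space M. R \<omega> \<ge> exp a} \<in> events")
  case True
  let ?E = "{\<omega> \<in> space M. R \<omega> \<ge> exp a}"
  have "emeasure M ?E = (\<integral>\<^sup>+ \<omega>. indicator ?E \<omega> \<partial>M)" using True by simp
  also have "\<dots> \<le> (\<integral>\<^sup>+ \<omega>. ennreal (exp (- (s * a))) * ennreal (R \<omega> powr s) \<partial>M)"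
  proof (rule nn_integral_mono)
    fix \<omega>
    show "indicator ?E \<omega> \<le> ennreal (exp (- (s * a))) * ennreal (R \<omega> powr s)"
    proof (cases "\<omega> \<in> ?E")
      case True
      then have "exp a powr s \<le> R \<omega> powr s" using s by (intro powr_mono2) auto
      then have "exp (- (s * a)) * exp (s * a) \<le> exp (- (s * a)) * R \<omega> powr s"
        by (intro mult_left_mono) (auto simp: powr_def)
      then have "1 \<le> exp (- (s * a)) * R \<omega> powr s" by (simp add: exp_minus_inverse mult.commute)
      then show ?thesis using True
        by (simp add: ennreal_mult[symmetric] ennreal_1[symmetric] ennreal_leI del: ennreal_1)
    qed simp
  qed
  also have "\<dots> = ennreal (exp (- (s * a))) * (\<integral>\<^sup>+ \<omega>. ennreal (R \<omega> powr s) \<partial>M)"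
    by (rule nn_integral_cmult[OF meas])
  also have "\<dots> \<le> ennreal (exp (- (s * a))) * ennreal B" by (intro mult_left_mono moment) simp
  also have "\<dots> = ennreal (exp (- (s * a)) * B)" using B by (simp add: ennreal_mult)
  finally have "ennreal (prob ?E) \<le> ennreal (exp (- (s * a)) * B)" by (simp add: emeasure_eq_measure)
  moreover have "0 \<le> exp (- (s * a)) * B" using B by simp
  ultimately show ?thesis using ennreal_le_iff by blast
\<comment> \<open>Measurability is assumed of the power of \<open>R\<close>; if the set is not an
  event, \<open>measure\<close> gives it the value 0.\<close>
qed (use B in \<open>simp add: measure_notin_sets\<close>)

context matrix_walk begin

theorem ratio_moment_and_tail:
  fixes S :: "nat \<Rightarrow> 'w \<Rightarrow> 'k ^ 'd ^ 'd"
  assumes irr: "strongly_irreducible (\<Gamma> \<mu>)" and iid: "iid_sequence P \<mu> X"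
    and S_def: "\<And>n \<omega>. S n \<omega> = left_prod (\<lambda>i. X i \<omega>) n"
  shows "(\<forall>\<gamma>>0. \<exists>\<epsilon>0>0. \<exists>n0>0. \<forall>\<epsilon> n. 0 < \<epsilon> \<and> \<epsilon> < \<epsilon>0 \<and> n > n0 \<longrightarrow>
            (SUP x\<in>{x. vnorm x = 1}.
               \<integral>\<^sup>+ \<omega>. ennreal ((opnorm (S n \<omega>) / vnorm (S n \<omega> *v x)) powr \<epsilon>) \<partial>P)
            \<le> ennreal ((1 + \<epsilon> * \<gamma>) ^ n)) \<and>
         (\<forall>\<epsilon>>0. limsup (\<lambda>n. ereal (
            (SUP x\<in>{x. vnorm x = 1}.
               measure P {\<omega> \<in> space P. opnorm (S n \<omega>) / vnorm (S n \<omega> *v x) \<ge> exp (real n * \<epsilon>)})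
            powr (1 / real n))) < 1)"
proof -
  interpret P: prob_space P using iid by (simp add: iid_sequence_def)
  obtain D :: nat and \<eta> \<kappa> :: real where \<eta>: "\<eta> > 0" and D: "D \<ge> 1"
    and spread: "\<And>g x. g \<in> SL \<Longrightarrow> x \<noteq> 0 \<Longrightarrow>
      ennreal \<eta> \<le> (\<Sum>i<D. emeasure (walk i) {h \<in> SL. lognorm g - \<kappa> \<le> cocyc g (h *v x)})"
    by (rule spread[OF irr]) blast
  \<comment> \<open>For each unit vector separately, with common thresholds: the tail estimate uses
    this pointwise form, and the supremum is taken at the end.\<close>
  have moments: "\<exists>\<epsilon>0>0. \<exists>n0>0. \<forall>\<epsilon> n x. 0 < \<epsilon> \<and> \<epsilon> < \<epsilon>0 \<and> n > n0 \<and> vnorm x = 1 \<longrightarrow>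
      (\<integral>\<^sup>+ \<omega>. ennreal ((opnorm (S n \<omega>) / vnorm (S n \<omega> *v x)) powr \<epsilon>) \<partial>P) \<le> ennreal ((1 + \<epsilon> * \<gamma>) ^ n)"
    if \<gamma>: "\<gamma> > 0" for \<gamma>
  proof -
    have "\<And>g x. g \<in> space \<mu> \<Longrightarrow> x \<in> {x. x \<noteq> 0} \<Longrightarrow>
      ennreal \<eta> \<le> (\<Sum>i<D. emeasure (walk i) {h \<in> space \<mu>. lognorm g - \<kappa> \<le> cocyc g (h *v x)})"
      using spread unfolding space_\<mu> by blast
    then obtain \<epsilon>0 n0 where "\<epsilon>0 > 0" "n0 > 0"
      and main: "\<And>\<epsilon> n x. 0 < \<epsilon> \<Longrightarrow> \<epsilon> < \<epsilon>0 \<Longrightarrow> n > n0 \<Longrightarrow> x \<in> {x. x \<noteq> 0} \<Longrightarrow>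
        (\<integral>\<^sup>+g. ennreal (exp (\<epsilon> * (lognorm g - cocyc g x))) \<partial>walk n) \<le> ennreal ((1 + \<epsilon> * \<gamma>) ^ n)"
      by (rule exp_moment_ratio[OF \<eta> D _ \<gamma>]) blast+
    moreover have "(\<integral>\<^sup>+ \<omega>. ennreal ((opnorm (S n \<omega>) / vnorm (S n \<omega> *v x)) powr \<epsilon>) \<partial>P) \<le> ennreal ((1 + \<epsilon> * \<gamma>) ^ n)"
      if "0 < \<epsilon>" "\<epsilon> < \<epsilon>0" "n > n0" "vnorm x = 1" for \<epsilon> n x
    proof -
      have "x \<in> {x. x \<noteq> 0}" using that(4) vnorm_eq_0[of x] by auto
      from main[OF that(1-3) this] show ?thesis
        unfolding S_def nn_integral_ratio(1)[OF iid that(4)] .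
    qed
    ultimately show ?thesis by blast
  qed
  have tail: "limsup (\<lambda>n. ereal ((SUP x\<in>{x. vnorm x = 1}.
      measure P {\<omega> \<in> space P. opnorm (S n \<omega>) / vnorm (S n \<omega> *v x) \<ge> exp (real n * \<epsilon>)}) powr (1 / real n))) < 1"
    if \<epsilon>: "\<epsilon> > 0" for \<epsilon>
  proof -
    obtain \<epsilon>0 n0 where e0: "\<epsilon>0 > 0" "n0 > 0" and m: "\<And>s n x. 0 < s \<Longrightarrow> s < \<epsilon>0 \<Longrightarrow> n > n0 \<Longrightarrow> vnorm x = 1 \<Longrightarrow>
      (\<integral>\<^sup>+ \<omega>. ennreal ((opnorm (S n \<omega>) / vnorm (S n \<omega> *v x)) powr s) \<partial>P) \<le> ennreal ((1 + s * (\<epsilon> / 2)) ^ n)"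
      using moments[of "\<epsilon> / 2"] \<epsilon> by auto
    define s where "s = \<epsilon>0 / 2"
    have s: "0 < s" "s < \<epsilon>0" using e0 by (simp_all add: s_def)
    \<comment> \<open>exp (- s \<epsilon>) (1 + s \<epsilon> / 2) \<le> exp (- s \<epsilon> / 2):
      with \<gamma> = \<epsilon> / 2 in the moment bound, half of the Chernoff exponent
      survives.\<close>
    define q where "q = exp (- (s * \<epsilon> / 2))"
    have q: "0 < q" "q < 1" using s \<epsilon> by (simp_all add: q_def)
    let ?p = "\<lambda>n x. measure P {\<omega> \<in> space P. opnorm (S n \<omega>) / vnorm (S n \<omega> *v x) \<ge> exp (real n * \<epsilon>)}"
    have p: "?p n x \<le> q ^ n" if n: "n > n0" and x: "vnorm x = 1" for n x
    proof -
      have "?p n x \<le> exp (- (s * (real n * \<epsilon>))) * (1 + s * (\<epsilon> / 2)) ^ n"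
        using nn_integral_ratio(2)[OF iid x, of n s] m[OF s n x] s \<epsilon>
        unfolding S_def by (intro P.prob_ge_le_exp_moment) auto
      also have "\<dots> \<le> exp (- (s * (real n * \<epsilon>))) * exp (s * (\<epsilon> / 2)) ^ n"
        using s \<epsilon> by (intro mult_left_mono power_mono exp_ge_add_one_self) auto
      also have "\<dots> = q ^ n"
        by (simp add: q_def exp_of_nat_mult[symmetric] exp_add[symmetric])
      finally show ?thesis .
    qed
    have ne: "{x :: 'k ^ 'd. vnorm x = 1} \<noteq> {}" using vnorm_axis by blast
    have "eventually (\<lambda>n. ereal ((SUP x\<in>{x. vnorm x = 1}. ?p n x) powr (1 / real n)) \<le> ereal q) sequentially"
      using eventually_gt_at_top[of n0]
    proof (rule eventually_mono)
      fix n assume n: "n0 < n"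
      let ?s = "SUP x\<in>{x. vnorm x = 1}. ?p n x"
      have le: "?s \<le> q ^ n" using p[OF n] ne by (intro cSUP_least) auto
      obtain x :: "'k ^ 'd" where x: "vnorm x = 1" using ne by blast
      \<comment> \<open>A real supremum has its meaning for bounded non-empty sets; its
        nonnegativity is what monotonicity of \<open>powr\<close> asks for.\<close>
      have "bdd_above (?p n ` {x. vnorm x = 1})" by (intro bdd_aboveI2[of _ _ 1]) simp
      then have "?p n x \<le> ?s" using x by (intro cSUP_upper) auto
      then have nn: "0 \<le> ?s" by (rule order_trans[OF measure_nonneg])
      have "?s powr (1 / real n) \<le> (q ^ n) powr (1 / real n)"
        using le nn by (intro powr_mono2) auto
      also have "\<dots> = q"
        using q(1) n by (simp add: powr_realpow[symmetric] powr_powr)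
      finally show "ereal (?s powr (1 / real n)) \<le> ereal q" by simp
    qed
    then have "limsup (\<lambda>n. ereal ((SUP x\<in>{x. vnorm x = 1}. ?p n x) powr (1 / real n))) \<le> ereal q"
      by (rule Limsup_bounded)
    also have "ereal q < 1" using q(2) by simp
    finally show ?thesis .
  qed
  show ?thesis
  proof (intro conjI allI impI tail)
    fix \<gamma> :: real assume "0 < \<gamma>"
    from moments[OF this] obtain \<epsilon>0 n0 where "\<epsilon>0 > 0" "n0 > 0"
      and m: "\<And>\<epsilon> n x. 0 < \<epsilon> \<Longrightarrow> \<epsilon> < \<epsilon>0 \<Longrightarrow> n > n0 \<Longrightarrow> vnorm x = 1 \<Longrightarrow>
        (\<integral>\<^sup>+ \<omega>. ennreal ((opnorm (S n \<omega>) / vnorm (S n \<omega> *v x)) powr \<epsilon>) \<partial>P) \<le> ennreal ((1 + \<epsilon> * \<gamma>) ^ n)"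
      by blast
    moreover have "(SUP x\<in>{x. vnorm x = 1}.
          \<integral>\<^sup>+ \<omega>. ennreal ((opnorm (S n \<omega>) / vnorm (S n \<omega> *v x)) powr \<epsilon>) \<partial>P)
        \<le> ennreal ((1 + \<epsilon> * \<gamma>) ^ n)" if "0 < \<epsilon> \<and> \<epsilon> < \<epsilon>0 \<and> n > n0" for \<epsilon> n
      using that by (intro SUP_least m) auto
    ultimately show "\<exists>\<epsilon>0>0. \<exists>n0>0. \<forall>\<epsilon> n. 0 < \<epsilon> \<and> \<epsilon> < \<epsilon>0 \<and> n > n0 \<longrightarrow>
            (SUP x\<in>{x. vnorm x = 1}.
               \<integral>\<^sup>+ \<omega>. ennreal ((opnorm (S n \<omega>) / vnorm (S n \<omega> *v x)) powr \<epsilon>) \<partial>P)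
            \<le> ennreal ((1 + \<epsilon> * \<gamma>) ^ n)"
      by blast
  qed
qed

end

theorem proposition4p14:
  fixes \<mu> :: "('k::valued_field ^ 'd ^ 'd) measure"
    and P :: "'w measure"
    and X :: "nat \<Rightarrow> 'w \<Rightarrow> 'k ^ 'd ^ 'd"
    and S :: "nat \<Rightarrow> 'w \<Rightarrow> 'k ^ 'd ^ 'd"
  assumes "local_field TYPE('k)"
    and "CARD('d) \<ge> 2"
    and "prob_measure_on_SL \<mu>"
    and "exp_local_moment \<mu>"
    and "strongly_irreducible (\<Gamma> \<mu>)"
    and "iid_sequence P \<mu> X"
    and S_def: "\<And>n \<omega>. S n \<omega> = left_prod (\<lambda>i. X i \<omega>) n"
  shows "(\<forall>\<gamma>>0. \<exists>\<epsilon>0>0. \<exists>n0>0. \<forall>\<epsilon> n. 0 < \<epsilon> \<and> \<epsilon> < \<epsilon>0 \<and> n > n0 \<longrightarrow>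
            (SUP x\<in>{x. vnorm x = 1}.
               \<integral>\<^sup>+ \<omega>. ennreal ((opnorm (S n \<omega>) / vnorm (S n \<omega> *v x)) powr \<epsilon>) \<partial>P)
            \<le> ennreal ((1 + \<epsilon> * \<gamma>) ^ n)) \<and>
         (\<forall>\<epsilon>>0. limsup (\<lambda>n. ereal (
            (SUP x\<in>{x. vnorm x = 1}.
               measure P {\<omega> \<in> space P. opnorm (S n \<omega>) / vnorm (S n \<omega> *v x) \<ge> exp (real n * \<epsilon>)})
            powr (1 / real n))) < 1)"
proof -
  obtain \<tau> where \<tau>: "\<tau> > 0" "(\<integral>\<^sup>+ g. ennreal (opnorm g powr \<tau>) \<partial>\<mu>) < \<infinity>"
    using assms(4) unfolding exp_local_moment_def by (elim exE conjE)
  have "matrix_walk \<mu> \<tau>"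
    by (rule matrix_walk.intro[OF compact_balls_local_field[OF assms(1)] assms(3) \<tau>])
  from matrix_walk.ratio_moment_and_tail[OF this assms(5,6) S_def] show ?thesis .
qed

end
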